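(* On any almost Kähler manifold $M$ the following identities of operators on $\Gamma(\mathbb{C}l(M))$ hold: $$\{\mathfrak D,\mathcal L\}=0,\qquad \{\overline{\mathfrak D},\overline{\mathcal L}\}=0,\qquad \{\mathfrak D,\overline{\mathcal L}\}=\mathfrak D^{\star},\qquad \{\overline{\mathfrak D},\mathcal L\}=\overline{\mathfrak D}^{\star},\qquad [\mathcal H,\mathfrak D]=\mathfrak D.$$
   Context: Almost Kähler manifold: a smooth manifold $M$ of real dimension $2n$ with a Riemannian metric $\langle\cdot,\cdot\rangle$ and an orthogonal almost complex structure $J$ such that $\omega(X,Y)=\langle JX,Y\rangle$ satisfies $d\omega=0$. $Cl(M)$ is the bundle $\Lambda(TM)\cong\Lambda(T^*M)$ (identified by the metric) with Clifford multiplication determined by $v\cdot\varphi=v\wedge\varphi-v\lrcorner\varphi$ for tangent vectors $v$, where $v\lrcorner$ is the adjoint of $v\wedge$. $\mathbb{C}l(M)=Cl(M)\otimes\mathbb{C}$. $J_{\mathrm{alg}}$ denotes the extension of $J$ to $\mathbb{C}l(M)$ as an algebra automorphism. $\star$ is the transpose, i.e. the complex-linear algebra anti-automorphism with $\star(v_1\cdots v_p)=v_p\cdots v_1$. For an operator $T$: $T_c=J_{\mathrm{alg}}^{-1}TJ_{\mathrm{alg}}$, $T^{\star}=\star T\star$. $[S,T]=ST-TS$ and $\{S,T\}=ST+TS$. For a local $J$-adapted orthonormal frame $e_1,\dots,e_n,Je_1,\dots,Je_n$ put $\epsilon_k=\tfrac12(e_k-iJe_k)$, $\bar\epsilon_k=\tfrac12(e_k+iJe_k)$,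 $\mathcal L(\varphi)=-\sum_k\epsilon_k\cdot\varphi\cdot\bar\epsilon_k$, $\overline{\mathcal L}(\varphi)=-\sum_k\bar\epsilon_k\cdot\varphi\cdot\epsilon_k$, $\mathcal H=[\mathcal L,\overline{\mathcal L}]$. $\widetilde D=\sum_j v_j\cdot\widetilde\nabla_{v_j}$ ($v_1,\dots,v_{2n}$ a local orthonormal frame) is the Dirac operator of the Levi-Civita connection $\widetilde\nabla$, extended as a derivation to $Cl(M)$. Put $\mathfrak D=\tfrac12(\widetilde D+i\widetilde D_c)$, $\overline{\mathfrak D}=\tfrac12(\widetilde D-i\widetilde D_c)$. *)

theory Defs
  imports "HOL-Analysis.Analysis" "HOL-Library.Function_Algebras"
begin

section \<open>Smooth manifolds\<close>

text \<open>
  Smoothness of a map on an open subset of a Euclidean space: all iterated directional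
  derivatives exist and are continuous.
\<close>

primrec C_on :: "nat \<Rightarrow> ('a::euclidean_space \<Rightarrow> 'b::real_normed_vector) \<Rightarrow> 'a set \<Rightarrow> bool" where
  "C_on 0 f S \<longleftrightarrow> continuous_on S f"
| "C_on (Suc k) f S \<longleftrightarrow>
     (\<forall>x\<in>S. f differentiable (at x)) \<and> (\<forall>u. C_on k (\<lambda>x. frechet_derivative f (at x) u) S)"

definition smooth_on :: "'a::euclidean_space set \<Rightarrow> ('a \<Rightarrow> 'b::real_normed_vector) \<Rightarrow> bool" where
  "smooth_on S f \<longleftrightarrow> (\<forall>k. C_on k f S)"

text \<open>A chart is a pair of its domain \<open>U\<close> and its coordinate map, of which only the values on \<open>U\<close> matter.\<close>

type_synonym ('p, 'e) chart = "'p set \<times> ('p \<Rightarrow> 'e)"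

definition target :: "('p, 'e) chart \<Rightarrow> 'e set" where
  "target c = snd c ` fst c"

definition transition :: "('p, 'e) chart \<Rightarrow> ('p, 'e) chart \<Rightarrow> 'e \<Rightarrow> 'e" where
  "transition c c' = snd c' \<circ> inv_into (fst c) (snd c)"

definition second_countable_space :: "'p topology \<Rightarrow> bool" where
  "second_countable_space X \<longleftrightarrow>
     (\<exists>\<B>. countable \<B> \<and> (\<forall>B\<in>\<B>. openin X B) \<and>
       (\<forall>U x. openin X U \<and> x \<in> U \<longrightarrow> (\<exists>B\<in>\<B>. x \<in> B \<and> B \<subseteq> U)))"

definition smooth_manifold :: "'p topology \<Rightarrow> ('p, 'e::euclidean_space) chart set \<Rightarrow> bool" where
  "smooth_manifold X A \<longleftrightarrow>
     Hausdorff_space X \<and> second_countable_space X \<and> (\<Union>c\<in>A. fst c) = topspace X \<and>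
     (\<forall>c\<in>A. openin X (fst c) \<and> open (target c) \<and>
        homeomorphic_map (subtopology X (fst c)) (top_of_set (target c)) (snd c)) \<and>
     (\<forall>c\<in>A. \<forall>c'\<in>A. smooth_on (snd c ` (fst c \<inter> fst c')) (transition c c'))"

text \<open>
  The derivative at \<open>x\<close> of the change of coordinates from \<open>c\<close> to \<open>c'\<close>.  A tangent vector at a
  point \<open>p\<close> is represented in each chart around \<open>p\<close> by a vector of the model space, and
  these representatives are related by this map.  Tensor fields are given by their
  representatives in all charts of the atlas: \<open>T c x\<close> is the representative in the chart \<open>c\<close>
  at the point with coordinates \<open>x\<close>.
\<close>

definition change :: "('p, 'e::euclidean_space) chart \<Rightarrow> ('p, 'e) chart \<Rightarrow> 'e \<Rightarrow> 'e \<Rightarrow> 'e" where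
  "change c c' x = frechet_derivative (transition c c') (at x)"

type_synonym 'e metric = "'e \<Rightarrow> 'e \<Rightarrow> 'e \<Rightarrow> real"
type_synonym 'e endo = "'e \<Rightarrow> 'e \<Rightarrow> 'e"

definition inner_prod :: "('e::real_vector \<Rightarrow> 'e \<Rightarrow> real) \<Rightarrow> bool" where
  "inner_prod G \<longleftrightarrow> bilinear G \<and> (\<forall>u v. G u v = G v u) \<and> (\<forall>u. u \<noteq> 0 \<longrightarrow> 0 < G u u)"

definition riemannian_metric ::
  "('p, 'e::euclidean_space) chart set \<Rightarrow> (('p, 'e) chart \<Rightarrow> 'e metric) \<Rightarrow> bool" where
  "riemannian_metric A g \<longleftrightarrow>
     (\<forall>c\<in>A. (\<forall>x\<in>target c. inner_prod (g c x)) \<and> (\<forall>u v. smooth_on (target c) (\<lambda>x. g c x u v))) \<and>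
     (\<forall>c\<in>A. \<forall>c'\<in>A. \<forall>p \<in> fst c \<inter> fst c'. \<forall>u v.
        g c (snd c p) u v = g c' (snd c' p) (change c c' (snd c p) u) (change c c' (snd c p) v))"

definition almost_complex_structure ::
  "('p, 'e::euclidean_space) chart set \<Rightarrow> (('p, 'e) chart \<Rightarrow> 'e endo) \<Rightarrow> bool" where
  "almost_complex_structure A J \<longleftrightarrow>
     (\<forall>c\<in>A. (\<forall>x\<in>target c. linear (J c x) \<and> (\<forall>u. J c x (J c x u) = - u)) \<and>
            (\<forall>u. smooth_on (target c) (\<lambda>x. J c x u))) \<and>
     (\<forall>c\<in>A. \<forall>c'\<in>A. \<forall>p \<in> fst c \<inter> fst c'. \<forall>u.
        change c c' (snd c p) (J c (snd c p) u) = J c' (snd c' p) (change c c' (snd c p) u))"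

section \<open>Exterior forms\<close>

text \<open>
  A (mixed degree) form is a function on lists of vectors; its restriction to lists of length \<open>k\<close>
  is the component of degree \<open>k\<close>.
\<close>

definition remove_nth :: "nat \<Rightarrow> 'a list \<Rightarrow> 'a list" where
  "remove_nth i ws = take i ws @ drop (Suc i) ws"

definition alt_form :: "('e::real_vector list \<Rightarrow> 'b::real_vector) \<Rightarrow> bool" where
  "alt_form \<phi> \<longleftrightarrow>
     (\<forall>us ws. linear (\<lambda>v. \<phi> (us @ v # ws))) \<and>
     (\<forall>us v vs ws. \<phi> (us @ v # vs @ v # ws) = 0)"

text \<open>
  The exterior derivative in coordinates, evaluated on constant (hence commuting) vector fields.
\<close>

definition ext_deriv :: "('e::euclidean_space \<Rightarrow> 'e list \<Rightarrow> 'b::real_normed_vector) \<Rightarrow> 'e \<Rightarrow> 'e list \<Rightarrow> 'b" where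
  "ext_deriv \<alpha> x ws =
     (\<Sum>i<length ws. (-1) ^ i *\<^sub>R frechet_derivative (\<lambda>y. \<alpha> y (remove_nth i ws)) (at x) (ws ! i))"

definition fundamental_form :: "'e metric \<Rightarrow> 'e endo \<Rightarrow> 'e \<Rightarrow> 'e list \<Rightarrow> real" where
  "fundamental_form g J x ws = (case ws of [u, v] \<Rightarrow> g x (J x u) v | _ \<Rightarrow> 0)"

definition almost_kaehler ::
  "'p topology \<Rightarrow> ('p, 'e::euclidean_space) chart set \<Rightarrow>
   (('p, 'e) chart \<Rightarrow> 'e metric) \<Rightarrow> (('p, 'e) chart \<Rightarrow> 'e endo) \<Rightarrow> bool" where
  "almost_kaehler X A g J \<longleftrightarrow>
     even DIM('e) \<and> smooth_manifold X A \<and> riemannian_metric A g \<and> almost_complex_structure A J \<and>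
     (\<forall>c\<in>A. \<forall>x\<in>target c. \<forall>u v. g c x (J c x u) (J c x v) = g c x u v) \<and>
     (\<forall>c\<in>A. \<forall>x\<in>target c. \<forall>ws. ext_deriv (fundamental_form (g c) (J c)) x ws = 0)"

section \<open>The complex Clifford algebra of a tangent space\<close>

text \<open>
  The fibre of the complexified Clifford bundle is the space of complex valued alternating forms
  on the tangent space, i.e. the complexified exterior algebra with \<open>\<Lambda>(TM)\<close> identified with
  \<open>\<Lambda>(T\<^sup>*M)\<close> by the metric.  Here \<open>G\<close> is the inner product of the tangent space.
\<close>

type_synonym 'e form = "'e list \<Rightarrow> complex"

definition cscale :: "complex \<Rightarrow> 'e form \<Rightarrow> 'e form" (infixr "\<odot>" 75) where
  "a \<odot> \<phi> = (\<lambda>ws. a * \<phi> ws)"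

definition unit_form :: "'e form" where
  "unit_form ws = (if ws = [] then 1 else 0)"

definition vec_form :: "('e \<Rightarrow> 'e \<Rightarrow> real) \<Rightarrow> 'e \<Rightarrow> 'e form" where
  "vec_form G v ws = (case ws of [w] \<Rightarrow> of_real (G v w) | _ \<Rightarrow> 0)"

definition wedge :: "('e \<Rightarrow> 'e \<Rightarrow> real) \<Rightarrow> 'e \<Rightarrow> 'e form \<Rightarrow> 'e form" where
  "wedge G v \<phi> ws = (\<Sum>i<length ws. (-1) ^ i * of_real (G v (ws ! i)) * \<phi> (remove_nth i ws))"

definition contract :: "'e \<Rightarrow> 'e form \<Rightarrow> 'e form" where
  "contract v \<phi> ws = \<phi> (v # ws)"

definition onb :: "('e::euclidean_space \<Rightarrow> 'e \<Rightarrow> real) \<Rightarrow> 'e set \<Rightarrow> bool" where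
  "onb G E \<longleftrightarrow> finite E \<and> card E = DIM('e) \<and> (\<forall>u\<in>E. \<forall>v\<in>E. G u v = (if u = v then 1 else 0))"

text \<open>
  The inner product on forms induced by \<open>G\<close>, for an orthonormal basis \<open>E\<close>.  The sum runs over
  all orderings of the subsets of \<open>E\<close>, whence the factorial.
\<close>

definition form_inner :: "'e set \<Rightarrow> 'e form \<Rightarrow> 'e form \<Rightarrow> complex" where
  "form_inner E \<phi> \<psi> =
     (\<Sum>ws | distinct ws \<and> set ws \<subseteq> E. \<phi> ws * cnj (\<psi> ws) / of_nat (fact (length ws)))"

lemma alt_form_swap:
  assumes "alt_form \<phi>"
  shows "\<phi> (us @ v # w # ws) = - \<phi> (us @ w # v # ws)"
proof -
  have lin: "linear (\<lambda>v. \<phi> (us @ v # ws))" for us ws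
    using assms by (simp add: alt_form_def)
  have z: "\<phi> (us @ a # a # ws) = 0" for a
    using assms unfolding alt_form_def by (metis append_Nil)
  have "0 = \<phi> (us @ (v + w) # (v + w) # ws)"
    using z by simp
  also have "\<dots> = \<phi> (us @ v # (v + w) # ws) + \<phi> (us @ w # (v + w) # ws)"
    using linear_add[OF lin[of us "(v + w) # ws"]] by simp
  also have "\<dots> = \<phi> (us @ v # w # ws) + \<phi> (us @ w # v # ws)"
    using linear_add[OF lin[of "us @ [v]" ws]] linear_add[OF lin[of "us @ [w]" ws]] z by simp
  finally have "\<phi> (us @ v # w # ws) + \<phi> (us @ w # v # ws) = 0"
    by simp
  then show ?thesis
    by (simp add: eq_neg_iff_add_eq_0)
qed

lemma alt_form_move:
  assumes "alt_form (\<phi> :: 'e::real_vector form)"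
  shows "\<phi> (us @ v # ws) = (-1) ^ length us * \<phi> (v # us @ ws)"
proof (induction us arbitrary: ws rule: rev_induct)
  case (snoc u us)
  have "\<phi> ((us @ [u]) @ v # ws) = - \<phi> (us @ v # u # ws)"
    using alt_form_swap[OF assms, of us u v ws] by simp
  also have "\<dots> = (-1) ^ length (us @ [u]) * \<phi> (v # (us @ [u]) @ ws)"
    using snoc[of "u # ws"] by simp
  finally show ?case .
qed simp

lemma onb_expansion:
  assumes "inner_prod G" and "onb G E"
  shows "v = (\<Sum>w\<in>E. G v w *\<^sub>R w)"
proof -
  have bl: "bilinear G" and sym: "\<And>u v. G u v = G v u" and pos: "\<And>u. u \<noteq> 0 \<Longrightarrow> 0 < G u u"
    using assms(1) by (auto simp: inner_prod_def)
  have fin: "finite E" and cE: "card E = DIM('a)"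
    and on: "\<And>u v. u \<in> E \<Longrightarrow> v \<in> E \<Longrightarrow> G u v = (if u = v then 1 else 0)"
    using assms(2) by (auto simp: onb_def)
  have lin: "linear (\<lambda>u. G u w)" for w
    using bl by (simp add: bilinear_def)
  have coef: "G (\<Sum>w\<in>E. c w *\<^sub>R w) u = c u" if "u \<in> E" for c u
  proof -
    have "G (\<Sum>w\<in>E. c w *\<^sub>R w) u = (\<Sum>w\<in>E. c w * G w u)"
      by (simp add: linear_sum[OF lin] linear_scale[OF lin])
    also have "\<dots> = (\<Sum>w\<in>E. if w = u then c w else 0)"
      using that on by (intro sum.cong) auto
    finally show ?thesis
      using fin that by simp
  qed
  have "independent E"
  proof (rule independent_if_scalars_zero[OF fin])
    fix f u assume "(\<Sum>w\<in>E. f w *\<^sub>R w) = 0" "u \<in> E"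
    then show "f u = 0"
      using coef[of u f] linear_0[OF lin] by simp
  qed
  then have "span E = UNIV"
    using cE by (metis card_ge_dim_independent dim_UNIV order_refl span_subspace
      subset_UNIV subspace_UNIV top.extremum_unique)
  then obtain c where c: "v = (\<Sum>w\<in>E. c w *\<^sub>R w)"
    using span_finite[OF fin] by (metis (no_types, lifting) UNIV_I imageE)
  then show ?thesis
    using coef by (simp cong: sum.cong)
qed

text \<open>Contraction is the adjoint of the exterior product.\<close>

lemma contract_adjoint:
  assumes G: "inner_prod G" and E: "onb G E" and "alt_form \<phi>" and \<psi>: "alt_form \<psi>"
  shows "form_inner E (wedge G v \<phi>) \<psi> = form_inner E \<phi> (contract v \<psi>)"
proof -
  let ?W = "{ws. distinct ws \<and> set ws \<subseteq> E}"
  let ?P = "SIGMA ws:?W. {..<length ws}"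
  let ?Q = "SIGMA us:?W. (E - set us) \<times> {..length us}"
  have fE: "finite E" using E by (simp add: onb_def)
  have fW: "finite ?W"
    by (rule finite_subset[OF _ finite_subset_distinct[OF fE]]) auto
  define h where "h = (\<lambda>w us. of_real (G v w) * \<phi> us * cnj (\<psi> (w # us)))"
  define r where "r = (\<lambda>(us, w :: 'a, i). (take i us @ w # drop i us, i :: nat))"
  define s where "s = (\<lambda>(ws :: 'a list, i :: nat). (remove_nth i ws, ws ! i, i))"
  have "form_inner E (wedge G v \<phi>) \<psi> =
      (\<Sum>ws\<in>?W. \<Sum>i<length ws. h (ws ! i) (remove_nth i ws) / of_nat (fact (length ws)))"
    unfolding form_inner_def
  proof (intro sum.cong refl)
    fix ws :: "'a list"
    have "(-1) ^ i * of_real (G v (ws ! i)) * \<phi> (remove_nth i ws) * cnj (\<psi> ws) =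
        h (ws ! i) (remove_nth i ws)" if "i < length ws" for i
    proof -
      have "\<psi> ws = (-1) ^ i * \<psi> (ws ! i # remove_nth i ws)"
        using alt_form_move[OF \<psi>, of "take i ws" "ws ! i" "drop (Suc i) ws"] that
        by (simp add: id_take_nth_drop[symmetric] remove_nth_def)
      moreover have "(-1) ^ i * (-1) ^ i = (1::complex)"
        by (simp flip: power_mult_distrib)
      ultimately show ?thesis
        by (simp add: h_def algebra_simps)
    qed
    then show "wedge G v \<phi> ws * cnj (\<psi> ws) / of_nat (fact (length ws)) =
        (\<Sum>i<length ws. h (ws ! i) (remove_nth i ws) / of_nat (fact (length ws)))"
      by (simp add: wedge_def sum_distrib_right flip: sum_divide_distrib)
  qed
  also have "\<dots> = (\<Sum>(ws, i)\<in>?P. h (ws ! i) (remove_nth i ws) / of_nat (fact (length ws)))"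
    using fW by (subst sum.Sigma) auto
  also have "\<dots> = (\<Sum>(us, w, i)\<in>?Q. h w us / of_nat (fact (Suc (length us))))"
  proof (rule sum.reindex_bij_witness[where i = r and j = s])
    fix a assume "a \<in> ?P"
    then obtain ws i where a: "a = (ws, i)" and d: "distinct ws" "set ws \<subseteq> E" "i < length ws"
      by auto
    have ws: "ws = take i ws @ ws ! i # drop (Suc i) ws"
      using d by (simp add: id_take_nth_drop)
    have len: "length ws = Suc (length (remove_nth i ws))"
      using d by (simp add: remove_nth_def)
    have "remove_nth i ws = take i ws @ drop (Suc i) ws" and "length (take i ws) = i"
      using d by (simp_all add: remove_nth_def)
    then have "(take i (remove_nth i ws) @ ws ! i # drop i (remove_nth i ws)) = ws"
      using ws by (metis append_eq_conv_conj)
    then show "r (s a) = a"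
      by (simp add: a r_def s_def)
    have "distinct (take i ws @ ws ! i # drop (Suc i) ws)"
      "set (take i ws @ ws ! i # drop (Suc i) ws) \<subseteq> E"
      using d ws by metis+
    then have "distinct (remove_nth i ws)" "set (remove_nth i ws) \<subseteq> E"
      "ws ! i \<in> E" "ws ! i \<notin> set (remove_nth i ws)"
      by (auto simp: remove_nth_def)
    moreover have "i \<le> length (remove_nth i ws)"
      using d(3) len by linarith
    ultimately show "s a \<in> ?Q"
      by (simp add: a s_def)
    show "(case s a of (us, w, i) \<Rightarrow> h w us / of_nat (fact (Suc (length us)))) =
        (case a of (ws, i) \<Rightarrow> h (ws ! i) (remove_nth i ws) / of_nat (fact (length ws)))"
      unfolding a s_def case_prod_conv len[symmetric] ..
  next
    fix b assume "b \<in> ?Q"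
    then obtain us w i where b: "b = (us, w, i)" and d: "distinct us" "set us \<subseteq> E"
        "w \<in> E" "w \<notin> set us" "i \<le> length us"
      by auto
    show "s (r b) = b"
      using d by (simp add: b r_def s_def remove_nth_def nth_append min_def)
    have "distinct (take i us @ drop i us)"
      using d by simp
    then have "distinct (take i us @ w # drop i us)"
      using d by (auto simp del: append_take_drop_id dest: in_set_takeD in_set_dropD)
    then show "r b \<in> ?P"
      using d by (auto simp: b r_def dest: in_set_takeD in_set_dropD)
  qed
  also have "\<dots> = (\<Sum>us\<in>?W. \<Sum>(w, i)\<in>(E - set us) \<times> {..length us}. h w us / of_nat (fact (Suc (length us))))"
    using fW fE by (intro sum.Sigma[symmetric]) auto
  also have "\<dots> = (\<Sum>us\<in>?W. \<phi> us * cnj (contract v \<psi> us) / of_nat (fact (length us)))"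
  proof (intro sum.cong refl)
    fix us :: "'a list"
    have lin: "linear (\<lambda>v. \<psi> (v # us))"
    proof -
      have "linear (\<lambda>v. \<psi> ([] @ v # us))"
        using \<psi> unfolding alt_form_def by blast
      then show ?thesis
        by simp
    qed
    have 0: "\<psi> (w # us) = 0" if w: "w \<in> set us" for w
    proof -
      obtain xs ys where us: "us = xs @ w # ys"
        using split_list[OF w] by blast
      have "\<psi> ([] @ w # xs @ w # ys) = 0"
        using \<psi> unfolding alt_form_def by blast
      then show ?thesis
        by (simp add: us)
    qed
    have "contract v \<psi> us = \<psi> ((\<Sum>w\<in>E. G v w *\<^sub>R w) # us)"
      by (simp only: contract_def onb_expansion[OF G E, of v, symmetric])
    also have "\<dots> = (\<Sum>w\<in>E. of_real (G v w) * \<psi> (w # us))"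
      by (simp add: linear_sum[OF lin] linear_scale[OF lin] scaleR_conv_of_real)
    also have "\<dots> = (\<Sum>w\<in>E - set us. of_real (G v w) * \<psi> (w # us))"
      using fE 0 by (intro sum.mono_neutral_right) auto
    finally have con: "contract v \<psi> us = (\<Sum>w\<in>E - set us. of_real (G v w) * \<psi> (w # us))" .
    have 1: "(\<Sum>w\<in>E - set us. h w us) = \<phi> us * cnj (contract v \<psi> us)"
      unfolding con cnj_sum sum_distrib_left h_def by (intro sum.cong refl) simp
    have f: "(of_nat (fact (Suc (length us))) :: complex) = of_nat (Suc (length us)) * of_nat (fact (length us))"
      by (simp only: fact_Suc of_nat_mult of_nat_id)
    have "(\<Sum>(w, i)\<in>(E - set us) \<times> {..length us}. h w us / of_nat (fact (Suc (length us)))) =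
        (\<Sum>w\<in>E - set us. of_nat (Suc (length us)) * (h w us / of_nat (fact (Suc (length us)))))"
      by (simp only: sum.cartesian_product[symmetric] sum_constant card_atMost)
    also have "\<dots> = (\<Sum>w\<in>E - set us. h w us / of_nat (fact (length us)))"
      unfolding f by (intro sum.cong refl) (simp del: of_nat_Suc of_nat_fact)
    finally show "(\<Sum>(w, i)\<in>(E - set us) \<times> {..length us}. h w us / of_nat (fact (Suc (length us)))) =
        \<phi> us * cnj (contract v \<psi> us) / of_nat (fact (length us))"
      by (simp only: sum_divide_distrib[symmetric] 1)
  qed
  finally show ?thesis
    by (simp add: form_inner_def)
qed

text \<open>
  The Clifford product: the associative unital product in which multiplication by a vector from
  the left is \<open>v \<and> \<phi> - v \<rfloor> \<phi>\<close>.  Such a product exists and is uniquely determined on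
  alternating forms because these are linear combinations of products of vectors.
\<close>

definition clifford_product :: "('e::euclidean_space \<Rightarrow> 'e \<Rightarrow> real) \<Rightarrow> ('e form \<Rightarrow> 'e form \<Rightarrow> 'e form) \<Rightarrow> bool" where
  "clifford_product G m \<longleftrightarrow>
     (\<forall>\<phi> \<psi>. alt_form \<phi> \<longrightarrow> alt_form \<psi> \<longrightarrow> alt_form (m \<phi> \<psi>)) \<and>
     (\<forall>\<phi> \<psi> \<theta>. alt_form \<phi> \<longrightarrow> alt_form \<psi> \<longrightarrow> alt_form \<theta> \<longrightarrow>
        m (\<phi> + \<psi>) \<theta> = m \<phi> \<theta> + m \<psi> \<theta> \<and> m \<phi> (\<psi> + \<theta>) = m \<phi> \<psi> + m \<phi> \<theta> \<and>
        m (m \<phi> \<psi>) \<theta> = m \<phi> (m \<psi> \<theta>)) \<and>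
     (\<forall>a \<phi> \<psi>. alt_form \<phi> \<longrightarrow> alt_form \<psi> \<longrightarrow> m (a \<odot> \<phi>) \<psi> = a \<odot> m \<phi> \<psi> \<and> m \<phi> (a \<odot> \<psi>) = a \<odot> m \<phi> \<psi>) \<and>
     (\<forall>\<phi>. alt_form \<phi> \<longrightarrow> m unit_form \<phi> = \<phi> \<and> m \<phi> unit_form = \<phi>) \<and>
     (\<forall>v \<phi>. alt_form \<phi> \<longrightarrow> m (vec_form G v) \<phi> = wedge G v \<phi> - contract v \<phi>)"

definition cmul :: "('e::euclidean_space \<Rightarrow> 'e \<Rightarrow> real) \<Rightarrow> 'e form \<Rightarrow> 'e form \<Rightarrow> 'e form" where
  "cmul G = (SOME m. clifford_product G m)"

definition form_linear :: "('e::real_vector form \<Rightarrow> 'e form) \<Rightarrow> bool" where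
  "form_linear T \<longleftrightarrow>
     (\<forall>\<phi>. alt_form \<phi> \<longrightarrow> alt_form (T \<phi>)) \<and>
     (\<forall>\<phi> \<psi>. alt_form \<phi> \<longrightarrow> alt_form \<psi> \<longrightarrow> T (\<phi> + \<psi>) = T \<phi> + T \<psi>) \<and>
     (\<forall>a \<phi>. alt_form \<phi> \<longrightarrow> T (a \<odot> \<phi>) = a \<odot> T \<phi>)"

definition automorphism_extension ::
  "('e::euclidean_space \<Rightarrow> 'e \<Rightarrow> real) \<Rightarrow> ('e \<Rightarrow> 'e) \<Rightarrow> ('e form \<Rightarrow> 'e form) \<Rightarrow> bool" where
  "automorphism_extension G j T \<longleftrightarrow>
     form_linear T \<and> bij_betw T (Collect alt_form) (Collect alt_form) \<and> T unit_form = unit_form \<and>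
     (\<forall>\<phi> \<psi>. alt_form \<phi> \<longrightarrow> alt_form \<psi> \<longrightarrow> T (cmul G \<phi> \<psi>) = cmul G (T \<phi>) (T \<psi>)) \<and>
     (\<forall>v. T (vec_form G v) = vec_form G (j v))"

definition J_alg :: "('e::euclidean_space \<Rightarrow> 'e \<Rightarrow> real) \<Rightarrow> ('e \<Rightarrow> 'e) \<Rightarrow> 'e form \<Rightarrow> 'e form" where
  "J_alg G j = (SOME T. automorphism_extension G j T)"

definition J_alg_inv :: "('e::euclidean_space \<Rightarrow> 'e \<Rightarrow> real) \<Rightarrow> ('e \<Rightarrow> 'e) \<Rightarrow> 'e form \<Rightarrow> 'e form" where
  "J_alg_inv G j = inv_into (Collect alt_form) (J_alg G j)"

definition clifford_word :: "('e::euclidean_space \<Rightarrow> 'e \<Rightarrow> real) \<Rightarrow> 'e list \<Rightarrow> 'e form" where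
  "clifford_word G vs = foldr (\<lambda>v. cmul G (vec_form G v)) vs unit_form"

definition is_transpose :: "('e::euclidean_space \<Rightarrow> 'e \<Rightarrow> real) \<Rightarrow> ('e form \<Rightarrow> 'e form) \<Rightarrow> bool" where
  "is_transpose G T \<longleftrightarrow>
     form_linear T \<and>
     (\<forall>\<phi> \<psi>. alt_form \<phi> \<longrightarrow> alt_form \<psi> \<longrightarrow> T (cmul G \<phi> \<psi>) = cmul G (T \<psi>) (T \<phi>)) \<and>
     (\<forall>vs. T (clifford_word G vs) = clifford_word G (rev vs))"

definition transposition :: "('e::euclidean_space \<Rightarrow> 'e \<Rightarrow> real) \<Rightarrow> 'e form \<Rightarrow> 'e form" where
  "transposition G = (SOME T. is_transpose G T)"

text \<open>\<open>E = {e\<^sub>1, \<dots>, e\<^sub>n}\<close> such that \<open>e\<^sub>1, \<dots>, e\<^sub>n, J e\<^sub>1, \<dots>, J e\<^sub>n\<close> is an orthonormal basis.\<close>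

definition adapted_frame :: "('e::euclidean_space \<Rightarrow> 'e \<Rightarrow> real) \<Rightarrow> ('e \<Rightarrow> 'e) \<Rightarrow> 'e set \<Rightarrow> bool" where
  "adapted_frame G j E \<longleftrightarrow> onb G (E \<union> j ` E) \<and> 2 * card E = DIM('e)"

definition eps :: "('e \<Rightarrow> 'e \<Rightarrow> real) \<Rightarrow> ('e \<Rightarrow> 'e) \<Rightarrow> 'e \<Rightarrow> 'e form" where
  "eps G j e = (1/2) \<odot> (vec_form G e - \<i> \<odot> vec_form G (j e))"

definition eps_bar :: "('e \<Rightarrow> 'e \<Rightarrow> real) \<Rightarrow> ('e \<Rightarrow> 'e) \<Rightarrow> 'e \<Rightarrow> 'e form" where
  "eps_bar G j e = (1/2) \<odot> (vec_form G e + \<i> \<odot> vec_form G (j e))"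

text \<open>These two do not depend on the adapted frame, so that one may be chosen at each point.\<close>

definition L_fibre :: "('e::euclidean_space \<Rightarrow> 'e \<Rightarrow> real) \<Rightarrow> ('e \<Rightarrow> 'e) \<Rightarrow> 'e form \<Rightarrow> 'e form" where
  "L_fibre G j \<phi> =
     - (\<Sum>e\<in>(SOME E. adapted_frame G j E). cmul G (cmul G (eps G j e) \<phi>) (eps_bar G j e))"

definition L_bar_fibre :: "('e::euclidean_space \<Rightarrow> 'e \<Rightarrow> real) \<Rightarrow> ('e \<Rightarrow> 'e) \<Rightarrow> 'e form \<Rightarrow> 'e form" where
  "L_bar_fibre G j \<phi> =
     - (\<Sum>e\<in>(SOME E. adapted_frame G j E). cmul G (cmul G (eps_bar G j e) \<phi>) (eps G j e))"

section \<open>The Levi-Civita connection and its Dirac operator in a coordinate domain\<close>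

text \<open>
  The connection \<open>\<partial>\<^sub>u + \<Gamma>(u, \<cdot>)\<close> is torsion free iff \<open>\<Gamma>\<close> is symmetric (constant fields commute);
  the other condition says that it preserves the metric.
\<close>

definition christoffel :: "'e::euclidean_space metric \<Rightarrow> 'e \<Rightarrow> 'e \<Rightarrow> 'e \<Rightarrow> 'e" where
  "christoffel g x = (THE \<Gamma>. bilinear \<Gamma> \<and> (\<forall>u v. \<Gamma> u v = \<Gamma> v u) \<and>
     (\<forall>u v w. frechet_derivative (\<lambda>y. g y v w) (at x) u = g x (\<Gamma> u v) w + g x v (\<Gamma> u w)))"

definition levi_civita :: "'e::euclidean_space metric \<Rightarrow> 'e \<Rightarrow> ('e \<Rightarrow> 'e) \<Rightarrow> 'e \<Rightarrow> 'e" where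
  "levi_civita g u Y x = frechet_derivative Y (at x) u + christoffel g x u (Y x)"

definition smooth_form_on :: "'e::euclidean_space set \<Rightarrow> ('e \<Rightarrow> 'e form) \<Rightarrow> bool" where
  "smooth_form_on V \<phi> \<longleftrightarrow> (\<forall>x\<in>V. alt_form (\<phi> x)) \<and> (\<forall>ws. smooth_on V (\<lambda>x. \<phi> x ws))"

text \<open>
  \<open>N u\<close> is the covariant derivative in the direction of the constant field \<open>u\<close> on the open set
  \<open>V\<close>: the extension of the Levi-Civita connection to the Clifford bundle as a derivation.  On
  smooth fields it is uniquely determined at the points of \<open>V\<close>.
\<close>

definition derivation_extension ::
  "'e::euclidean_space set \<Rightarrow> 'e metric \<Rightarrow> ('e \<Rightarrow> ('e \<Rightarrow> 'e form) \<Rightarrow> 'e \<Rightarrow> 'e form) \<Rightarrow> bool" where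
  "derivation_extension V g N \<longleftrightarrow>
     (\<forall>u \<phi>. smooth_form_on V \<phi> \<longrightarrow> smooth_form_on V (N u \<phi>)) \<and>
     (\<forall>u \<phi> \<psi>. smooth_form_on V \<phi> \<longrightarrow> smooth_form_on V \<psi> \<longrightarrow>
        (\<forall>x\<in>V. N u (\<lambda>y. \<phi> y + \<psi> y) x = N u \<phi> x + N u \<psi> x)) \<and>
     (\<forall>u f \<phi>. smooth_on V f \<longrightarrow> smooth_form_on V \<phi> \<longrightarrow>
        (\<forall>x\<in>V. N u (\<lambda>y. f y \<odot> \<phi> y) x = frechet_derivative f (at x) u \<odot> \<phi> x + f x \<odot> N u \<phi> x)) \<and>
     (\<forall>u \<phi> \<psi>. smooth_form_on V \<phi> \<longrightarrow> smooth_form_on V \<psi> \<longrightarrow>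
        (\<forall>x\<in>V. N u (\<lambda>y. cmul (g y) (\<phi> y) (\<psi> y)) x =
                 cmul (g x) (N u \<phi> x) (\<psi> x) + cmul (g x) (\<phi> x) (N u \<psi> x))) \<and>
     (\<forall>u Y. smooth_on V Y \<longrightarrow>
        (\<forall>x\<in>V. N u (\<lambda>y. vec_form (g y) (Y y)) x = vec_form (g x) (levi_civita g u Y x)))"

definition nabla :: "'e::euclidean_space set \<Rightarrow> 'e metric \<Rightarrow> 'e \<Rightarrow> ('e \<Rightarrow> 'e form) \<Rightarrow> 'e \<Rightarrow> 'e form" where
  "nabla V g = (SOME N. derivation_extension V g N)"

text \<open>
  The summand is tensorial in \<open>v\<close> and the sum independent of the frame, so that an orthonormal
  basis may be chosen at each point.
\<close>

definition dirac_on :: "'e::euclidean_space set \<Rightarrow> 'e metric \<Rightarrow> ('e \<Rightarrow> 'e form) \<Rightarrow> 'e \<Rightarrow> 'e form" where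
  "dirac_on V g \<phi> x =
     (\<Sum>v\<in>(SOME E. onb (g x) E). cmul (g x) (vec_form (g x) v) (nabla V g v \<phi> x))"

section \<open>Operators on sections of the complex Clifford bundle\<close>

type_synonym ('p, 'e) cl_field = "('p, 'e) chart \<Rightarrow> 'e \<Rightarrow> 'e form"

definition sections :: "('p, 'e::euclidean_space) chart set \<Rightarrow> ('p, 'e) cl_field set" where
  "sections A = {\<phi>.
     (\<forall>c\<in>A. smooth_form_on (target c) (\<phi> c)) \<and>
     (\<forall>c\<in>A. \<forall>c'\<in>A. \<forall>p \<in> fst c \<inter> fst c'. \<forall>ws.
        \<phi> c (snd c p) ws = \<phi> c' (snd c' p) (map (change c c' (snd c p)) ws))}"

definition eq_on_sections :: "('p, 'e::euclidean_space) chart set \<Rightarrow>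
    (('p, 'e) cl_field \<Rightarrow> ('p, 'e) cl_field) \<Rightarrow> (('p, 'e) cl_field \<Rightarrow> ('p, 'e) cl_field) \<Rightarrow> bool" where
  "eq_on_sections A S T \<longleftrightarrow> (\<forall>\<phi>\<in>sections A. \<forall>c\<in>A. \<forall>x\<in>target c. S \<phi> c x = T \<phi> c x)"

definition commutator :: "('a::ab_group_add \<Rightarrow> 'a) \<Rightarrow> ('a \<Rightarrow> 'a) \<Rightarrow> 'a \<Rightarrow> 'a" where
  "commutator S T \<phi> = S (T \<phi>) - T (S \<phi>)"

definition anticommutator :: "('a::ab_group_add \<Rightarrow> 'a) \<Rightarrow> ('a \<Rightarrow> 'a) \<Rightarrow> 'a \<Rightarrow> 'a" where
  "anticommutator S T \<phi> = S (T \<phi>) + T (S \<phi>)"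

definition fscale :: "complex \<Rightarrow> ('p, 'e) cl_field \<Rightarrow> ('p, 'e) cl_field" where
  "fscale a \<phi> = (\<lambda>c x. a \<odot> \<phi> c x)"

context
  fixes g :: "('p, 'e::euclidean_space) chart \<Rightarrow> 'e metric"
begin

definition star :: "('p, 'e) cl_field \<Rightarrow> ('p, 'e) cl_field" where
  "star \<phi> = (\<lambda>c x. transposition (g c x) (\<phi> c x))"

definition op_star :: "(('p, 'e) cl_field \<Rightarrow> ('p, 'e) cl_field) \<Rightarrow> ('p, 'e) cl_field \<Rightarrow> ('p, 'e) cl_field" where
  "op_star T = star \<circ> T \<circ> star"

definition dirac :: "('p, 'e) cl_field \<Rightarrow> ('p, 'e) cl_field" where
  "dirac \<phi> = (\<lambda>c x. dirac_on (target c) (g c) (\<phi> c) x)"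

context
  fixes J :: "('p, 'e) chart \<Rightarrow> 'e endo"
begin

definition op_c :: "(('p, 'e) cl_field \<Rightarrow> ('p, 'e) cl_field) \<Rightarrow> ('p, 'e) cl_field \<Rightarrow> ('p, 'e) cl_field" where
  "op_c T \<phi> = (\<lambda>c x. J_alg_inv (g c x) (J c x) (T (\<lambda>c x. J_alg (g c x) (J c x) (\<phi> c x)) c x))"

definition L_op :: "('p, 'e) cl_field \<Rightarrow> ('p, 'e) cl_field" where
  "L_op \<phi> = (\<lambda>c x. L_fibre (g c x) (J c x) (\<phi> c x))"

definition L_bar_op :: "('p, 'e) cl_field \<Rightarrow> ('p, 'e) cl_field" where
  "L_bar_op \<phi> = (\<lambda>c x. L_bar_fibre (g c x) (J c x) (\<phi> c x))"

definition H_op :: "('p, 'e) cl_field \<Rightarrow> ('p, 'e) cl_field" where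
  "H_op = commutator L_op L_bar_op"

definition D_op :: "('p, 'e) cl_field \<Rightarrow> ('p, 'e) cl_field" where
  "D_op \<phi> = fscale (1/2) (dirac \<phi> + fscale \<i> (op_c dirac \<phi>))"

definition D_bar_op :: "('p, 'e) cl_field \<Rightarrow> ('p, 'e) cl_field" where
  "D_bar_op \<phi> = fscale (1/2) (dirac \<phi> - fscale \<i> (op_c dirac \<phi>))"

end

end

end

theory Submission
  imports Defs
begin

text \<open>
  Over the domain of a chart a smooth orthonormal frame identifies the Clifford bundle with the
  constant Clifford algebra of Euclidean space, and the Levi-Civita connection becomes
  \<open>\<partial> + [\<Omega>, \<cdot>]\<close>.  Put \<open>a = -J(\<nabla>J)\<close>.  Then \<open>J\<^sub>a\<^sub>l\<^sub>g\<inverse> \<nabla>\<^sub>b J\<^sub>a\<^sub>l\<^sub>g = \<nabla>\<^sub>b + [K\<^sub>b, \<cdot>]\<close>, where \<open>K\<^sub>b\<close> lifts the skew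
  endomorphism \<open>a\<^sub>b\<close>, and with \<open>\<epsilon>(v) = (v - iJv)/2\<close>, \<open>\<epsilon>'(v) = (v + iJv)/2\<close> and sums over an
  orthonormal basis, \<open>\<DD> = \<Sum> \<epsilon>(b) \<nabla>\<^sup>h\<^sub>b - B/2\<close> with \<open>\<nabla>\<^sup>h\<^sub>b = \<nabla>\<^sub>b + [K\<^sub>b, \<cdot>]/2\<close> and
  \<open>B(\<phi>) = \<Sum> \<epsilon>'(b) [K\<^sub>b, \<phi>]\<close>.  The connection \<open>\<nabla>\<^sup>h\<close> preserves \<open>J\<close>, hence commutes with both operators
  \<open>\<L>\<close>, so for the first term the identities follow from the anticommutation relations of \<open>\<epsilon>\<close> and
  \<open>\<epsilon>'\<close>.  For the second, \<open>d\<omega> = 0\<close> says that the cyclic sum of \<open>\<langle>(\<nabla>\<^sub>uJ)v, w\<rangle>\<close> vanishes; this makes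
  \<open>T(b, c, d) = \<langle>a\<^sub>bc, d\<rangle>\<close> cyclic and yields \<open>B(\<phi>) = -1/4 \<Sum> T(b, c, d) \<epsilon>'(b) \<phi> \<epsilon>'(c) \<epsilon>'(d)\<close>.
  Replacing \<open>J\<close> by \<open>-J\<close> exchanges barred and unbarred operators, and the identity for \<open>\<H>\<close>
  follows formally from the first and third ones because \<open>\<star>\<close> conjugates \<open>\<L>\<close> into its bar.
\<close>

text \<open>The product, the automorphism, the transpose and the connection are chosen by
  \<open>SOME\<close> from characterizing properties, so nothing can be computed before each is
  shown to exist and to be determined by these properties. Both are done in one concrete model, the
  type \<open>cl\<close>: existence by transporting an operation of the model, uniqueness by
  induction along products of vectors. The frame is orthonormal but not adapted to J. Instead, J
  becomes a variable orthogonal map of Euclidean space, and the sum over an adapted frame becomes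
  half of a sum over the whole basis. The obstacle is that J is not parallel: conjugating the Dirac
  operator by J costs the commutators with K. Since -iJb = \<epsilon>(b) - \<epsilon>'(b), half of
  this cost joins \<epsilon>(b) and produces exactly the connection that preserves J; the other half
  is B. The sum of T against three factors \<epsilon>' vanishes, because such factors anticommute
  and the cyclic sum of T is zero. This removes the part of B that multiplies from the left, and
  d\<omega> = 0 enters only through such symmetries of T.\<close>

section \<open>Alternating forms under contraction and exterior multiplication\<close>

lemma alt_form_linear: "alt_form \<phi> \<Longrightarrow> linear (\<lambda>v. \<phi> (us @ v # ws))"
  by (simp add: alt_form_def)

lemma alt_form_linear_hd: "alt_form \<phi> \<Longrightarrow> linear (\<lambda>v. \<phi> (v # ws))"
  using alt_form_linear[of \<phi> "[]"] by simp

text \<open>Polarizing the adjacent case gives the sign under a swap of neighbours, and swaps bring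
  two equal arguments next to each other.\<close>

lemma alt_formI:
  assumes lin: "\<And>us ws. linear (\<lambda>v. \<phi> (us @ v # ws))"
    and adj: "\<And>us v ws. \<phi> (us @ v # v # ws) = 0"
  shows "alt_form \<phi>"
proof -
  have swap: "\<phi> (us @ v # w # ws) = - \<phi> (us @ w # v # ws)" for us v w ws
  proof -
    have "0 = \<phi> (us @ (v + w) # (v + w) # ws)"
      by (simp add: adj)
    also have "\<dots> = \<phi> (us @ v # (v + w) # ws) + \<phi> (us @ w # (v + w) # ws)"
      using linear_add[OF lin[of us "(v + w) # ws"]] by simp
    also have "\<dots> = \<phi> (us @ v # w # ws) + \<phi> (us @ w # v # ws)"
      using linear_add[OF lin[of "us @ [v]" ws]] linear_add[OF lin[of "us @ [w]" ws]]
      by (simp add: adj)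
    finally show ?thesis
      by (simp add: eq_neg_iff_add_eq_0)
  qed
  have "\<phi> (us @ v # vs @ v # ws) = 0" for us v vs ws
  proof (induction vs arbitrary: us)
    case (Cons w vs)
    show ?case
      using swap[of us v w "vs @ v # ws"] Cons[of "us @ [w]"] by simp
  qed (simp add: adj)
  then show ?thesis
    using lin by (simp add: alt_form_def)
qed

lemma alt_form_0 [simp]: "alt_form 0"
  by (auto simp: zero_fun_def alt_form_def module_hom_zero)

lemma alt_form_add: "alt_form \<phi> \<Longrightarrow> alt_form \<psi> \<Longrightarrow> alt_form (\<phi> + \<psi>)"
  by (simp add: alt_form_def linear_compose_add)

lemma alt_form_diff: "alt_form \<phi> \<Longrightarrow> alt_form \<psi> \<Longrightarrow> alt_form (\<phi> - \<psi>)"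
  by (simp add: alt_form_def linear_compose_sub)

lemma alt_form_uminus: "alt_form \<phi> \<Longrightarrow> alt_form (- \<phi>)"
  by (simp add: alt_form_def linear_compose_neg)

lemma alt_form_cscale: "alt_form \<phi> \<Longrightarrow> alt_form (a \<odot> \<phi>)"
  by (auto simp: alt_form_def cscale_def linear_iff algebra_simps)

lemma alt_form_unit [simp]: "alt_form unit_form"
  by (auto simp: alt_form_def unit_form_def module_hom_zero)

lemma alt_form_vec_form: "linear (G v) \<Longrightarrow> alt_form (vec_form G v)"
  by (rule alt_formI)
    (auto simp: vec_form_def linear_iff split: list.splits simp: append_eq_Cons_conv algebra_simps scaleR_conv_of_real)

lemma alt_form_contract: "alt_form \<phi> \<Longrightarrow> alt_form (contract v \<phi>)"
  unfolding alt_form_def contract_def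
proof (intro conjI allI; elim conjE)
  fix us vs ws :: "'a list" and u :: 'a
  assume "\<forall>us ws. linear (\<lambda>v. \<phi> (us @ v # ws))"
  from this[rule_format, of "v # us" ws] show "linear (\<lambda>u. \<phi> (v # us @ u # ws))"
    by simp
next
  fix us vs ws :: "'a list" and u :: 'a
  assume "\<forall>us v vs ws. \<phi> (us @ v # vs @ v # ws) = 0"
  then show "\<phi> (v # us @ u # vs @ u # ws) = 0"
    by (auto dest!: spec[of _ "v # us"])
qed

lemma contract_add_left: "alt_form \<phi> \<Longrightarrow> contract (u + v) \<phi> = contract u \<phi> + contract v \<phi>"
  by (simp add: contract_def fun_eq_iff linear_add[OF alt_form_linear_hd])

lemma contract_scaleR_left: "alt_form \<phi> \<Longrightarrow> contract (r *\<^sub>R v) \<phi> = of_real r \<odot> contract v \<phi>"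
  by (simp add: contract_def cscale_def fun_eq_iff linear_scale[OF alt_form_linear_hd] scaleR_conv_of_real)

lemma contract_swap:
  assumes "alt_form \<phi>"
  shows "contract u (contract v \<phi>) = - contract v (contract u \<phi>)"
  using alt_form_swap[OF assms, of "[]" v u] by (simp add: contract_def fun_eq_iff)

lemma contract_self:
  assumes "alt_form \<phi>"
  shows "contract u (contract u \<phi>) = 0"
proof -
  have "\<phi> ([] @ u # [] @ u # ws) = 0" for ws
    using assms unfolding alt_form_def by blast
  then show ?thesis by (simp add: contract_def fun_eq_iff)
qed

lemma wedge_Nil [simp]: "wedge G v \<phi> [] = 0"
  by (simp add: wedge_def)

text \<open>Contraction is an antiderivation; read at the first argument, this is a recursion on the
  argument list in which \<open>\<phi>\<close> is replaced by its contraction. Inductions with this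
  rule therefore generalize over the form.\<close>

lemma wedge_Cons:
  "wedge G v \<phi> (u # ws) = of_real (G v u) * \<phi> ws - wedge G v (contract u \<phi>) ws"
  by (simp add: wedge_def sum.lessThan_Suc_shift remove_nth_def contract_def sum_negf del: sum.lessThan_Suc)

lemma wedge_add: "wedge G v (\<phi> + \<psi>) = wedge G v \<phi> + wedge G v \<psi>"
  by (simp add: wedge_def fun_eq_iff algebra_simps sum.distrib)

lemma wedge_cscale: "wedge G v (a \<odot> \<phi>) = a \<odot> wedge G v \<phi>"
  by (simp add: wedge_def cscale_def fun_eq_iff sum_distrib_left algebra_simps)

lemma wedge_0 [simp]: "wedge G v 0 = 0"
  by (simp add: wedge_def fun_eq_iff)

lemma alt_form_wedge:
  assumes G: "linear (G v)" and "alt_form \<phi>"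
  shows "alt_form (wedge G v \<phi>)"
proof (rule alt_formI)
  show "linear (\<lambda>x. wedge G v \<phi> (us @ x # ws))" for us ws
    using \<open>alt_form \<phi>\<close>
  proof (induction us arbitrary: \<phi>)
    case Nil
    then show ?case
      by (intro linearI) (simp_all add: wedge_Cons linear_add[OF G] linear_scale[OF G]
          contract_add_left wedge_add contract_scaleR_left wedge_cscale,
          simp_all add: cscale_def algebra_simps scaleR_conv_of_real)
  next
    case (Cons u us)
    then show ?case
      using linear_compose_sub[OF linear_compose[OF alt_form_linear[OF Cons.prems, of us ws]
          linear_times[of "of_real (G v u)"]] Cons.IH[OF alt_form_contract[OF Cons.prems, of u]]]
      by (simp add: wedge_Cons o_def)
  qed
next
  show "wedge G v \<phi> (us @ x # x # ws) = 0" for us x ws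
    using \<open>alt_form \<phi>\<close>
  proof (induction us arbitrary: \<phi>)
    case Nil
    then show ?case
      by (simp add: wedge_Cons contract_self) (simp add: contract_def)
  next
    case (Cons u us)
    have "\<phi> (us @ x # [] @ x # ws) = 0"
      using Cons.prems unfolding alt_form_def by blast
    then show ?case
      using Cons.IH[OF alt_form_contract[OF Cons.prems, of u]] by (simp add: wedge_Cons)
  qed
qed

section \<open>The Clifford algebra of Euclidean space\<close>

text \<open>Forms on Euclidean space with its standard inner product get a type of their own, so
  that the Clifford product can be a class instance and computations carry no side condition
  \<open>alt_form\<close>.\<close>

typedef (overloaded) 'e cl = "{\<phi> :: 'e::euclidean_space form. alt_form \<phi>}"
  morphisms frm Abs_cl
  by (rule exI[of _ 0]) simp

setup_lifting type_definition_cl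

lemma alt_form_frm [simp]: "alt_form (frm x)"
  using frm[of x] by simp

lemma cl_eqI: "(\<And>ws. frm x ws = frm y ws) \<Longrightarrow> x = y"
  by (simp add: frm_inject[symmetric] fun_eq_iff)

instantiation cl :: (euclidean_space) ab_group_add
begin
lift_definition zero_cl :: "'a cl" is 0 by simp
lift_definition plus_cl :: "'a cl \<Rightarrow> 'a cl \<Rightarrow> 'a cl" is "(+)" by (rule alt_form_add)
lift_definition minus_cl :: "'a cl \<Rightarrow> 'a cl \<Rightarrow> 'a cl" is "(-)" by (rule alt_form_diff)
lift_definition uminus_cl :: "'a cl \<Rightarrow> 'a cl" is "uminus" by (rule alt_form_uminus)
instance by standard (transfer, simp add: algebra_simps fun_eq_iff)+
end

lift_definition csc :: "complex \<Rightarrow> 'e::euclidean_space cl \<Rightarrow> 'e cl" (infixr "*C" 75)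
  is cscale by (rule alt_form_cscale)

lemma frm_simps [simp]:
  "frm 0 ws = 0" "frm (x + y) ws = frm x ws + frm y ws" "frm (x - y) ws = frm x ws - frm y ws"
  "frm (- x) ws = - frm x ws" "frm (a *C x) ws = a * frm x ws"
  by (simp_all add: zero_cl.rep_eq plus_cl.rep_eq minus_cl.rep_eq uminus_cl.rep_eq csc.rep_eq
      cscale_def)

instantiation cl :: (euclidean_space) real_vector
begin
definition scaleR_cl :: "real \<Rightarrow> 'a cl \<Rightarrow> 'a cl" where "scaleR_cl r x = of_real r *C x"
instance
  by (standard; intro cl_eqI) (simp_all add: scaleR_cl_def algebra_simps)
end

lemma frm_scaleR [simp]: "frm (r *\<^sub>R x) ws = of_real r * frm x ws"
  by (simp add: scaleR_cl_def)

lemma frm_sum: "frm (sum f A) ws = (\<Sum>a\<in>A. frm (f a) ws)"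
  by (induction A rule: infinite_finite_induct) auto

lemma csc_simps [simp]:
  "a *C (x + y) = a *C x + a *C y" "a *C (x - y) = a *C x - a *C y"
  "a *C (- x) = - (a *C x)" "(- a) *C x = - (a *C x)"
  "a *C 0 = 0" "0 *C x = 0" "1 *C x = x" "a *C b *C x = (a * b) *C x"
  "a *C (r *\<^sub>R x) = r *\<^sub>R (a *C x)"
  by (auto intro!: cl_eqI simp: algebra_simps)

lemma csc_add_left: "(a + b) *C x = a *C x + b *C x"
  by (auto intro!: cl_eqI simp: algebra_simps)

lemma csc_of_real [simp]: "of_real r *C x = r *\<^sub>R x"
  by (simp add: scaleR_cl_def)

lemma csc_sum: "a *C sum f A = (\<Sum>i\<in>A. a *C f i)"
  by (auto intro!: cl_eqI simp: frm_sum sum_distrib_left)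

lift_definition con :: "'e::euclidean_space \<Rightarrow> 'e cl \<Rightarrow> 'e cl" is contract
  by (rule alt_form_contract)

lift_definition wed :: "'e::euclidean_space \<Rightarrow> 'e cl \<Rightarrow> 'e cl" is "wedge (\<bullet>)"
  by (intro alt_form_wedge bounded_linear.linear bounded_linear_inner_right)

text \<open>The grading involution. It anticommutes with \<open>wed v\<close> and
  \<open>con v\<close>, and it enters right Clifford multiplication.\<close>

lift_definition par :: "'e::euclidean_space cl \<Rightarrow> 'e cl" is "\<lambda>\<phi> ws. (-1) ^ length ws * \<phi> ws"
proof -
  fix \<phi> :: "'e form" assume a: "alt_form \<phi>"
  show "alt_form (\<lambda>ws. (-1) ^ length ws * \<phi> ws)"
  proof (unfold alt_form_def, intro conjI allI)
    show "linear (\<lambda>v. (-1) ^ length (us @ v # ws) * \<phi> (us @ v # ws))" for us ws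
      using linear_compose[OF alt_form_linear[OF a, of us ws] linear_times[of "(-1) ^ (length us + Suc (length ws))"]]
      by (simp add: o_def)
    show "(-1) ^ length (us @ v # vs @ v # ws) * \<phi> (us @ v # vs @ v # ws) = 0" for us v vs ws
      using a unfolding alt_form_def by auto
  qed
qed

lemma frm_con [simp]: "frm (con v x) ws = frm x (v # ws)"
  by (simp add: con.rep_eq contract_def)

lemma frm_wed_Nil [simp]: "frm (wed v x) [] = 0"
  by (simp add: wed.rep_eq)

lemma frm_wed_Cons [simp]:
  "frm (wed v x) (u # ws) = of_real (v \<bullet> u) * frm x ws - frm (wed v (con u x)) ws"
  by (simp add: wed.rep_eq con.rep_eq wedge_Cons)

lemma frm_par [simp]: "frm (par x) ws = (-1) ^ length ws * frm x ws"
  by (simp add: par.rep_eq)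

lemma con_simps [simp]:
  "con v (x + y) = con v x + con v y" "con v (x - y) = con v x - con v y" "con v (- x) = - con v x"
  "con v 0 = 0" "con v (a *C x) = a *C con v x" "con v (r *\<^sub>R x) = r *\<^sub>R con v x"
  by (auto intro!: cl_eqI)

lemma wed_0 [simp]: "wed v 0 = 0"
  by (transfer, simp)

lemma wed_add [simp]: "wed v (x + y) = wed v x + wed v y"
  by (transfer, simp add: wedge_add)

lemma wed_csc [simp]: "wed v (a *C x) = a *C wed v x"
  by (transfer, simp add: wedge_cscale)

lemma wed_scaleR [simp]: "wed v (r *\<^sub>R x) = r *\<^sub>R wed v x"
  by (simp add: scaleR_cl_def del: csc_of_real)

lemma wed_minus [simp]: "wed v (- x) = - wed v x"
  using wed_scaleR[of v "-1" x] by simp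

lemma wed_diff [simp]: "wed v (x - y) = wed v x - wed v y"
  using wed_add[of v x "- y"] by simp

lemma par_simps [simp]:
  "par (x + y) = par x + par y" "par (x - y) = par x - par y" "par (- x) = - par x"
  "par 0 = 0" "par (a *C x) = a *C par x" "par (r *\<^sub>R x) = r *\<^sub>R par x" "par (par x) = x"
  by (auto intro!: cl_eqI simp: algebra_simps simp flip: power_mult_distrib)

lemma con_con: "con u (con v x) = - con v (con u x)"
  by (transfer, rule contract_swap)

lemma con_wed: "con u (wed v x) = (u \<bullet> v) *\<^sub>R x - wed v (con u x)"
  by (rule cl_eqI) (simp add: inner_commute)

lemma wed_wed: "wed u (wed v x) = - wed v (wed u x)"
proof (rule cl_eqI)
  show "frm (wed u (wed v x)) ws = frm (- wed v (wed u x)) ws" for ws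
  proof (induction ws arbitrary: x)
    case (Cons w ws)
    have "frm (con w (wed u (wed v x))) ws = frm (con w (- wed v (wed u x))) ws"
      using Cons[of "con w x"] by (simp only: con_wed con_simps wed_diff wed_scaleR frm_simps)
        (simp add: algebra_simps)
    then show ?case by (simp only: frm_con)
  qed simp
qed

lemma con_par: "con v (par x) = - par (con v x)"
  by (rule cl_eqI) simp

lemma wed_par: "wed v (par x) = - par (wed v x)"
proof (rule cl_eqI)
  show "frm (wed v (par x)) ws = frm (- par (wed v x)) ws" for ws
    by (induction ws arbitrary: x) (simp_all add: con_par algebra_simps)
qed

section \<open>Expansion in exterior monomials\<close>

lemma cl_vanish:
  assumes "length ws > DIM('e)"
  shows "frm (x :: 'e::euclidean_space cl) ws = 0"
proof -
  \<comment> \<open>Arguments are replaced by basis vectors one at a time, and \<open>us\<close>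
    holds those already replaced. In the end a list longer than the dimension must repeat a basis
    vector.\<close>
  have "frm x (us @ ws) = 0" if "set us \<subseteq> Basis" "length (us @ ws) > DIM('e)" for us
    using that
  proof (induction ws arbitrary: us)
    case Nil
    have "\<not> distinct us"
      using card_mono[OF finite_Basis Nil(1)] Nil(2) distinct_card[of us] by auto
    then obtain xs y ys zs where "us = xs @ [y] @ ys @ [y] @ zs"
      using not_distinct_decomp by blast
    moreover have "frm x (xs @ y # ys @ y # zs) = 0"
      using alt_form_frm[of x] unfolding alt_form_def by blast
    ultimately show ?case by simp
  next
    case (Cons w ws)
    have "frm x (us @ w # ws) = frm x (us @ (\<Sum>b\<in>Basis. (w \<bullet> b) *\<^sub>R b) # ws)"
      by (simp only: euclidean_representation)
    also have "\<dots> = (\<Sum>b\<in>Basis. (w \<bullet> b) *\<^sub>R frm x ((us @ [b]) @ ws))"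
      by (simp add: linear_sum[OF alt_form_linear[OF alt_form_frm]]
          linear_scale[OF alt_form_linear[OF alt_form_frm]])
    also have "\<dots> = 0"
    proof (intro sum.neutral ballI)
      fix b :: 'e assume "b \<in> Basis"
      then have "frm x ((us @ [b]) @ ws) = 0"
        using Cons.prems by (intro Cons.IH) auto
      then show "(w \<bullet> b) *\<^sub>R frm x ((us @ [b]) @ ws) = 0"
        by simp
    qed
    finally show ?case .
  qed
  from this[of "[]"] show ?thesis using assms by simp
qed

lemma frm_linear_hd: "linear (\<lambda>v. frm x (v # ws))"
  by (rule alt_form_linear_hd) simp

text \<open>Euler's identity: this operator multiplies the part of degree p by p. The induction
  peels off the first argument, whose expansion in the basis contributes the additional 1.\<close>

lemma sum_wed_con:
  "(\<Sum>b\<in>Basis. frm (wed b (con b x)) ws) = of_nat (length ws) * frm x ws"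
proof (induction ws arbitrary: x)
  case (Cons u ws)
  have "(\<Sum>b\<in>Basis. frm (wed b (con b x)) (u # ws)) =
      (\<Sum>b\<in>Basis. of_real (u \<bullet> b) * frm x (b # ws)) - (\<Sum>b\<in>Basis. frm (wed b (con u (con b x))) ws)"
    by (simp add: sum_subtractf inner_commute)
  also have "(\<Sum>b\<in>Basis. frm (wed b (con u (con b x))) ws) = - (of_nat (length ws) * frm x (u # ws))"
    by (subst con_con) (simp add: Cons sum_negf)
  also have "(\<Sum>b\<in>Basis. of_real (u \<bullet> b) * frm x (b # ws)) = frm x ((\<Sum>b\<in>Basis. (u \<bullet> b) *\<^sub>R b) # ws)"
    by (simp add: linear_sum[OF frm_linear_hd] linear_scale[OF frm_linear_hd] scaleR_conv_of_real)
  finally show ?case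
    by (simp add: euclidean_representation algebra_simps)
qed simp

instantiation cl :: (euclidean_space) one
begin
lift_definition one_cl :: "'a cl" is unit_form by simp
instance ..
end

lemma frm_one: "frm 1 ws = (if ws = [] then 1 else 0)"
  by (simp add: one_cl.rep_eq unit_form_def)

lemma con_one [simp]: "con v 1 = 0"
  by (rule cl_eqI) (simp add: frm_one)

lemma par_one [simp]: "par 1 = 1"
  by (rule cl_eqI) (simp add: frm_one)

lift_definition hom_part :: "nat \<Rightarrow> 'e::euclidean_space cl \<Rightarrow> 'e cl" is
  "\<lambda>k \<phi> ws. if length ws = k then \<phi> ws else 0"
proof -
  fix k :: nat and \<phi> :: "'e form" assume a: "alt_form \<phi>"
  have "linear (\<lambda>v. if length (us @ v # ws) = k then \<phi> (us @ v # ws) else 0)" for us ws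
    using alt_form_linear[OF a, of us ws] by (cases "length us + Suc (length ws) = k") (simp_all add: module_hom_zero)
  then show "alt_form (\<lambda>ws. if length ws = k then \<phi> ws else 0)"
    using a by (simp add: alt_form_def)
qed

lemma frm_hom_part [simp]: "frm (hom_part k x) ws = (if length ws = k then frm x ws else 0)"
  by (simp add: hom_part.rep_eq)

definition wedges :: "'e::euclidean_space list \<Rightarrow> 'e cl" where
  "wedges ws = foldr wed ws 1"

lemma wed_sum: "wed v (sum f A) = (\<Sum>a\<in>A. wed v (f a))"
  by (induction A rule: infinite_finite_induct) auto

text \<open>Euler's identity, applied once per degree, recovers a form from its values on basis
  vectors. All lists are summed and not just the increasing ones, so each monomial is counted k!
  times; the division by \<open>Suc k\<close> in each step accumulates this factorial.\<close>

lemma hom_part_expansion: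
  "hom_part k (x :: 'e::euclidean_space cl) =
    (\<Sum>ws | set ws \<subseteq> Basis \<and> length ws = k. (frm x ws / fact k) *C wedges ws)"
proof (induction k arbitrary: x)
  case 0
  have "{ws. set ws \<subseteq> Basis \<and> length ws = 0} = {[] :: 'e list}"
    by auto
  moreover have "hom_part 0 x = frm x [] *C 1"
    by (rule cl_eqI) (auto simp: frm_one)
  ultimately show ?case by (simp add: wedges_def)
next
  case (Suc k)
  let ?B = "{ws :: 'e list. set ws \<subseteq> Basis \<and> length ws = k}"
  have "of_nat (Suc k) *C hom_part (Suc k) x = (\<Sum>b\<in>Basis. wed b (con b (hom_part (Suc k) x)))"
    by (rule cl_eqI) (simp add: frm_sum sum_wed_con)
  also have "\<dots> = (\<Sum>b\<in>Basis. wed b (hom_part k (con b x)))"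
    by (intro sum.cong refl arg_cong[of _ _ "wed _"] cl_eqI) simp
  also have "\<dots> = (\<Sum>b\<in>Basis. \<Sum>ws\<in>?B. (frm x (b # ws) / fact k) *C wedges (b # ws))"
    by (subst Suc) (simp add: wed_sum wedges_def)
  also have "\<dots> = (\<Sum>(ws, b)\<in>?B \<times> Basis. (frm x (b # ws) / fact k) *C wedges (b # ws))"
    by (subst sum.swap) (simp add: sum.cartesian_product)
  also have "\<dots> = (\<Sum>ws | set ws \<subseteq> Basis \<and> length ws = Suc k. (frm x ws / fact k) *C wedges ws)"
    unfolding lists_length_Suc_eq by (subst sum.reindex) (auto simp: inj_on_def intro!: sum.cong)
  finally have "inverse (of_nat (Suc k)) *C of_nat (Suc k) *C hom_part (Suc k) x =
      inverse (of_nat (Suc k)) *C \<dots>"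
    by simp
  moreover have "inverse (of_nat (Suc k)) * of_nat (Suc k) = (1::complex)"
    using of_nat_neq_0[of k] by (simp del: of_nat_Suc)
  ultimately show ?case
    by (simp add: csc_sum field_simps del: of_nat_Suc)
qed

definition cl_index :: "'e::euclidean_space list set" where
  "cl_index = {ws. set ws \<subseteq> Basis \<and> length ws \<le> DIM('e)}"

definition coef :: "'e::euclidean_space list \<Rightarrow> 'e cl \<Rightarrow> complex" where
  "coef ws x = frm x ws / fact (length ws)"

lemma finite_cl_index [simp]: "finite cl_index"
  by (simp add: cl_index_def finite_lists_length_le)

lemma cl_expansion: "(x :: 'e::euclidean_space cl) = (\<Sum>ws\<in>cl_index. coef ws x *C wedges ws)"
proof -
  have "x = (\<Sum>k\<le>DIM('e). hom_part k x)"
    by (rule cl_eqI) (auto simp: frm_sum cl_vanish not_le)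
  also have "\<dots> = (\<Sum>k\<le>DIM('e). \<Sum>ws | set ws \<subseteq> Basis \<and> length ws = k. coef ws x *C wedges ws)"
    by (simp add: hom_part_expansion coef_def)
  also have "\<dots> = (\<Sum>ws\<in>(\<Union>k\<le>DIM('e). {ws. set ws \<subseteq> Basis \<and> length ws = k}). coef ws x *C wedges ws)"
    by (intro sum.UNION_disjoint[symmetric]) (auto simp: finite_lists_length_eq)
  also have "(\<Union>k\<le>DIM('e). {ws. set ws \<subseteq> Basis \<and> length ws = k}) = (cl_index :: 'e list set)"
    by (auto simp: cl_index_def)
  finally show ?thesis .
qed

text \<open>
  With \<open>s = -1\<close> this is the span of the iterated left multiplications by vectors applied to the
  unit; with \<open>s = 1\<close> it gives, up to parity, the span of the right multiplications.
\<close>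

inductive_set cl_span :: "real \<Rightarrow> 'e::euclidean_space cl set" for s where
  one: "1 \<in> cl_span s"
| add: "x \<in> cl_span s \<Longrightarrow> y \<in> cl_span s \<Longrightarrow> x + y \<in> cl_span s"
| csc: "x \<in> cl_span s \<Longrightarrow> a *C x \<in> cl_span s"
| gen: "x \<in> cl_span s \<Longrightarrow> wed v x + s *\<^sub>R con v x \<in> cl_span s"

lemma cl_span_scaleR: "x \<in> cl_span s \<Longrightarrow> r *\<^sub>R x \<in> cl_span s"
  unfolding scaleR_cl_def by (rule cl_span.csc)

lemma cl_span_diff: "x \<in> cl_span s \<Longrightarrow> y \<in> cl_span s \<Longrightarrow> x - y \<in> cl_span s"
  using cl_span.add[of x s "(-1) *\<^sub>R y"] cl_span_scaleR[of y s "-1"] by simp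

lemma cl_span_0: "0 \<in> cl_span s"
  using cl_span.csc[OF cl_span.one, of 0] by simp

text \<open>Passing a contraction through a generator \<open>wed v + s con v\<close> gives a scalar
  minus the generator after the contraction. So the contraction can be pushed down to the unit,
  which it annihilates.\<close>

lemma cl_span_con: "x \<in> cl_span s \<Longrightarrow> con w x \<in> cl_span s"
proof (induction rule: cl_span.induct)
  case (gen x v)
  have "con w (wed v x + s *\<^sub>R con v x) = (w \<bullet> v) *\<^sub>R x - (wed v (con w x) + s *\<^sub>R con v (con w x))"
    by (simp add: con_wed con_con[of w v])
  then show ?case
    using gen by (simp only: cl_span_diff cl_span_scaleR cl_span.gen)
qed (auto intro: cl_span.intros simp: cl_span_0)

text \<open>Since contractions stay in the span, so does \<open>wed v x\<close>, being the generator
  minus a multiple of a contraction. Hence all exterior monomials lie in the span.\<close>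

lemma cl_span_UNIV: "(x :: 'e::euclidean_space cl) \<in> cl_span s"
proof -
  have wed: "wed v x \<in> cl_span s" if "x \<in> cl_span s" for v x
    using cl_span_diff[OF cl_span.gen[OF that, of v] cl_span_scaleR[OF cl_span_con[OF that, of v], of s]] by simp
  have "wedges ws \<in> cl_span s" for ws
    by (induction ws) (auto simp: wedges_def cl_span.one wed)
  then have "coef ws x *C wedges ws \<in> cl_span s" for ws :: "'e list"
    by (rule cl_span.csc)
  moreover have "sum f A \<in> cl_span s" if "\<And>a. a \<in> A \<Longrightarrow> f a \<in> cl_span s" for f :: "'e list \<Rightarrow> 'e cl" and A
    using that by (induction A rule: infinite_finite_induct) (auto simp: cl_span_0 cl_span.add)
  ultimately have "(\<Sum>ws\<in>cl_index. coef ws x *C wedges ws) \<in> cl_span s"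
    by simp
  then show ?thesis
    by (simp flip: cl_expansion)
qed

section \<open>Left and right Clifford multiplication\<close>

definition lvec :: "'e::euclidean_space \<Rightarrow> 'e cl \<Rightarrow> 'e cl" where
  "lvec v x = wed v x - con v x"

text \<open>Right Clifford multiplication by \<open>v\<close>, written down before a product exists:
  for a form of degree p it is (-1)^p times exterior product plus contraction, where left
  multiplication has a minus.\<close>

definition rvec :: "'e::euclidean_space \<Rightarrow> 'e cl \<Rightarrow> 'e cl" where
  "rvec v x = wed v (par x) + con v (par x)"

lemma lvec_induct [case_names one add csc clv]:
  assumes "P 1" and "\<And>x y. P x \<Longrightarrow> P y \<Longrightarrow> P (x + y)" and "\<And>a x. P x \<Longrightarrow> P (a *C x)"
    and "\<And>v x. P x \<Longrightarrow> P (lvec v x)"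
  shows "P x"
  using cl_span_UNIV[of x "-1"]
  by (induction rule: cl_span.induct) (use assms in \<open>auto simp: lvec_def\<close>)

text \<open>\<open>P\<close> is proved for \<open>x\<close> and \<open>par x\<close> together,
  because a generator of the span with s = 1 is \<open>rvec v (par x)\<close>.\<close>

lemma rvec_induct [case_names one add csc clv]:
  assumes "P 1" and "\<And>x y. P x \<Longrightarrow> P y \<Longrightarrow> P (x + y)" and "\<And>a x. P x \<Longrightarrow> P (a *C x)"
    and "\<And>v x. P x \<Longrightarrow> P (rvec v x)"
  shows "P x"
proof -
  have "P x \<and> P (par x)"
    using cl_span_UNIV[of x 1]
  proof (induction rule: cl_span.induct)
    case (gen x v)
    have "wed v x + 1 *\<^sub>R con v x = rvec v (par x)"
      by (simp add: rvec_def)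
    moreover have "par (wed v x + 1 *\<^sub>R con v x) = (-1) *C rvec v x"
      by (simp add: rvec_def wed_par con_par)
    ultimately show ?case
      using gen assms(3,4) by (simp del: csc_simps)
  qed (use assms in auto)
  then show ?thesis ..
qed

text \<open>The sign contributed by \<open>par\<close> compensates the anticommutation of exterior
  products and contractions, and both orders leave the same scalar term. This is associativity with
  a vector on either side, from which the general case will follow.\<close>

lemma lvec_rvec: "lvec u (rvec v x) = rvec v (lvec u x)"
  by (simp add: lvec_def rvec_def con_wed wed_par con_par wed_wed[of u v] con_con[of u v] inner_commute)

lemma lvec_simps [simp]:
  "lvec v (x + y) = lvec v x + lvec v y" "lvec v (a *C x) = a *C lvec v x"
  by (simp_all add: lvec_def)

lemma rvec_simps [simp]:
  "rvec v (x + y) = rvec v x + rvec v y" "rvec v (a *C x) = a *C rvec v x"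
  by (simp_all add: rvec_def)

text \<open>
  The algebra generated by the left multiplications by vectors.  Its elements commute with the
  right multiplications, so they are determined by their values at the unit.
\<close>

inductive_set lops :: "('e::euclidean_space cl \<Rightarrow> 'e cl) set" where
  id: "(\<lambda>x. x) \<in> lops"
| add: "S \<in> lops \<Longrightarrow> T \<in> lops \<Longrightarrow> (\<lambda>x. S x + T x) \<in> lops"
| csc: "S \<in> lops \<Longrightarrow> (\<lambda>x. a *C S x) \<in> lops"
| clv: "S \<in> lops \<Longrightarrow> (\<lambda>x. lvec v (S x)) \<in> lops"

lemma lops_add: "T \<in> lops \<Longrightarrow> T (x + y) = T x + T y"
  by (induction rule: lops.induct) (auto simp: algebra_simps)

lemma lops_csc: "T \<in> lops \<Longrightarrow> T (a *C x) = a *C T x"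
  by (induction rule: lops.induct) (auto simp: mult.commute)

lemma lops_rvec: "T \<in> lops \<Longrightarrow> T (rvec v x) = rvec v (T x)"
  by (induction rule: lops.induct) (auto simp: lvec_rvec)

lemma lops_comp: "S \<in> lops \<Longrightarrow> T \<in> lops \<Longrightarrow> (\<lambda>x. S (T x)) \<in> lops"
  by (induction rule: lops.induct) (auto intro: lops.intros)

lemma lops_eqI:
  assumes "S \<in> lops" "T \<in> lops" "S 1 = T 1"
  shows "S = T"
proof
  show "S x = T x" for x
    by (induction x rule: rvec_induct) (simp_all add: assms lops_add lops_csc lops_rvec)
qed

lemma lops_ex: "\<exists>T\<in>lops. T 1 = x"
  by (induction x rule: lvec_induct) (fastforce intro: lops.intros)+

text \<open>Left multiplication by \<open>x\<close> is characterized as the one operator in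
  \<open>lops\<close> that sends the unit to \<open>x\<close>. With this as the product,
  associativity is closure of \<open>lops\<close> under composition.\<close>

definition lmul :: "'e::euclidean_space cl \<Rightarrow> 'e cl \<Rightarrow> 'e cl" where
  "lmul x = (THE T. T \<in> lops \<and> T 1 = x)"

lemma lmul: "lmul x \<in> lops" "lmul x 1 = x"
proof -
  have "\<exists>!T. T \<in> lops \<and> T 1 = x"
    using lops_ex[of x] lops_eqI by metis
  from theI'[OF this] show "lmul x \<in> lops" "lmul x 1 = x"
    by (auto simp: lmul_def)
qed

lemma lmul_eqI: "T \<in> lops \<Longrightarrow> T 1 = x \<Longrightarrow> lmul x = T"
  using lops_eqI[OF lmul(1), of T x] by (simp add: lmul)

instantiation cl :: (euclidean_space) real_algebra_1
begin

definition times_cl :: "'a cl \<Rightarrow> 'a cl \<Rightarrow> 'a cl" where "times_cl = lmul"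

instance
proof
  have "lmul (lmul x y) = (\<lambda>z. lmul x (lmul y z))" for x y :: "'a cl"
    by (rule lmul_eqI) (simp_all add: lops_comp lmul)
  then show "x * y * z = x * (y * z)" for x y z :: "'a cl"
    by (simp add: times_cl_def fun_eq_iff)
  have "lmul (x + y) = (\<lambda>z. lmul x z + lmul y z)" for x y :: "'a cl"
    by (rule lmul_eqI) (simp_all add: lops.add lmul)
  then show "(x + y) * z = x * z + y * z" for x y z :: "'a cl"
    by (simp add: times_cl_def fun_eq_iff)
  show "x * (y + z) = x * y + x * z" for x y z :: "'a cl"
    by (simp add: times_cl_def lops_add lmul)
  have "lmul 1 = (\<lambda>x :: 'a cl. x)"
    by (rule lmul_eqI) (simp_all add: lops.id)
  then show "1 * x = x" for x :: "'a cl"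
    by (simp add: times_cl_def)
  show "x * 1 = x" for x :: "'a cl"
    by (simp add: times_cl_def lmul)
  have "lmul (r *\<^sub>R x) = (\<lambda>z. of_real r *C lmul x z)" for r and x :: "'a cl"
    by (rule lmul_eqI, rule lops.csc) (simp_all add: lmul)
  then show "(r *\<^sub>R x) * y = r *\<^sub>R (x * y)" for r and x y :: "'a cl"
    by (simp add: times_cl_def)
  show "x * (r *\<^sub>R y) = r *\<^sub>R (x * y)" for r and x y :: "'a cl"
    by (simp add: times_cl_def scaleR_cl_def lops_csc lmul del: csc_of_real)
  have "frm (0 :: 'a cl) [] \<noteq> frm 1 []"
    by (simp add: frm_one)
  then show "(0 :: 'a cl) \<noteq> 1"
    by metis
qed

end

lemma csc_mult_left [simp]: "(a *C x) * y = a *C (x * y)"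
proof -
  have "lmul (a *C x) = (\<lambda>z. a *C lmul x z)"
    by (rule lmul_eqI) (simp_all add: lops.csc lmul)
  then show ?thesis by (simp add: times_cl_def)
qed

lemma csc_mult_right [simp]: "x * (a *C y) = a *C (x * y)"
  by (simp add: times_cl_def lops_csc lmul)

definition clv :: "'e::euclidean_space \<Rightarrow> 'e cl" where
  "clv v = lvec v 1"

lemma clv_mult: "clv v * x = wed v x - con v x"
proof -
  have "lmul (clv v) = lvec v"
    by (rule lmul_eqI) (auto simp: clv_def intro: lops.intros)
  then show ?thesis
    by (simp add: times_cl_def lvec_def)
qed

lemma mult_clv: "x * clv v = wed v (par x) + con v (par x)"
proof -
  have "rvec v 1 = clv v"
    by (simp add: clv_def lvec_def rvec_def)
  then have "x * clv v = rvec v (lmul x 1)"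
    by (metis lmul(1) lops_rvec times_cl_def)
  then show ?thesis
    by (simp add: lmul rvec_def)
qed

lemma cl_induct [case_names one add csc clv]:
  assumes "P 1" and "\<And>x y. P x \<Longrightarrow> P y \<Longrightarrow> P (x + y)" and "\<And>a x. P x \<Longrightarrow> P (a *C x)"
    and "\<And>v x. P x \<Longrightarrow> P (clv v * x)"
  shows "P x"
  by (induction x rule: lvec_induct) (use assms in \<open>simp_all add: clv_mult lvec_def\<close>)

lemma frm_clv: "frm (clv v) = vec_form (\<bullet>) v"
proof
  show "frm (clv v) ws = vec_form (\<bullet>) v ws" for ws
    by (cases ws) (auto simp: clv_def lvec_def vec_form_def frm_one split: list.splits)
qed

lemma linear_clv: "linear clv"
  by (intro linearI cl_eqI) (simp_all add: frm_clv vec_form_def inner_add_left split: list.splits)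

lemmas clv_simps [simp] = linear_add[OF linear_clv] linear_diff[OF linear_clv]
  linear_neg[OF linear_clv] linear_0[OF linear_clv] linear_scale[OF linear_clv]

lemma clv_clv: "clv u * clv v + clv v * clv u = - ((2 * (u \<bullet> v)) *\<^sub>R 1)"
proof -
  have "clv u * clv v = wed u (wed v 1) - (u \<bullet> v) *\<^sub>R 1" for u v :: 'a
    by (simp add: clv_mult con_wed) (simp add: clv_def lvec_def con_wed)
  then have "clv u * clv v + clv v * clv u = (wed u (wed v 1) - (u \<bullet> v) *\<^sub>R 1) + (wed v (wed u 1) - (v \<bullet> u) *\<^sub>R 1)"
    by simp
  also have "\<dots> = - ((u \<bullet> v + v \<bullet> u) *\<^sub>R 1)"
    unfolding wed_wed[of u v] scaleR_left_distrib by simp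
  finally show ?thesis
    by (simp only: inner_commute[of v u] mult_2)
qed

section \<open>Transposition and orthogonal automorphisms\<close>

text \<open>On a form of degree p, reversing the arguments is the sign (-1)^(p(p-1)/2), and so is
  reversing a product of p orthogonal vectors. The encoding thus refers neither to a basis nor to
  the product.\<close>

lift_definition tr :: "'e::euclidean_space cl \<Rightarrow> 'e cl" is "\<lambda>\<phi> ws. \<phi> (rev ws)"
proof -
  fix \<phi> :: "'e form" assume a: "alt_form \<phi>"
  show "alt_form (\<lambda>ws. \<phi> (rev ws))"
  proof (unfold alt_form_def, intro conjI allI)
    show "linear (\<lambda>v. \<phi> (rev (us @ v # ws)))" for us ws
      using alt_form_linear[OF a, of "rev ws" "rev us"] by simp
    show "\<phi> (rev (us @ v # vs @ v # ws)) = 0" for us v vs ws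
      using a unfolding alt_form_def by auto
  qed
qed

lemma frm_tr [simp]: "frm (tr x) ws = frm x (rev ws)"
  by (simp add: tr.rep_eq)

lemma tr_simps [simp]:
  "tr (x + y) = tr x + tr y" "tr (x - y) = tr x - tr y" "tr (- x) = - tr x"
  "tr 0 = 0" "tr (a *C x) = a *C tr x" "tr (r *\<^sub>R x) = r *\<^sub>R tr x" "tr (tr x) = x"
  by (auto intro!: cl_eqI)

lemma tr_sum: "tr (sum f A) = (\<Sum>i\<in>A. tr (f i))"
  by (induction A rule: infinite_finite_induct) simp_all

lemma tr_one [simp]: "tr 1 = 1"
  by (rule cl_eqI) (simp add: frm_one)

lemma frm_snoc: "frm x (ws @ [v]) = (-1) ^ length ws * frm x (v # ws)"
  using alt_form_move[of "frm x" ws v "[]"] by simp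

lemma tr_con: "tr (con v x) = - con v (par (tr x))"
  by (rule cl_eqI) (simp add: frm_snoc)

text \<open>The recursion for \<open>wed\<close> consumes the first argument, while the reversed
  list exposes its last one; \<open>frm_snoc\<close> carries an argument from one end to the other
  at the cost of a sign.\<close>

lemma tr_wed: "tr (wed v x) = wed v (par (tr x))"
proof (rule cl_eqI)
  show "frm (tr (wed v x)) ws = frm (wed v (par (tr x))) ws" for ws
  proof (induction ws arbitrary: x rule: rev_induct)
    case (snoc u ws)
    have sq: "(-1) ^ length ws * ((-1) ^ length ws * a) = (a :: complex)" for a
      by simp
    have "frm (tr (wed v x)) (ws @ [u]) = of_real (v \<bullet> u) * frm (tr x) ws - frm (tr (wed v (con u x))) ws"
      by simp
    also have "frm (tr (wed v (con u x))) ws = frm (wed v (par (tr (con u x)))) ws"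
      by (rule snoc)
    also have "par (tr (con u x)) = con u (tr x)"
      by (simp add: tr_con con_par)
    also have "of_real (v \<bullet> u) * frm (tr x) ws - frm (wed v (con u (tr x))) ws = frm (wed v (tr x)) (u # ws)"
      by simp
    also have "\<dots> = (-1) ^ length ws * frm (wed v (tr x)) (ws @ [u])"
      by (simp only: frm_snoc sq)
    also have "\<dots> = frm (- par (wed v (tr x))) (ws @ [u])"
      by simp
    finally show ?case by (simp only: wed_par)
  qed simp
qed

lemma tr_mult: "tr (x * y) = tr y * tr x"
proof (induction x rule: cl_induct)
  case (clv v x)
  have *: "tr (clv v * z) = tr z * clv v" for z :: "'a cl"
    by (simp add: clv_mult mult_clv tr_wed tr_con)
  show ?case
    by (simp only: mult.assoc * clv)
qed (simp_all add: algebra_simps)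

lemma tr_clv [simp]: "tr (clv v) = clv v"
  using tr_wed[of v 1] by (simp add: clv_def lvec_def)

text \<open>Contravariant: for orthogonal \<open>r\<close> it sends \<open>clv (r w)\<close> to
  \<open>clv w\<close>, so the automorphism extending an orthogonal map is the pullback along its
  inverse. \<open>Abs_cl\<close> is applied directly because the result is known to alternate only
  for linear \<open>r\<close>.\<close>

definition pull :: "('e::euclidean_space \<Rightarrow> 'e) \<Rightarrow> 'e cl \<Rightarrow> 'e cl" where
  "pull r x = Abs_cl (\<lambda>ws. frm x (map r ws))"

lemma alt_form_map:
  assumes "linear r" "alt_form \<phi>"
  shows "alt_form (\<lambda>ws. \<phi> (map r ws))"
proof (unfold alt_form_def, intro conjI allI)
  show "linear (\<lambda>v. \<phi> (map r (us @ v # ws)))" for us ws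
    using linear_compose[OF assms(1) alt_form_linear[OF assms(2), of "map r us" "map r ws"]]
    by (simp add: o_def)
  show "\<phi> (map r (us @ v # vs @ v # ws)) = 0" for us v vs ws
    using assms(2) unfolding alt_form_def by simp
qed

lemma frm_pull: "linear r \<Longrightarrow> frm (pull r x) ws = frm x (map r ws)"
  by (simp add: pull_def Abs_cl_inverse alt_form_map)

context
  fixes r :: "'e::euclidean_space \<Rightarrow> 'e"
  assumes lin: "linear r"
begin

lemma pull_simps:
  "pull r (x + y) = pull r x + pull r y" "pull r (a *C x) = a *C pull r x"
  "pull r (x - y) = pull r x - pull r y" "pull r (- x) = - pull r x"
  "pull r 0 = 0" "pull r (s *\<^sub>R x) = s *\<^sub>R pull r x" "pull r 1 = 1"
  by (auto intro!: cl_eqI simp: frm_pull[OF lin] frm_one)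

lemma pull_con: "con v (pull r x) = pull r (con (r v) x)"
  by (auto intro!: cl_eqI simp: frm_pull[OF lin])

lemma pull_wed: 
  assumes "\<And>u. v \<bullet> r u = w \<bullet> u"
  shows "pull r (wed v x) = wed w (pull r x)"
proof (rule cl_eqI)
  show "frm (pull r (wed v x)) ws = frm (wed w (pull r x)) ws" for ws
    by (induction ws arbitrary: x) (simp_all add: frm_pull[OF lin] assms pull_con)
qed

lemma pull_clv_mult:
  assumes "\<And>u v. r u \<bullet> r v = u \<bullet> v"
  shows "pull r (clv (r w) * x) = clv w * pull r x"
  by (simp add: clv_mult pull_simps pull_con pull_wed[of "r w" w] assms)

lemma pull_clv: "(\<And>u v. r u \<bullet> r v = u \<bullet> v) \<Longrightarrow> pull r (clv (r w)) = clv w"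
  using pull_clv_mult[of w 1] by (simp add: pull_simps)

text \<open>An orthogonal map is injective, hence onto in finite dimension, so every generator has
  the form \<open>clv (r w)\<close> required by \<open>pull_clv_mult\<close>.\<close>

lemma pull_mult:
  assumes orth: "\<And>u v. r u \<bullet> r v = u \<bullet> v"
  shows "pull r (x * y) = pull r x * pull r y"
proof (induction x rule: cl_induct)
  case (clv v x)
  have "inj r"
    by (auto simp: linear_injective_0[OF lin]) (metis orth inner_eq_zero_iff)
  then obtain w where "v = r w"
    using linear_inj_imp_surj[OF lin] by (metis surjD)
  then show ?case
    by (simp add: mult.assoc pull_clv_mult[OF orth] clv)
qed (simp_all add: pull_simps algebra_simps)

end

section \<open>Calculus of smooth maps\<close>

lemma sum_basis_linear:
  assumes "linear (f :: 'e::euclidean_space \<Rightarrow> 'b::real_vector)"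
  shows "(\<Sum>b\<in>Basis. (v \<bullet> b) *\<^sub>R f b) = f v"
  using linear_sum[OF assms, of "\<lambda>b. (v \<bullet> b) *\<^sub>R b" Basis]
  by (simp add: euclidean_representation linear_scale[OF assms])

abbreviation pd :: "('a::real_normed_vector \<Rightarrow> 'b::real_normed_vector) \<Rightarrow> 'a \<Rightarrow> 'a \<Rightarrow> 'b" where
  "pd f x u \<equiv> frechet_derivative f (at x) u"

lemma pd_eqI: "(f has_derivative f') (at x) \<Longrightarrow> pd f x u = f' u"
  by (metis frechet_derivative_at)

lemma differentiable_pd: "f differentiable (at x) \<Longrightarrow> (f has_derivative pd f x) (at x)"
  by (simp add: frechet_derivative_works)

lemma pd_bilinear:
  assumes "bounded_bilinear h" "f differentiable (at x)" "g differentiable (at x)"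
  shows "pd (\<lambda>y. h (f y) (g y)) x u = h (f x) (pd g x u) + h (pd f x u) (g x)"
  using bounded_bilinear.FDERIV[OF assms(1)] assms(2,3)
  by (intro pd_eqI) (simp add: frechet_derivative_works)

lemma pd_add:
  assumes "f differentiable (at x)" "g differentiable (at x)"
  shows "pd (\<lambda>y. f y + g y) x u = pd f x u + pd g x u"
  using assms by (intro pd_eqI) (simp add: frechet_derivative_works has_derivative_add)

lemma pd_sum:
  assumes "\<And>i. i \<in> I \<Longrightarrow> f i differentiable (at x)"
  shows "pd (\<lambda>y. \<Sum>i\<in>I. f i y) x u = (\<Sum>i\<in>I. pd (f i) x u)"
  using pd_eqI[OF has_derivative_sum[of I f "\<lambda>i. pd (f i) x"]] assms differentiable_pd by blast

lemma pd_bounded_linear: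
  assumes "bounded_linear h" "f differentiable (at x)"
  shows "pd (\<lambda>y. h (f y)) x u = h (pd f x u)"
  by (rule pd_eqI[OF bounded_linear.has_derivative[OF assms(1) differentiable_pd[OF assms(2)]]])

lemma pd_cong:
  fixes f :: "'a::real_normed_vector \<Rightarrow> 'b::real_normed_vector"
  assumes "open S" "x \<in> S" "\<And>y. y \<in> S \<Longrightarrow> f y = g y" "g differentiable (at x)"
  shows "pd f x u = pd g x u"
proof -
  have "(f has_derivative pd g x) (at x)"
    by (rule has_derivative_transform_within_open[OF differentiable_pd[OF assms(4)] assms(1,2)])
      (simp add: assms(3))
  then show ?thesis by (rule pd_eqI)
qed

lemma differentiable_cong_open:
  fixes f :: "'a::real_normed_vector \<Rightarrow> 'b::real_normed_vector"
  assumes "open S" "x \<in> S" "\<And>y. y \<in> S \<Longrightarrow> f y = g y" "g differentiable (at x)"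
  shows "f differentiable (at x)"
proof -
  have "(f has_derivative pd g x) (at x)"
    by (rule has_derivative_transform_within_open[OF differentiable_pd[OF assms(4)] assms(1,2)])
      (simp add: assms(3))
  then show ?thesis by (rule differentiableI)
qed

lemma differentiable_bilinear:
  assumes "bounded_bilinear h" "f differentiable (at x)" "g differentiable (at x)"
  shows "(\<lambda>y. h (f y) (g y)) differentiable (at x)"
  using bounded_bilinear.FDERIV[OF assms(1)] assms(2,3) unfolding differentiable_def by blast

lemma differentiable_bounded_linear:
  assumes "bounded_linear h" "f differentiable (at x)"
  shows "(\<lambda>y. h (f y)) differentiable (at x)"
  using assms bounded_linear.has_derivative unfolding differentiable_def by blast

lemma C_on_cong:
  assumes "open S" "\<And>x. x \<in> S \<Longrightarrow> f x = g x" "C_on k g S"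
  shows "C_on k f S"
  using assms(2,3)
proof (induction k arbitrary: f g)
  case 0
  then show ?case using continuous_on_cong[of S S f g] by simp
next
  case (Suc k)
  have g: "g differentiable (at x)" if "x \<in> S" for x
    using Suc.prems(2) that by simp
  have "C_on k (\<lambda>x. pd f x u) S" for u
  proof (rule Suc.IH)
    show "pd f x u = pd g x u" if "x \<in> S" for x
      by (rule pd_cong[OF assms(1) that Suc.prems(1) g[OF that]])
    show "C_on k (\<lambda>x. pd g x u) S"
      using Suc.prems(2) by simp
  qed
  moreover have "f differentiable (at x)" if "x \<in> S" for x
    by (rule differentiable_cong_open[OF assms(1) that Suc.prems(1) g[OF that]])
  ultimately show ?case by simp
qed

text \<open>The product rule leaves undifferentiated factors, which must also be known to be of the
  lower class. In the base case continuity comes from differentiability.\<close>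

lemma C_on_SucD: "C_on (Suc k) f S \<Longrightarrow> C_on k f S"
proof (induction k arbitrary: f)
  case 0
  then show ?case
    by (auto intro!: differentiable_imp_continuous_on simp: differentiable_on_def differentiable_at_withinI)
next
  case (Suc k)
  have "\<forall>x\<in>S. f differentiable (at x)"
    using Suc.prems unfolding C_on.simps(2)[of "Suc k"] by (rule conjunct1)
  moreover have "C_on (Suc k) (\<lambda>x. pd f x u) S" for u
    using Suc.prems unfolding C_on.simps(2)[of "Suc k"] by blast
  then have "C_on k (\<lambda>x. pd f x u) S" for u
    by (rule Suc.IH)
  ultimately show ?case by simp
qed

lemma C_on_const: "C_on k (\<lambda>x. c) S"
  by (induction k arbitrary: c) auto

lemma C_on_add:
  assumes "open S" "C_on k f S" "C_on k g S"
  shows "C_on k (\<lambda>x. f x + g x) S"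
  using assms(2,3)
proof (induction k arbitrary: f g)
  case (Suc k)
  have "C_on k (\<lambda>x. pd (\<lambda>x. f x + g x) x u) S" for u
  proof (rule C_on_cong[OF assms(1)])
    show "C_on k (\<lambda>x. pd f x u + pd g x u) S"
      using Suc.prems by (intro Suc.IH) auto
  qed (use Suc.prems in \<open>auto intro: pd_add\<close>)
  then show ?case using Suc.prems by auto
qed (auto intro: continuous_on_add)

lemma C_on_bounded_linear:
  assumes "open S" "bounded_linear h" "C_on k f S"
  shows "C_on k (\<lambda>x. h (f x)) S"
  using assms(3)
proof (induction k arbitrary: f)
  case (Suc k)
  have "C_on k (\<lambda>x. pd (\<lambda>x. h (f x)) x u) S" for u
  proof (rule C_on_cong[OF assms(1)])
    show "C_on k (\<lambda>x. h (pd f x u)) S"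
      using Suc.prems by (intro Suc.IH) auto
  qed (use Suc.prems in \<open>auto intro: pd_bounded_linear[OF assms(2)]\<close>)
  then show ?case using Suc.prems differentiable_bounded_linear[OF assms(2)] by auto
qed (auto intro: bounded_linear.continuous_on[OF assms(2)])

lemma C_on_bilinear:
  assumes "open S" "bounded_bilinear h" "C_on k f S" "C_on k g S"
  shows "C_on k (\<lambda>x. h (f x) (g x)) S"
  using assms(3,4)
proof (induction k arbitrary: f g)
  case (Suc k)
  have "C_on k (\<lambda>x. pd (\<lambda>x. h (f x) (g x)) x u) S" for u
  proof (rule C_on_cong[OF assms(1)])
    show "C_on k (\<lambda>x. h (f x) (pd g x u) + h (pd f x u) (g x)) S"
      using Suc.prems C_on_SucD[of k f S] C_on_SucD[of k g S]
      by (intro C_on_add[OF assms(1)] Suc.IH) auto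
  qed (use Suc.prems in \<open>auto intro: pd_bilinear[OF assms(2)]\<close>)
  moreover have "(\<lambda>x. h (f x) (g x)) differentiable (at x)" if "x \<in> S" for x
    using Suc.prems that by (intro differentiable_bilinear[OF assms(2)]) auto
  ultimately show ?case by simp
qed (auto intro: bounded_bilinear.continuous_on[OF assms(2)])

text \<open>The derivative is a product of \<open>inverse f\<close>, \<open>pd f\<close> and
  \<open>inverse f\<close> again, so the induction hypothesis for the inverse itself closes the
  step.\<close>

lemma C_on_inverse:
  fixes f :: "'a::euclidean_space \<Rightarrow> real"
  assumes "open S" "\<And>x. x \<in> S \<Longrightarrow> f x \<noteq> 0" "C_on k f S"
  shows "C_on k (\<lambda>x. inverse (f x)) S"
  using assms(3)
proof (induction k)
  case (Suc k)
  have d: "((\<lambda>x. inverse (f x)) has_derivative (\<lambda>u. - (inverse (f x) * pd f x u * inverse (f x)))) (at x)"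
    if "x \<in> S" for x
    using Suc.prems that assms(2) by (intro Deriv.has_derivative_inverse differentiable_pd) auto
  have "C_on k (\<lambda>x. pd (\<lambda>x. inverse (f x)) x u) S" for u
  proof (rule C_on_cong[OF assms(1)])
    have "C_on k (\<lambda>x. inverse (f x)) S" "C_on k (\<lambda>x. pd f x u) S"
      using Suc C_on_SucD by auto
    then show "C_on k (\<lambda>x. - (inverse (f x) * pd f x u * inverse (f x))) S"
      by (intro C_on_bounded_linear[OF assms(1) bounded_linear_minus[OF bounded_linear_ident]]
          C_on_bilinear[OF assms(1) bounded_bilinear_mult])
  qed (rule pd_eqI[OF d])
  then show ?case
    using d unfolding C_on.simps differentiable_def by blast
qed (use assms(2) in \<open>auto intro: continuous_on_inverse\<close>)

lemma C_on_sqrt: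
  fixes f :: "'a::euclidean_space \<Rightarrow> real"
  assumes "open S" "\<And>x. x \<in> S \<Longrightarrow> f x > 0" "C_on k f S"
  shows "C_on k (\<lambda>x. sqrt (f x)) S"
  using assms(3)
proof (induction k)
  case (Suc k)
  have d: "((\<lambda>x. sqrt (f x)) has_derivative (\<lambda>u. pd f x u * (inverse (sqrt (f x)) / 2))) (at x)"
    if "x \<in> S" for x
    using Suc.prems that assms(2) by (intro has_derivative_real_sqrt differentiable_pd) auto
  have "C_on k (\<lambda>x. pd (\<lambda>x. sqrt (f x)) x u) S" for u
  proof (rule C_on_cong[OF assms(1)])
    have "C_on k (\<lambda>x. sqrt (f x)) S" "C_on k (\<lambda>x. pd f x u) S"
      using Suc C_on_SucD by auto
    moreover have "sqrt (f x) \<noteq> 0" if "x \<in> S" for x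
      using assms(2)[OF that] by simp
    ultimately show "C_on k (\<lambda>x. pd f x u * (inverse (sqrt (f x)) / 2)) S"
      by (intro C_on_bilinear[OF assms(1) bounded_bilinear_mult] C_on_inverse[OF assms(1)]
          C_on_bounded_linear[OF assms(1) bounded_linear_divide]) auto
  qed (rule pd_eqI[OF d])
  then show ?case
    using d unfolding C_on.simps differentiable_def by blast
qed (auto intro: continuous_on_real_sqrt)

lemma smooth_on_const [simp]: "smooth_on S (\<lambda>x. c)"
  by (simp add: smooth_on_def C_on_const)

lemma smooth_on_differentiable: "smooth_on S f \<Longrightarrow> x \<in> S \<Longrightarrow> f differentiable (at x)"
  unfolding smooth_on_def using C_on.simps(2)[of 0] by blast

lemma smooth_on_pd: "smooth_on S f \<Longrightarrow> smooth_on S (\<lambda>x. pd f x u)"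
  unfolding smooth_on_def using C_on.simps(2) by blast

context
  fixes S :: "'a::euclidean_space set"
  assumes S: "open S"
begin

lemma smooth_on_cong: "smooth_on S g \<Longrightarrow> (\<And>x. x \<in> S \<Longrightarrow> f x = g x) \<Longrightarrow> smooth_on S f"
  using C_on_cong[OF S] unfolding smooth_on_def by blast

lemma smooth_on_add: "smooth_on S f \<Longrightarrow> smooth_on S g \<Longrightarrow> smooth_on S (\<lambda>x. f x + g x)"
  using C_on_add[OF S] unfolding smooth_on_def by blast

lemma smooth_on_bounded_linear: "bounded_linear h \<Longrightarrow> smooth_on S f \<Longrightarrow> smooth_on S (\<lambda>x. h (f x))"
  using C_on_bounded_linear[OF S] unfolding smooth_on_def by blast

lemma smooth_on_bilinear:
  "bounded_bilinear h \<Longrightarrow> smooth_on S f \<Longrightarrow> smooth_on S g \<Longrightarrow> smooth_on S (\<lambda>x. h (f x) (g x))"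
  using C_on_bilinear[OF S] unfolding smooth_on_def by blast

lemmas smooth_on_scaleR = smooth_on_bilinear[OF bounded_bilinear_scaleR]
lemmas smooth_on_mult = smooth_on_bilinear[OF bounded_bilinear_mult]
lemmas smooth_on_minus = smooth_on_bounded_linear[OF bounded_linear_minus[OF bounded_linear_ident]]
lemmas smooth_on_inner_left = smooth_on_bounded_linear[OF bounded_linear_inner_left]

lemma smooth_on_diff: "smooth_on S f \<Longrightarrow> smooth_on S g \<Longrightarrow> smooth_on S (\<lambda>x. f x - g x)"
  using smooth_on_add[of f "\<lambda>x. - g x"] smooth_on_minus[of g] by simp

lemma smooth_on_sum: "(\<And>i. i \<in> I \<Longrightarrow> smooth_on S (f i)) \<Longrightarrow> smooth_on S (\<lambda>x. \<Sum>i\<in>I. f i x)"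
  by (induction I rule: infinite_finite_induct) (auto intro: smooth_on_add)

lemma smooth_on_inverse:
  "smooth_on S f \<Longrightarrow> (\<And>x. x \<in> S \<Longrightarrow> f x \<noteq> 0) \<Longrightarrow> smooth_on S (\<lambda>x. inverse (f x :: real))"
  using C_on_inverse[OF S] unfolding smooth_on_def by blast

lemma smooth_on_sqrt:
  "smooth_on S f \<Longrightarrow> (\<And>x. x \<in> S \<Longrightarrow> f x > 0) \<Longrightarrow> smooth_on S (\<lambda>x. sqrt (f x))"
  using C_on_sqrt[OF S] unfolding smooth_on_def by blast

text \<open>Smoothness of a tensor field is given on constant vectors; expanding variable arguments
  in the standard basis reduces to these.\<close>

lemma smooth_on_bilinear_family:
  fixes h :: "'a \<Rightarrow> 'a \<Rightarrow> 'a \<Rightarrow> 'b::real_normed_vector"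
  assumes "\<And>x. x \<in> S \<Longrightarrow> bilinear (h x)" and "\<And>u v. smooth_on S (\<lambda>x. h x u v)"
    and "smooth_on S Y" "smooth_on S Z"
  shows "smooth_on S (\<lambda>x. h x (Y x) (Z x))"
proof (rule smooth_on_cong)
  show "smooth_on S (\<lambda>x. \<Sum>b\<in>Basis. \<Sum>c\<in>Basis. (Y x \<bullet> b) *\<^sub>R (Z x \<bullet> c) *\<^sub>R h x b c)"
    using assms(2-) by (intro smooth_on_sum smooth_on_scaleR smooth_on_inner_left)
  show "h x (Y x) (Z x) = (\<Sum>b\<in>Basis. \<Sum>c\<in>Basis. (Y x \<bullet> b) *\<^sub>R (Z x \<bullet> c) *\<^sub>R h x b c)" if "x \<in> S" for x
  proof -
    have "h x (Y x) (Z x) = h x (\<Sum>b\<in>Basis. (Y x \<bullet> b) *\<^sub>R b) (\<Sum>c\<in>Basis. (Z x \<bullet> c) *\<^sub>R c)"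
      by (simp only: euclidean_representation)
    also have "\<dots> = (\<Sum>b\<in>Basis. \<Sum>c\<in>Basis. (Y x \<bullet> b) *\<^sub>R (Z x \<bullet> c) *\<^sub>R h x b c)"
      using assms(1)[OF that]
      by (simp add: bilinear_sum bilinear_lmul bilinear_rmul sum.cartesian_product)
    finally show ?thesis .
  qed
qed

lemma smooth_on_linear_family:
  fixes h :: "'a \<Rightarrow> 'a \<Rightarrow> 'b::real_normed_vector"
  assumes "\<And>x. x \<in> S \<Longrightarrow> linear (h x)" and "\<And>u. smooth_on S (\<lambda>x. h x u)" and "smooth_on S Y"
  shows "smooth_on S (\<lambda>x. h x (Y x))"
proof (rule smooth_on_cong)
  show "smooth_on S (\<lambda>x. \<Sum>b\<in>Basis. (Y x \<bullet> b) *\<^sub>R h x b)"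
    using assms(2-) by (intro smooth_on_sum smooth_on_scaleR smooth_on_inner_left)
  show "h x (Y x) = (\<Sum>b\<in>Basis. (Y x \<bullet> b) *\<^sub>R h x b)" if "x \<in> S" for x
    by (rule sum_basis_linear[OF assms(1)[OF that], symmetric])
qed

lemma smooth_on_form_map:
  fixes \<phi> :: "'a \<Rightarrow> 'a form"
  assumes "smooth_form_on S \<phi>" and P: "\<And>v. smooth_on S (\<lambda>x. P x v)"
  shows "smooth_on S (\<lambda>x. \<phi> x (map (P x) ws))"
proof -
  have alt: "\<And>x. x \<in> S \<Longrightarrow> alt_form (\<phi> x)" and sm: "\<And>ws. smooth_on S (\<lambda>x. \<phi> x ws)"
    using assms(1) by (auto simp: smooth_form_on_def)
  \<comment> \<open>The prefix \<open>us\<close> collects the constant vectors that have already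
    replaced arguments depending on \<open>x\<close>.\<close>
  have "smooth_on S (\<lambda>x. \<phi> x (us @ map (P x) ws))" for us
  proof (induction ws arbitrary: us)
    case (Cons w ws)
    show ?case
    proof (rule smooth_on_cong)
      show "smooth_on S (\<lambda>x. \<Sum>b\<in>Basis. (P x w \<bullet> b) *\<^sub>R \<phi> x ((us @ [b]) @ map (P x) ws))"
        by (intro smooth_on_sum smooth_on_scaleR smooth_on_inner_left P Cons)
      show "\<phi> x (us @ map (P x) (w # ws)) =
          (\<Sum>b\<in>Basis. (P x w \<bullet> b) *\<^sub>R \<phi> x ((us @ [b]) @ map (P x) ws))" if "x \<in> S" for x
        using sum_basis_linear[OF alt_form_linear[OF alt[OF that], of us "map (P x) ws"]] by simp
    qed
  qed (simp add: sm)
  from this[of "[]"] show ?thesis by simp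
qed

end

section \<open>The norm topology of the Clifford algebra\<close>

instantiation cl :: (euclidean_space) real_normed_vector
begin

text \<open>The sum norm of the coefficients in \<open>cl_expansion\<close>. A norm on
  \<open>cl\<close> is what gives meaning to derivatives of Clifford valued fields.\<close>

definition norm_cl :: "'a cl \<Rightarrow> real" where "norm_cl x = (\<Sum>ws\<in>cl_index. cmod (coef ws x))"
definition dist_cl :: "'a cl \<Rightarrow> 'a cl \<Rightarrow> real" where "dist_cl x y = norm (x - y)"
definition sgn_cl :: "'a cl \<Rightarrow> 'a cl" where "sgn_cl x = x /\<^sub>R norm x"
definition uniformity_cl :: "('a cl \<times> 'a cl) filter"
  where "uniformity_cl = (INF e\<in>{0 <..}. principal {(x, y). dist x y < e})"
definition open_cl :: "'a cl set \<Rightarrow> bool"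
  where "open_cl U \<longleftrightarrow> (\<forall>x\<in>U. \<forall>\<^sub>F (x', y) in uniformity. x' = x \<longrightarrow> y \<in> U)"

instance
proof
  show "norm x = 0 \<longleftrightarrow> x = 0" for x :: "'a cl"
  proof
    assume "norm x = 0"
    then have "\<forall>ws\<in>cl_index. coef ws x = 0"
      by (simp add: norm_cl_def sum_nonneg_eq_0_iff)
    then show "x = 0"
      by (subst cl_expansion) simp
  qed (simp add: norm_cl_def coef_def)
  show "norm (x + y) \<le> norm x + norm y" for x y :: "'a cl"
    unfolding norm_cl_def sum.distrib[symmetric]
    by (intro sum_mono) (simp add: coef_def add_divide_distrib norm_triangle_ineq flip: norm_divide)
  show "norm (r *\<^sub>R x) = \<bar>r\<bar> * norm x" for r and x :: "'a cl"
    by (simp add: norm_cl_def coef_def norm_mult norm_divide sum_distrib_left)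
qed (simp_all add: dist_cl_def sgn_cl_def uniformity_cl_def open_cl_def)

end

lemma cmod_coef_le: "ws \<in> cl_index \<Longrightarrow> cmod (coef ws x) \<le> norm x"
  unfolding norm_cl_def by (rule member_le_sum) auto

text \<open>As \<open>f\<close> is only real linear, each complex coefficient is split into real and
  imaginary part, and the bound \<open>K\<close> takes into account the images of both
  \<open>wedges ws\<close> and its multiple by i.\<close>

lemma bounded_linear_cl:
  fixes f :: "'e::euclidean_space cl \<Rightarrow> 'b::real_normed_vector"
  assumes "linear f"
  shows "bounded_linear f"
proof -
  define K where "K = (\<Sum>ws\<in>cl_index. norm (f (wedges ws)) + norm (f (\<i> *C wedges ws)))"
  have "norm (f x) \<le> norm x * K" for x
  proof -
    have "f x = (\<Sum>ws\<in>cl_index. f (coef ws x *C wedges ws))"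
      by (subst (1) cl_expansion) (simp add: linear_sum[OF assms])
    also have "norm \<dots> \<le> (\<Sum>ws\<in>cl_index. norm x * (norm (f (wedges ws)) + norm (f (\<i> *C wedges ws))))"
    proof (intro sum_norm_le)
      fix ws :: "'e list" assume ws: "ws \<in> cl_index"
      have "coef ws x *C wedges ws = Re (coef ws x) *\<^sub>R wedges ws + Im (coef ws x) *\<^sub>R (\<i> *C wedges ws)"
        by (auto intro!: cl_eqI simp: complex_eq_iff)
      then have "f (coef ws x *C wedges ws) = Re (coef ws x) *\<^sub>R f (wedges ws) + Im (coef ws x) *\<^sub>R f (\<i> *C wedges ws)"
        by (simp add: linear_add[OF assms] linear_scale[OF assms])
      also have "norm \<dots> \<le> \<bar>Re (coef ws x)\<bar> * norm (f (wedges ws)) + \<bar>Im (coef ws x)\<bar> * norm (f (\<i> *C wedges ws))"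
        by (rule norm_triangle_le) simp
      also have "\<dots> \<le> norm x * norm (f (wedges ws)) + norm x * norm (f (\<i> *C wedges ws))"
        using cmod_coef_le[OF ws, of x] abs_Re_le_cmod[of "coef ws x"] abs_Im_le_cmod[of "coef ws x"]
        by (intro add_mono mult_right_mono) auto
      finally show "norm (f (coef ws x *C wedges ws)) \<le> norm x * (norm (f (wedges ws)) + norm (f (\<i> *C wedges ws)))"
        by (simp add: algebra_simps)
    qed
    finally show ?thesis
      by (simp add: K_def sum_distrib_left)
  qed
  then show ?thesis
    using assms by (intro bounded_linear_intro[where K = K]) (auto simp: linear_add linear_scale)
qed

lemma norm_csc: "norm (a *C x) = cmod a * norm x"
  by (simp add: norm_cl_def coef_def norm_mult norm_divide sum_distrib_left)

lemma csc_scaleR_left: "(r *\<^sub>R a) *C x = r *\<^sub>R (a *C x)"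
  by (rule cl_eqI) (simp add: scaleR_conv_of_real[where 'a = complex])

lemma bounded_bilinear_csc: "bounded_bilinear (*C)"
  by (rule bounded_bilinear.intro)
    (auto simp: csc_add_left norm_csc csc_scaleR_left intro!: exI[of _ 1])

lemma bounded_bilinear_cl_mult: "bounded_bilinear ((*) :: 'e::euclidean_space cl \<Rightarrow> _)"
proof (rule bounded_bilinear.intro)
  define K where "K = (\<Sum>ws\<in>cl_index. \<Sum>vs\<in>cl_index. norm (wedges ws * wedges vs :: 'e cl))"
  have "norm (x * y) \<le> norm x * norm y * K" for x y :: "'e cl"
  proof -
    have "x * y = (\<Sum>ws\<in>cl_index. coef ws x *C wedges ws) * (\<Sum>vs\<in>cl_index. coef vs y *C wedges vs)"
      by (simp flip: cl_expansion)
    also have "\<dots> = (\<Sum>ws\<in>cl_index. \<Sum>vs\<in>cl_index. (coef ws x * coef vs y) *C (wedges ws * wedges vs))"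
      unfolding sum_product by (simp add: mult.commute)
    also have "norm \<dots> \<le> (\<Sum>ws\<in>cl_index. \<Sum>vs\<in>cl_index. norm x * norm y * norm (wedges ws * wedges vs :: 'e cl))"
      by (intro sum_norm_le) (auto simp: norm_csc norm_mult intro!: mult_right_mono mult_mono cmod_coef_le)
    finally show ?thesis
      by (simp add: K_def sum_distrib_left)
  qed
  then show "\<exists>K. \<forall>x y. norm (x * y :: 'e cl) \<le> norm x * norm y * K"
    by blast
qed (auto simp: algebra_simps)

lemma bounded_linear_frm: "bounded_linear (\<lambda>x. frm x ws)"
  by (intro bounded_linear_cl linearI) (simp_all add: complex_eq_iff)

lemma bounded_linear_tr: "bounded_linear tr"
  by (intro bounded_linear_cl linearI) simp_all

context
  fixes S :: "'a::euclidean_space set"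
  assumes S: "open S"
begin

lemmas smooth_on_csc = smooth_on_bilinear[OF S bounded_bilinear_csc]
lemmas smooth_on_cl_mult = smooth_on_bilinear[OF S bounded_bilinear_cl_mult]
lemmas smooth_on_tr = smooth_on_bounded_linear[OF S bounded_linear_tr]

lemma smooth_on_clv:
  fixes Y :: "'a \<Rightarrow> 'e::euclidean_space"
  assumes "smooth_on S Y"
  shows "smooth_on S (\<lambda>x. clv (Y x))"
proof (rule smooth_on_bounded_linear[OF S _ assms])
  show "bounded_linear (clv :: 'e \<Rightarrow> 'e cl)"
    by (rule linear_conv_bounded_linear[THEN iffD1, OF linear_clv])
qed

lemma smooth_on_clI:
  assumes "\<And>ws. smooth_on S (\<lambda>x. frm (\<Phi> x) ws)"
  shows "smooth_on S \<Phi>"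
proof (rule smooth_on_cong[OF S])
  show "smooth_on S (\<lambda>x. \<Sum>ws\<in>cl_index. ((1 / fact (length ws)) * frm (\<Phi> x) ws) *C wedges ws)"
    by (intro smooth_on_sum[OF S] smooth_on_csc smooth_on_const smooth_on_mult[OF S] assms)
  show "\<Phi> x = (\<Sum>ws\<in>cl_index. ((1 / fact (length ws)) * frm (\<Phi> x) ws) *C wedges ws)" for x
    using cl_expansion[of "\<Phi> x"] by (simp add: coef_def)
qed

end

section \<open>Smooth orthonormal frames\<close>

text \<open>Gram-Schmidt applied to the standard basis at all points simultaneously. Smoothness
  survives since only sums, products and the inverse square root of a positive function
  occur.\<close>

lemma ex_orthonormal_frame:
  fixes g :: "'e::euclidean_space metric"
  assumes V: "open V" and ip: "\<And>x. x \<in> V \<Longrightarrow> inner_prod (g x)"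
    and sm: "\<And>u v. smooth_on V (\<lambda>x. g x u v)"
  shows "\<exists>f :: 'e \<Rightarrow> 'e \<Rightarrow> 'e. (\<forall>b\<in>Basis. smooth_on V (f b)) \<and>
    (\<forall>x\<in>V. \<forall>b\<in>Basis. \<forall>c\<in>Basis. g x (f b x) (f c x) = (if b = c then 1 else 0))"
proof -
  have bl: "bilinear (g x)" and sym: "g x u v = g x v u" and pos: "u \<noteq> 0 \<Longrightarrow> 0 < g x u u"
    if "x \<in> V" for x u v
    using ip[OF that] by (auto simp: inner_prod_def)
  \<comment> \<open>The span condition is carried along because it ensures that the next vector is
    nonzero before it is normalized.\<close>
  have "\<exists>f. (\<forall>b\<in>B. smooth_on V (f b)) \<and> (\<forall>x\<in>V. \<forall>b\<in>B. f b x \<in> span B) \<and>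
    (\<forall>x\<in>V. \<forall>b\<in>B. \<forall>c\<in>B. g x (f b x) (f c x) = (if b = c then 1 else 0))" if "B \<subseteq> Basis" for B
    using finite_subset[OF that finite_Basis] that
  proof (induction B rule: finite_induct)
    case (insert b B)
    then have "\<exists>f. (\<forall>b\<in>B. smooth_on V (f b)) \<and> (\<forall>x\<in>V. \<forall>b\<in>B. f b x \<in> span B) \<and>
        (\<forall>x\<in>V. \<forall>b\<in>B. \<forall>c\<in>B. g x (f b x) (f c x) = (if b = c then 1 else 0))"
      by simp
    then obtain f where f: "\<And>b. b \<in> B \<Longrightarrow> smooth_on V (f b)"
      "\<And>b x. b \<in> B \<Longrightarrow> x \<in> V \<Longrightarrow> f b x \<in> span B"
      "\<And>b c x. b \<in> B \<Longrightarrow> c \<in> B \<Longrightarrow> x \<in> V \<Longrightarrow> g x (f b x) (f c x) = (if b = c then 1 else 0)"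
      by metis
    define w where "w = (\<lambda>x. b - (\<Sum>c\<in>B. g x b (f c x) *\<^sub>R f c x))"
    define e where "e = (\<lambda>x. inverse (sqrt (g x (w x) (w x))) *\<^sub>R w x)"
    have nz: "w x \<noteq> 0" if "x \<in> V" for x
    proof
      assume "w x = 0"
      then have "b = (\<Sum>c\<in>B. g x b (f c x) *\<^sub>R f c x)"
        by (simp add: w_def)
      also have "\<dots> \<in> span B"
        using f(2)[OF _ that] by (intro span_sum span_scale)
      also have "span B \<subseteq> span (Basis - {b})"
        using insert by (intro span_mono) auto
      finally show False
        using independent_Basis insert.prems by (auto simp: dependent_def)
    qed
    have smw: "smooth_on V w"
      unfolding w_def using f(1)
      by (intro smooth_on_diff[OF V] smooth_on_sum[OF V] smooth_on_scaleR[OF V]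
          smooth_on_bilinear_family[OF V bl sm] smooth_on_const)
    have sme: "smooth_on V e"
      unfolding e_def using pos[OF _ nz]
      by (intro smooth_on_scaleR[OF V] smooth_on_inverse[OF V] smooth_on_sqrt[OF V]
          smooth_on_bilinear_family[OF V bl sm] smw) (auto simp: less_le)
    have orth: "g x (w x) (f c x) = 0" if "x \<in> V" "c \<in> B" for x c
    proof -
      have "g x (w x) (f c x) = g x b (f c x) - (\<Sum>d\<in>B. g x b (f d x) * g x (f d x) (f c x))"
        using linear_sum[of "\<lambda>u. g x u (f c x)" "\<lambda>c. g x b (f c x) *\<^sub>R f c x" B] bl[OF that(1)]
        by (simp add: w_def bilinear_lsub bilinear_lmul) (simp add: bilinear_def)
      also have "(\<Sum>d\<in>B. g x b (f d x) * g x (f d x) (f c x)) = (\<Sum>d\<in>B. if d = c then g x b (f d x) else 0)"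
        using that by (intro sum.cong refl) (simp add: f(3))
      finally show ?thesis
        using insert.hyps that by simp
    qed
    have ee: "g x (e x) (e x) = 1" if "x \<in> V" for x
      using pos[OF that nz[OF that]] bl[OF that]
      by (simp add: e_def bilinear_lmul bilinear_rmul field_simps)
    have ec: "g x (e x) (f c x) = 0" if "x \<in> V" "c \<in> B" for x c
      using orth[OF that] bl[OF that(1)] by (simp add: e_def bilinear_lmul)
    have esp: "e x \<in> span (insert b B)" if "x \<in> V" for x
    proof -
      have "f c x \<in> span (insert b B)" if "c \<in> B" for c
        using f(2)[OF that \<open>x \<in> V\<close>] span_mono[of B "insert b B"] by auto
      moreover have "b \<in> span (insert b B)"
        by (simp add: span_base)
      ultimately show ?thesis
        unfolding e_def w_def by (intro span_scale span_diff span_sum)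
    qed
    show ?case
    proof (intro exI[of _ "f(b := e)"] conjI ballI)
      show "smooth_on V ((f(b := e)) c)" if "c \<in> insert b B" for c
        using that f(1) sme by auto
      show "(f(b := e)) c x \<in> span (insert b B)" if "x \<in> V" "c \<in> insert b B" for c x
        using that f(2)[of c x] esp[of x] span_mono[of B "insert b B"] by auto
      show "g x ((f(b := e)) c x) ((f(b := e)) d x) = (if c = d then 1 else 0)"
        if "x \<in> V" "c \<in> insert b B" "d \<in> insert b B" for c d x
        using that insert.hyps f(3)[of c d x] ee[of x] ec[of x c] ec[of x d] sym[of x "f c x" "e x"]
        by auto
    qed
  qed simp
  from this[OF subset_refl] show ?thesis
    by (elim exE conjE) (intro exI conjI)
qed

section \<open>Orthonormal bases and adapted frames\<close>

lemma orthonormal_independent: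
  assumes "bilinear G" "finite E" "\<And>u v. u \<in> E \<Longrightarrow> v \<in> E \<Longrightarrow> G u v = (if u = v then 1 else 0 :: real)"
  shows "independent E"
proof (rule independent_if_scalars_zero[OF assms(2)])
  fix f u assume z: "(\<Sum>w\<in>E. f w *\<^sub>R w) = 0" and u: "u \<in> E"
  have lin: "linear (\<lambda>w. G w u)"
    using assms(1) by (simp add: bilinear_def)
  have "0 = G (\<Sum>w\<in>E. f w *\<^sub>R w) u"
    using linear_0[OF lin] by (simp add: z)
  also have "\<dots> = (\<Sum>w\<in>E. if w = u then f w else 0)"
    using u by (simp add: linear_sum[OF lin] linear_scale[OF lin] assms(3)) (intro sum.cong, auto)
  finally show "f u = 0"
    using assms(2) u by simp
qed

lemma inner_prodD:
  assumes "inner_prod G"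
  shows "bilinear G" "G u v = G v u" "u \<noteq> 0 \<Longrightarrow> 0 < G u u"
  using assms by (auto simp: inner_prod_def)

text \<open>Take \<open>E\<close> of maximal cardinality among the orthonormal sets orthogonal to
  their image under \<open>j\<close>. If it were too small, there would be a unit vector
  \<open>u\<close> orthogonal to \<open>E\<close> and \<open>j\<close> E\<open>; then\<close>j
  u\<open>is orthogonal to\<close>u\<open>by skewness and to\<close>E\<open>because\<close>u\<open>is orthogonal to\<close>j
  \<open>E\<close>, so \<open>u\<close> could be added.\<close>

lemma ex_adapted_frame:
  fixes G :: "'e::euclidean_space \<Rightarrow> 'e \<Rightarrow> real"
  assumes ip: "inner_prod G" and lin: "linear j" and jj: "\<And>u. j (j u) = - u"
    and orth: "\<And>u v. G (j u) (j v) = G u v"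
  shows "\<exists>E. adapted_frame G j E"
proof -
  note bl = inner_prodD(1)[OF ip] and sym = inner_prodD(2)[OF ip] and pos = inner_prodD(3)[OF ip]
  have skew: "G (j u) v = - G u (j v)" for u v
    using orth[of "j u" v] bl by (simp add: jj bilinear_lneg)
  have skew0: "G u (j u) = 0" for u
    using skew[of u u] sym[of u "j u"] by simp
  have "inj j"
    using lin by (metis injI jj minus_equation_iff)
  define good where "good = (\<lambda>E. finite E \<and> (\<forall>u\<in>E. \<forall>v\<in>E. G u v = (if u = v then 1 else 0) \<and> G u (j v) = 0))"
  have on: "G u v = (if u = v then 1 else 0)" if "good E" "u \<in> E \<union> j ` E" "v \<in> E \<union> j ` E" for E u v
  proof -
    have 1: "G a b = (if a = b then 1 else 0)" "G a (j b) = 0" if "a \<in> E" "b \<in> E" for a b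
      using \<open>good E\<close> that by (auto simp: good_def)
    have 2: "a \<noteq> j b" "j b \<noteq> a" if "a \<in> E" "b \<in> E" for a b
      using 1[OF that] 1[OF that(1) that(1)] by auto
    have 3: "(j a = j b) = (a = b)" for a b
      using \<open>inj j\<close> by (auto dest: injD)
    have 4: "G (j a) b = 0" if "a \<in> E" "b \<in> E" for a b
      using 1(2)[OF that(2,1)] sym[of "j a" b] by simp
    from that(2,3) show ?thesis
      by (elim UnE imageE) (simp_all add: 1 2 3 4 orth)
  qed
  have card: "card (E \<union> j ` E) = 2 * card E" if "good E" for E
  proof -
    have "E \<inter> j ` E = {}"
      using that by (auto simp: good_def) (metis zero_neq_one)
    then show ?thesis
      using that \<open>inj j\<close> by (simp add: good_def card_Un_disjoint card_image inj_on_subset)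
  qed
  have le: "2 * card E \<le> DIM('e)" if "good E" for E
  proof -
    have "finite (E \<union> j ` E)"
      using that by (simp add: good_def)
    from orthonormal_independent[OF bl this on[OF that]] have "card (E \<union> j ` E) \<le> DIM('e)"
      using independent_bound by blast
    then show ?thesis
      by (simp add: card[OF that])
  qed
  have "good {}"
    by (simp add: good_def)
  moreover have "\<forall>F. good F \<longrightarrow> card F < Suc DIM('e)"
    using le by fastforce
  ultimately have "\<exists>E. good E \<and> (\<forall>F. good F \<longrightarrow> card F \<le> card E)"
    by (rule ex_has_greatest_nat)
  then obtain E where E: "good E" and max: "\<And>F. good F \<Longrightarrow> card F \<le> card E"
    by blast
  have "2 * card E = DIM('e)"
  proof (rule ccontr)
    let ?F = "E \<union> j ` E"
    assume "2 * card E \<noteq> DIM('e)"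
    then have "card ?F < DIM('e)"
      using le[OF E] card[OF E] by simp
    moreover have "dim (span ?F) \<le> card ?F"
      using E by (simp add: dim_le_card' good_def)
    ultimately have "span ?F \<noteq> UNIV"
      using dim_UNIV by (metis not_le)
    then obtain b where b: "b \<notin> span ?F"
      by blast
    define w where "w = b - (\<Sum>c\<in>?F. G b c *\<^sub>R c)"
    define u where "u = inverse (sqrt (G w w)) *\<^sub>R w"
    have "(\<Sum>c\<in>?F. G b c *\<^sub>R c) \<in> span ?F"
      by (intro span_sum span_scale span_base)
    then have "w \<noteq> 0"
      using b by (auto simp: w_def)
    then have uu: "G u u = 1"
      using pos[of w] bl by (simp add: u_def bilinear_lmul bilinear_rmul field_simps)
    have uc: "G u c = 0" if "c \<in> ?F" for c
    proof -
      have l: "linear (\<lambda>w. G w c)"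
        using bl by (simp add: bilinear_def)
      have "G w c = G b c - (\<Sum>d\<in>?F. G b d * G d c)"
        by (simp add: w_def linear_diff[OF l] linear_sum[OF l] linear_scale[OF l])
      also have "(\<Sum>d\<in>?F. G b d * G d c) = (\<Sum>d\<in>?F. if d = c then G b d else 0)"
        using that on[OF E] by (intro sum.cong refl) simp
      also have "\<dots> = G b c"
        using that E by (simp add: good_def)
      finally show ?thesis
        using bl by (simp add: u_def bilinear_lmul)
    qed
    have "u \<notin> E"
      using uc[of u] uu by auto
    moreover have "good (insert u E)"
    proof -
      have cu: "G c u = 0" if "c \<in> ?F" for c
        using uc[OF that] sym[of c u] by simp
      have cj: "G c (j u) = 0" if "c \<in> E" for c
        using skew[of c u] cu[of "j c"] that by simp
      have "G a b = (if a = b then 1 else 0)" "G a (j b) = 0" if "a \<in> E" "b \<in> E" for a b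
        using E that by (auto simp: good_def)
      then show ?thesis
        using E \<open>u \<notin> E\<close> uu uc cu cj skew0 unfolding good_def
        by (intro conjI ballI; (elim conjE insertE)?) (simp, (metis UnI1 UnI2 imageI)+)
    qed
    ultimately show False
      using max[of "insert u E"] E by (simp add: good_def)
  qed
  then have "adapted_frame G j E"
    using E on[OF E] card[OF E] by (auto simp: adapted_frame_def onb_def good_def)
  then show ?thesis ..
qed

section \<open>Transfer to the Clifford algebra of Euclidean space\<close>

text \<open>\<open>P\<close> stands for an isometry from Euclidean space onto the tangent space and
  \<open>Q\<close> for its inverse; forms on the two spaces then correspond by pullback.\<close>

definition toC :: "('e \<Rightarrow> 'e) \<Rightarrow> 'e::euclidean_space form \<Rightarrow> 'e cl" where
  "toC P \<phi> = Abs_cl (\<lambda>ws. \<phi> (map P ws))"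

definition fromC :: "('e \<Rightarrow> 'e) \<Rightarrow> 'e::euclidean_space cl \<Rightarrow> 'e form" where
  "fromC Q x = (\<lambda>ws. frm x (map Q ws))"

definition epsC :: "('e \<Rightarrow> 'e) \<Rightarrow> 'e::euclidean_space \<Rightarrow> 'e cl" where
  "epsC r v = (1/2) *C (clv v - \<i> *C clv (r v))"

definition epsC_bar :: "('e \<Rightarrow> 'e) \<Rightarrow> 'e::euclidean_space \<Rightarrow> 'e cl" where
  "epsC_bar r v = (1/2) *C (clv v + \<i> *C clv (r v))"

text \<open>The factor 1/2 makes up for summing over the whole basis: for an orthogonal complex
  structure \<open>r\<close> the vectors \<open>v\<close> and \<open>r v\<close> contribute equally,
  and an adapted frame lists only one of them.\<close>

definition LC :: "('e \<Rightarrow> 'e) \<Rightarrow> 'e::euclidean_space cl \<Rightarrow> 'e cl" where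
  "LC r x = - (1/2) *\<^sub>R (\<Sum>b\<in>Basis. epsC r b * x * epsC_bar r b)"

definition LC_bar :: "('e \<Rightarrow> 'e) \<Rightarrow> 'e::euclidean_space cl \<Rightarrow> 'e cl" where
  "LC_bar r x = - (1/2) *\<^sub>R (\<Sum>b\<in>Basis. epsC_bar r b * x * epsC r b)"

lemma linear_epsC: "linear r \<Longrightarrow> linear (epsC r)" "linear r \<Longrightarrow> linear (epsC_bar r)"
  by (auto simp: linear_iff epsC_def epsC_bar_def algebra_simps)

lemma epsC_r:
  assumes "\<And>v. r (r v) = - v"
  shows "epsC r (r v) = \<i> *C epsC r v" "epsC_bar r (r v) = (- \<i>) *C epsC_bar r v"
  by (simp_all add: epsC_def epsC_bar_def assms algebra_simps)

lemma bilinear_mult_linear: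
  fixes f h :: "'e::euclidean_space \<Rightarrow> 'e cl"
  assumes "linear f" "linear h"
  shows "bilinear (\<lambda>u v. f u * x * h v)"
  using assms by (auto simp: bilinear_def linear_iff algebra_simps)

locale orthonormal_iso =
  fixes G :: "'e::euclidean_space \<Rightarrow> 'e \<Rightarrow> real" and P Q :: "'e \<Rightarrow> 'e"
  assumes ip: "inner_prod G" and linP: "linear P" and linQ: "linear Q"
    and iso: "\<And>u v. G (P u) (P v) = u \<bullet> v" and PQ [simp]: "\<And>v. P (Q v) = v" and QP [simp]: "\<And>u. Q (P u) = u"
begin

lemma QQ: "Q u \<bullet> Q v = G u v"
  using iso[of "Q u" "Q v"] by simp

lemma linG: "linear (G v)" "linear (\<lambda>u. G u v)"
  using inner_prodD(1)[OF ip] by (simp_all add: bilinear_def)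

lemma alt_fromC [simp]: "alt_form (fromC Q x)"
  unfolding fromC_def by (rule alt_form_map[OF linQ]) simp

lemma frm_toC: "alt_form \<phi> \<Longrightarrow> frm (toC P \<phi>) ws = \<phi> (map P ws)"
  by (simp add: toC_def Abs_cl_inverse alt_form_map[OF linP])

lemma toC_fromC [simp]: "toC P (fromC Q x) = x"
  by (rule cl_eqI) (simp add: frm_toC, simp add: fromC_def o_def)

lemma fromC_toC: "alt_form \<phi> \<Longrightarrow> fromC Q (toC P \<phi>) = \<phi>"
  by (rule ext) (simp add: fromC_def frm_toC o_def)

lemma alt_form_cases: "alt_form \<phi> \<Longrightarrow> (\<And>x. \<phi> = fromC Q x \<Longrightarrow> thesis) \<Longrightarrow> thesis"
  using fromC_toC by metis

lemma fromC_inj [simp]: "fromC Q x = fromC Q y \<longleftrightarrow> x = y"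
  using toC_fromC by metis

lemma fromC_simps:
  "fromC Q (x + y) = fromC Q x + fromC Q y" "fromC Q (x - y) = fromC Q x - fromC Q y"
  "fromC Q (- x) = - fromC Q x" "fromC Q 0 = 0"
  "fromC Q (a *C x) = a \<odot> fromC Q x" "fromC Q 1 = unit_form"
  by (auto simp: fromC_def fun_eq_iff cscale_def unit_form_def frm_one)

lemma fromC_sum: "fromC Q (sum f A) = (\<Sum>a\<in>A. fromC Q (f a))"
  by (induction A rule: infinite_finite_induct) (simp_all add: fromC_simps)

lemma fromC_con: "fromC Q (con v x) = contract (P v) (fromC Q x)"
  by (rule ext) (simp add: fromC_def contract_def)

lemma fromC_wed: "fromC Q (wed v x) = wedge G (P v) (fromC Q x)"
proof
  show "fromC Q (wed v x) ws = wedge G (P v) (fromC Q x) ws" for ws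
  proof (induction ws arbitrary: x)
    case (Cons u ws)
    have "v \<bullet> Q u = G (P v) u"
      using QQ[of "P v" u] by simp
    moreover have "contract u (fromC Q x) = fromC Q (con (Q u) x)"
      by (simp add: fromC_con)
    ultimately show ?case
      using Cons[of "con (Q u) x"] by (simp add: wedge_Cons) (simp add: fromC_def)
  qed (simp add: fromC_def)
qed

lemma fromC_clv: "fromC Q (clv v) = vec_form G (P v)"
proof
  show "fromC Q (clv v) ws = vec_form G (P v) ws" for ws
    using QQ[of "P v"] by (auto simp: fromC_def frm_clv vec_form_def split: list.splits)
qed

lemma vec_form_eq: "vec_form G v = fromC Q (clv (Q v))"
  by (simp add: fromC_clv)

section \<open>Identification of the chosen fibre operations with those of the model\<close>

text \<open>Induction on the first factor strips off one vector at a time, and on a vector the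
  product is prescribed.\<close>

lemma clifford_product_eqI:
  assumes "clifford_product G m"
  shows "m (fromC Q x) (fromC Q y) = fromC Q (x * y)"
proof -
  have m_add: "m (\<phi> + \<psi>) \<theta> = m \<phi> \<theta> + m \<psi> \<theta>" and assoc: "m (m \<phi> \<psi>) \<theta> = m \<phi> (m \<psi> \<theta>)"
    and m_csc: "m (a \<odot> \<phi>) \<psi> = a \<odot> m \<phi> \<psi>" and m_one: "m unit_form \<phi> = \<phi>"
    and vec: "m (vec_form G v) \<phi> = wedge G v \<phi> - contract v \<phi>"
    if "alt_form \<phi>" "alt_form \<psi>" "alt_form \<theta>" for \<phi> \<psi> \<theta> a v
    using assms that by (simp_all only: clifford_product_def)
  have alt: "alt_form (vec_form G v)" for v
    by (rule alt_form_vec_form[OF linG(1)])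
  have 1: "fromC Q (clv v * z) = m (vec_form G (P v)) (fromC Q z)" for v z
    unfolding clv_mult fromC_simps fromC_con fromC_wed
    by (rule vec[OF alt_fromC alt_fromC alt_fromC, symmetric])
  show ?thesis
  proof (induction x rule: cl_induct)
    case (clv v x)
    then show ?case
      by (simp only: mult.assoc clv 1 assoc[OF alt alt_fromC alt_fromC])
  next
    case (add x y)
    then show ?case
      by (simp only: fromC_simps distrib_right add m_add[OF alt_fromC alt_fromC alt_fromC])
  next
    case (csc a x)
    then show ?case
      by (simp only: fromC_simps csc_mult_left csc m_csc[OF alt_fromC alt_fromC alt_fromC])
  next
    case one
    show ?case
      by (simp only: fromC_simps mult_1_left m_one[OF alt_fromC alt_fromC alt_fromC])
  qed
qed

text \<open>Existence, which the choice behind \<open>cmul\<close> relies on: the product of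
  \<open>cl\<close> is carried over to the forms on the tangent space.\<close>

lemma clifford_product_transfer: "clifford_product G (\<lambda>\<phi> \<psi>. fromC Q (toC P \<phi> * toC P \<psi>))"
  unfolding clifford_product_def
proof (intro conjI allI impI)
  show "fromC Q (toC P (vec_form G v) * toC P \<phi>) = wedge G v \<phi> - contract v \<phi>" if "alt_form \<phi>" for v \<phi>
    using that by (auto elim!: alt_form_cases simp: vec_form_eq clv_mult fromC_simps fromC_con fromC_wed)
qed (auto elim!: alt_form_cases simp: fromC_simps[symmetric] algebra_simps)

lemma clifford_product_cmul: "clifford_product G (cmul G)"
  unfolding cmul_def using clifford_product_transfer by (rule someI[of "clifford_product G"])

lemma cmul_fromC: "cmul G (fromC Q x) (fromC Q y) = fromC Q (x * y)"
  by (rule clifford_product_eqI[OF clifford_product_cmul])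

text \<open>Existence comes from transporting \<open>tr\<close>, uniqueness from the induction on
  products of vectors. Words of length 0 and 1 supply the values on the unit and on vectors.\<close>

lemma transposition_fromC: "transposition G (fromC Q x) = fromC Q (tr x)"
proof -
  have word: "clifford_word G vs = fromC Q (foldr (\<lambda>v x. clv (Q v) * x) vs 1)" for vs
    by (induction vs) (simp_all add: clifford_word_def fromC_simps vec_form_eq cmul_fromC)
  have rw: "tr (foldr (\<lambda>v x. clv (Q v) * x) vs 1) = foldr (\<lambda>v x. clv (Q v) * x) (rev vs) 1" for vs
  proof (induction vs)
    case (Cons v vs)
    have "foldr (\<lambda>v x. clv (Q v) * x) vs y = foldr (\<lambda>v x. clv (Q v) * x) vs 1 * y" for vs y
      by (induction vs) (simp_all add: mult.assoc)
    from this[of "rev vs" "clv (Q v)"] show ?case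
      by (simp add: tr_mult Cons)
  qed simp
  have "is_transpose G (\<lambda>\<phi>. fromC Q (tr (toC P \<phi>)))"
    unfolding is_transpose_def form_linear_def
    by (auto elim!: alt_form_cases simp: cmul_fromC tr_mult word rw)
      (auto simp: fromC_simps[symmetric])
  then have tp: "is_transpose G (transposition G)"
    unfolding transposition_def by (rule someI[of "is_transpose G"])
  have 1: "transposition G unit_form = unit_form"
    using tp by (auto simp: is_transpose_def clifford_word_def dest: spec[of _ "[]"])
  have v: "transposition G (vec_form G v) = vec_form G v" for v
  proof -
    have "clifford_word G [v] = vec_form G v"
      by (simp add: word vec_form_eq)
    then show ?thesis
      using tp unfolding is_transpose_def by (metis rev_singleton_conv)
  qed
  show ?thesis
  proof (induction x rule: cl_induct)
    case (clv v x)
    have "transposition G (cmul G (fromC Q (clv v)) (fromC Q x)) =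
        cmul G (transposition G (fromC Q x)) (transposition G (fromC Q (clv v)))"
      using tp unfolding is_transpose_def by simp
    then show ?case
      by (simp only: clv fromC_clv v) (simp add: fromC_clv[symmetric] cmul_fromC tr_mult)
  next
    case (add x y)
    then show ?case
      using tp alt_fromC unfolding is_transpose_def form_linear_def fromC_simps tr_simps by metis
  next
    case (csc a x)
    then show ?case
      using tp alt_fromC unfolding is_transpose_def form_linear_def fromC_simps tr_simps by metis
  qed (simp add: 1 fromC_simps)
qed

text \<open>Both sides are the trace of \<open>F\<close> with respect to \<open>G\<close>. After
  expanding each \<open>P b\<close> in \<open>E\<close>, Parseval's identity collapses the products
  of coefficients of \<open>v\<close> and \<open>w\<close>, summed over \<open>b\<close>, to
  \<open>G v w\<close>.\<close>

lemma onb_sum: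
  assumes E: "onb G E" and F: "bilinear F"
  shows "(\<Sum>v\<in>E. F v v) = (\<Sum>b\<in>Basis. F (P b) (P b))"
proof -
  have fE: "finite E" and on: "\<And>u v. u \<in> E \<Longrightarrow> v \<in> E \<Longrightarrow> G u v = (if u = v then 1 else 0)"
    using E by (auto simp: onb_def)
  have "(\<Sum>b\<in>Basis. F (P b) (P b)) =
      (\<Sum>b\<in>Basis. F (\<Sum>v\<in>E. G (P b) v *\<^sub>R v) (\<Sum>w\<in>E. G (P b) w *\<^sub>R w))"
    by (simp flip: onb_expansion[OF ip E])
  also have "\<dots> = (\<Sum>b\<in>Basis. \<Sum>v\<in>E. \<Sum>w\<in>E. (G (P b) v * G (P b) w) *\<^sub>R F v w)"
    unfolding bilinear_sum[OF F] sum.cartesian_product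
    by (intro sum.cong refl) (auto simp: bilinear_lmul[OF F] bilinear_rmul[OF F])
  also have "\<dots> = (\<Sum>v\<in>E. \<Sum>b\<in>Basis. \<Sum>w\<in>E. (G (P b) v * G (P b) w) *\<^sub>R F v w)"
    by (rule sum.swap)
  also have "\<dots> = (\<Sum>v\<in>E. \<Sum>w\<in>E. (\<Sum>b\<in>Basis. G (P b) v * G (P b) w) *\<^sub>R F v w)"
    unfolding scaleR_sum_left by (rule sum.cong[OF refl], rule sum.swap)
  also have "\<dots> = (\<Sum>v\<in>E. \<Sum>w\<in>E. if v = w then F v w else 0)"
  proof (intro sum.cong refl)
    fix v w assume vw: "v \<in> E" "w \<in> E"
    have "G (P b) u = Q u \<bullet> b" for b u
      by (metis QQ QP inner_prodD(2)[OF ip])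
    then have "(\<Sum>b\<in>Basis. G (P b) v * G (P b) w) = Q v \<bullet> Q w"
      unfolding euclidean_inner[of "Q v" "Q w"] by (simp only:)
    then show "(\<Sum>b\<in>Basis. G (P b) v * G (P b) w) *\<^sub>R F v w = (if v = w then F v w else 0)"
      using on[OF vw] by (simp add: QQ)
  qed
  finally show ?thesis
    using fE by simp
qed

lemma ex_onb: "onb G (P ` Basis)"
proof -
  have "inj P"
    using QP by (metis injI)
  then show ?thesis
    by (auto simp: onb_def iso inner_Basis card_image inj_on_subset dest: injD)
qed

context
  fixes j :: "'e \<Rightarrow> 'e"
    and r :: "'e \<Rightarrow> 'e"
  assumes r_eq: "\<And>v. r v = Q (j (P v))" and linj: "linear j" and jj: "\<And>u. j (j u) = - u" and orth: "\<And>u v. G (j u) (j v) = G u v"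
begin

lemma lin_r: "linear r"
  using linear_compose[OF linear_compose[OF linP linj] linQ] by (simp add: o_def r_eq[abs_def])

lemma lin_nr: "linear (\<lambda>v. - r v)"
  using linear_compose_neg[OF lin_r] .

lemma r_orth: "r u \<bullet> r v = u \<bullet> v"
  by (simp add: r_eq QQ orth iso)

lemma r_r: "r (r v) = - v"
  by (simp add: r_eq jj linear_neg[OF linQ])

lemma pull_inverse: "pull (\<lambda>v. - r v) (pull r x) = x" "pull r (pull (\<lambda>v. - r v) x) = x"
  by (auto intro!: cl_eqI simp: frm_pull[OF lin_r] frm_pull[OF lin_nr] o_def r_r linear_neg[OF lin_r])

lemma pull_nr_mult: "pull (\<lambda>v. - r v) (x * y) = pull (\<lambda>v. - r v) x * pull (\<lambda>v. - r v) y"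
  by (rule pull_mult[OF lin_nr]) (simp add: r_orth)

lemma pull_nr_clv: "pull (\<lambda>v. - r v) (clv v) = clv (r v)"
  using pull_clv[OF lin_nr, of "r v"] by (simp add: r_orth r_r)

text \<open>The minus sign is an inversion: since \<open>r\<close> squares to -1, its inverse is
  \<open>-r\<close>, and pullback along the inverse maps \<open>clv v\<close> to
  \<open>clv (r v)\<close>.\<close>

lemma J_alg_fromC: "J_alg G j (fromC Q x) = fromC Q (pull (\<lambda>v. - r v) x)"
proof -
  have "automorphism_extension G j (\<lambda>\<phi>. fromC Q (pull (\<lambda>v. - r v) (toC P \<phi>)))"
    unfolding automorphism_extension_def
  proof (intro conjI allI impI)
    show "form_linear (\<lambda>\<phi>. fromC Q (pull (\<lambda>v. - r v) (toC P \<phi>)))"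
      unfolding form_linear_def
      by (auto elim!: alt_form_cases) (auto simp: fromC_simps[symmetric] pull_simps[OF lin_nr])
    show "bij_betw (\<lambda>\<phi>. fromC Q (pull (\<lambda>v. - r v) (toC P \<phi>))) (Collect alt_form) (Collect alt_form)"
      by (rule bij_betw_byWitness[where f' = "\<lambda>\<phi>. fromC Q (pull r (toC P \<phi>))"])
        (auto elim!: alt_form_cases simp: pull_inverse)
    show "fromC Q (pull (\<lambda>v. - r v) (toC P unit_form)) = unit_form"
      by (simp add: fromC_simps(6)[symmetric] pull_simps[OF lin_nr])
    show "fromC Q (pull (\<lambda>v. - r v) (toC P (cmul G \<phi> \<psi>))) =
        cmul G (fromC Q (pull (\<lambda>v. - r v) (toC P \<phi>))) (fromC Q (pull (\<lambda>v. - r v) (toC P \<psi>)))"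
      if "alt_form \<phi>" "alt_form \<psi>" for \<phi> \<psi>
      using that by (auto elim!: alt_form_cases simp: cmul_fromC pull_nr_mult)
    show "fromC Q (pull (\<lambda>v. - r v) (toC P (vec_form G v))) = vec_form G (j v)" for v
      by (simp add: vec_form_eq pull_nr_clv) (simp add: r_eq)
  qed
  then have *: "automorphism_extension G j (J_alg G j)"
    unfolding J_alg_def by (rule someI[of "automorphism_extension G j"])
  show ?thesis
  proof (induction x rule: cl_induct)
    case (clv v x)
    have "J_alg G j (cmul G (fromC Q (clv v)) (fromC Q x)) =
        cmul G (J_alg G j (fromC Q (clv v))) (J_alg G j (fromC Q x))"
      using * unfolding automorphism_extension_def by simp
    also have "J_alg G j (fromC Q (clv v)) = fromC Q (clv (r v))"
      using * unfolding automorphism_extension_def by (simp add: fromC_clv r_eq)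
    finally show ?case
      by (simp add: clv cmul_fromC pull_nr_mult pull_nr_clv)
  next
    case (add x y)
    then show ?case
      using * alt_fromC unfolding automorphism_extension_def form_linear_def fromC_simps pull_simps[OF lin_nr]
      by metis
  next
    case (csc a x)
    then show ?case
      using * alt_fromC unfolding automorphism_extension_def form_linear_def fromC_simps pull_simps[OF lin_nr]
      by metis
  next
    case one
    show ?case
      using * unfolding automorphism_extension_def fromC_simps pull_simps[OF lin_nr] by blast
  qed
qed

lemma J_alg_inv_fromC: "J_alg_inv G j (fromC Q x) = fromC Q (pull r x)"
proof -
  have "inj_on (J_alg G j) (Collect alt_form)"
  proof (rule inj_onI)
    fix \<phi> \<psi> assume "\<phi> \<in> Collect alt_form" "\<psi> \<in> Collect alt_form" "J_alg G j \<phi> = J_alg G j \<psi>"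
    then show "\<phi> = \<psi>"
      by (auto elim!: alt_form_cases simp: J_alg_fromC) (metis pull_inverse(2))
  qed
  moreover have "fromC Q x = J_alg G j (fromC Q (pull r x))"
    by (simp add: J_alg_fromC pull_inverse)
  ultimately show ?thesis
    unfolding J_alg_inv_def by (simp add: inv_into_f_f)
qed

lemma eps_eq: "eps G j v = fromC Q (epsC r (Q v))" "eps_bar G j v = fromC Q (epsC_bar r (Q v))"
  by (simp_all only: eps_def eps_bar_def epsC_def epsC_bar_def fromC_simps vec_form_eq r_eq PQ)

text \<open>The frame and its image under \<open>j\<close> form an orthonormal basis, over which
  \<open>onb_sum\<close> evaluates the full sum, and the invariance of \<open>F\<close> makes both
  halves equal.\<close>

lemma adapted_frame_sum:
  fixes F :: "'e \<Rightarrow> 'e \<Rightarrow> 'b::real_vector"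
  assumes "bilinear F" and F: "\<And>v. F (r v) (r v) = F v v" and E: "adapted_frame G j E"
  shows "(\<Sum>e\<in>E. F (Q e) (Q e)) = (1/2) *\<^sub>R (\<Sum>b\<in>Basis. F b b)"
proof -
  have onb: "onb G (E \<union> j ` E)" and c: "2 * card E = DIM('e)"
    using E by (auto simp: adapted_frame_def)
  have fE: "finite E" and cE: "card (E \<union> j ` E) = 2 * card E"
    using onb c by (auto simp: onb_def)
  have "inj j"
    by (metis injI jj minus_equation_iff)
  then have "card (j ` E) = card E"
    by (simp add: card_image inj_on_subset)
  then have "card (E \<inter> j ` E) = 0"
    using card_Un_Int[of E "j ` E"] fE cE by simp
  then have dis: "E \<inter> j ` E = {}"
    using fE by simp
  have "bilinear (\<lambda>u v. F (Q u) (Q v))"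
    using assms(1) linQ unfolding bilinear_def
    by (auto intro!: linear_compose[unfolded o_def, of Q])
  from onb_sum[OF onb this] have "(\<Sum>b\<in>Basis. F b b) = (\<Sum>v\<in>E \<union> j ` E. F (Q v) (Q v))"
    by simp
  also have "\<dots> = (\<Sum>v\<in>E. F (Q v) (Q v)) + (\<Sum>v\<in>E. F (Q (j v)) (Q (j v)))"
    using dis fE \<open>inj j\<close> by (simp add: sum.union_disjoint sum.reindex inj_on_subset)
  also have "(\<Sum>v\<in>E. F (Q (j v)) (Q (j v))) = (\<Sum>v\<in>E. F (Q v) (Q v))"
    using F[of "Q _"] by (simp add: r_eq)
  finally show ?thesis
    by (simp add: scaleR_2[symmetric])
qed

text \<open>Under \<open>r\<close> the factor \<open>epsC\<close> acquires i and
  \<open>epsC_bar\<close> acquires -i, so their product is invariant and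
  \<open>adapted_frame_sum\<close> applies. The result no longer mentions the frame picked by the
  choice operator.\<close>

lemma L_fibre_fromC: "L_fibre G j (fromC Q x) = fromC Q (LC r x)"
  and L_bar_fibre_fromC: "L_bar_fibre G j (fromC Q x) = fromC Q (LC_bar r x)"
proof -
  let ?E = "SOME E. adapted_frame G j E"
  have E: "adapted_frame G j ?E"
    using someI_ex[OF ex_adapted_frame[OF ip linj jj orth]] .
  have "(\<Sum>e\<in>?E. epsC r (Q e) * x * epsC_bar r (Q e)) =
      (1/2) *\<^sub>R (\<Sum>b\<in>Basis. epsC r b * x * epsC_bar r b)"
    by (rule adapted_frame_sum[OF bilinear_mult_linear[OF linear_epsC[OF lin_r]] _ E]) (simp add: epsC_r[of r, OF r_r])
  then show "L_fibre G j (fromC Q x) = fromC Q (LC r x)"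
    by (simp only: L_fibre_def eps_eq cmul_fromC LC_def fromC_simps(3)[symmetric] fromC_sum[symmetric]) simp
  have "(\<Sum>e\<in>?E. epsC_bar r (Q e) * x * epsC r (Q e)) =
      (1/2) *\<^sub>R (\<Sum>b\<in>Basis. epsC_bar r b * x * epsC r b)"
    by (rule adapted_frame_sum[OF bilinear_mult_linear[OF linear_epsC(2,1)[OF lin_r]] _ E]) (simp add: epsC_r[of r, OF r_r])
  then show "L_bar_fibre G j (fromC Q x) = fromC Q (LC_bar r x)"
    by (simp only: L_bar_fibre_def eps_eq cmul_fromC LC_bar_def fromC_simps(3)[symmetric] fromC_sum[symmetric]) simp
qed

end

end

section \<open>The Levi-Civita connection in an orthonormal frame\<close>

lemma linear_pd_family:
  fixes h :: "'a::euclidean_space \<Rightarrow> 'e::euclidean_space \<Rightarrow> 'b::real_normed_vector"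
  assumes S: "open S" "x \<in> S" and lin: "\<And>y. y \<in> S \<Longrightarrow> linear (h y)"
    and sm: "\<And>v. smooth_on S (\<lambda>y. h y v)"
  shows "linear (\<lambda>v. pd (\<lambda>y. h y v) x u)"
proof (rule linearI)
  note d = smooth_on_differentiable[OF sm S(2)]
  show "pd (\<lambda>y. h y (a + b)) x u = pd (\<lambda>y. h y a) x u + pd (\<lambda>y. h y b) x u" for a b
    by (subst pd_add[OF d d, symmetric], rule pd_cong[OF S linear_add[OF lin]]) (auto intro: d differentiable_add)
  show "pd (\<lambda>y. h y (r *\<^sub>R a)) x u = r *\<^sub>R pd (\<lambda>y. h y a) x u" for a r
    by (subst pd_bounded_linear[OF bounded_linear_scaleR_right d, symmetric], rule pd_cong[OF S linear_scale[OF lin]])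
      (auto intro: d differentiable_bounded_linear[OF bounded_linear_scaleR_right])
qed

text \<open>The Leibniz rule for a field of linear maps applied to a field of vectors; componentwise
  it is the ordinary product rule.\<close>

lemma pd_linear_family:
  fixes h :: "'a::euclidean_space \<Rightarrow> 'e::euclidean_space \<Rightarrow> 'b::real_normed_vector"
  assumes S: "open S" "x \<in> S" and lin: "\<And>y. y \<in> S \<Longrightarrow> linear (h y)"
    and sm: "\<And>v. smooth_on S (\<lambda>y. h y v)" and Y: "smooth_on S Y"
  shows "pd (\<lambda>y. h y (Y y)) x u = pd (\<lambda>y. h y (Y x)) x u + h x (pd Y x u)"
proof -
  have rep: "h y v = (\<Sum>b\<in>Basis. (v \<bullet> b) *\<^sub>R h y b)" if "y \<in> S" for y v
    by (rule sum_basis_linear[OF lin[OF that], symmetric])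
  note d = smooth_on_differentiable[OF _ S(2)]
  have gen: "pd (\<lambda>y. h y (Z y)) x u =
      (\<Sum>b\<in>Basis. (Z x \<bullet> b) *\<^sub>R pd (\<lambda>y. h y b) x u + (pd Z x u \<bullet> b) *\<^sub>R h x b)"
    if Z: "smooth_on S Z" for Z
  proof -
    have sb: "smooth_on S (\<lambda>y. (Z y \<bullet> b) *\<^sub>R h y b)" for b
      by (intro smooth_on_scaleR smooth_on_inner_left S sm Z)
    have "pd (\<lambda>y. h y (Z y)) x u = pd (\<lambda>y. \<Sum>b\<in>Basis. (Z y \<bullet> b) *\<^sub>R h y b) x u"
      by (rule pd_cong[OF S rep d[OF smooth_on_sum[OF S(1) sb]]])
    also have "\<dots> = (\<Sum>b\<in>Basis. pd (\<lambda>y. (Z y \<bullet> b) *\<^sub>R h y b) x u)"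
      by (rule pd_sum[OF d[OF sb]])
    also have "\<dots> = (\<Sum>b\<in>Basis. (Z x \<bullet> b) *\<^sub>R pd (\<lambda>y. h y b) x u + (pd Z x u \<bullet> b) *\<^sub>R h x b)"
      by (intro sum.cong refl)
        (simp add: pd_bilinear[OF bounded_bilinear_scaleR d[OF smooth_on_inner_left[OF S(1) Z]] d[OF sm]]
          pd_bounded_linear[OF bounded_linear_inner_left d[OF Z]])
    finally show ?thesis .
  qed
  have "pd (\<lambda>y. h y (Y x)) x u = (\<Sum>b\<in>Basis. (Y x \<bullet> b) *\<^sub>R pd (\<lambda>y. h y b) x u)"
    using gen[of "\<lambda>_. Y x"] by simp
  then show ?thesis
    using gen[OF Y] rep[OF S(2), of "pd Y x u"] by (simp add: sum.distrib)
qed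

lemma pd_bilinear_family:
  fixes h :: "'a::euclidean_space \<Rightarrow> 'a \<Rightarrow> 'a \<Rightarrow> 'b::real_normed_vector"
  assumes S: "open S" "x \<in> S" and bil: "\<And>y. y \<in> S \<Longrightarrow> bilinear (h y)"
    and sm: "\<And>v w. smooth_on S (\<lambda>y. h y v w)" and Y: "smooth_on S Y" and Z: "smooth_on S Z"
  shows "pd (\<lambda>y. h y (Y y) (Z y)) x u =
    pd (\<lambda>y. h y (Y x) (Z x)) x u + h x (pd Y x u) (Z x) + h x (Y x) (pd Z x u)"
proof -
  have "pd (\<lambda>y. h y (Y y) (Z y)) x u = pd (\<lambda>y. h y (Y y) (Z x)) x u + h x (Y x) (pd Z x u)"
  proof (rule pd_linear_family[OF S _ _ Z])
    show "linear (h y (Y y))" if "y \<in> S" for y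
      using bil[OF that] by (simp add: bilinear_def)
    show "smooth_on S (\<lambda>y. h y (Y y) v)" for v
      by (rule smooth_on_bilinear_family[OF S(1) bil sm Y smooth_on_const])
  qed
  also have "pd (\<lambda>y. h y (Y y) (Z x)) x u = pd (\<lambda>y. h y (Y x) (Z x)) x u + h x (pd Y x u) (Z x)"
  proof (rule pd_linear_family[OF S _ _ Y])
    show "linear (\<lambda>v. h y v (Z x))" if "y \<in> S" for y
      using bil[OF that] by (simp add: bilinear_def)
  qed (rule sm)
  finally show ?thesis .
qed

lemma inner_prod_eqI:
  assumes "inner_prod G" "\<And>w. G u w = G v w"
  shows "u = v"
proof -
  have "G (u - v) (u - v) = 0"
    using assms(2) inner_prodD(1)[OF assms(1)] by (simp add: bilinear_lsub)
  then show ?thesis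
    using inner_prodD(3)[OF assms(1), of "u - v"] by auto
qed

text \<open>The lift of a skew endomorphism from \<open>so(n)\<close> to the Clifford algebra.\<close>

definition spn :: "('e \<Rightarrow> 'e) \<Rightarrow> 'e::euclidean_space cl" where
  "spn z = (1/4) *\<^sub>R (\<Sum>b\<in>Basis. clv b * clv (z b))"

definition comm :: "'a::ring \<Rightarrow> 'a \<Rightarrow> 'a" where
  "comm x y = x * y - y * x"

lemma comm_simps:
  "comm x (y + z) = comm x y + comm x z" "comm (x + y) z = comm x z + comm y z"
  "comm x (y - z) = comm x y - comm x z"
  by (simp_all add: comm_def algebra_simps)

lemma comm_cl_simps:
  "comm x (a *C y) = a *C comm x (y :: 'e::euclidean_space cl)" "comm (a *C x) y = a *C comm x y"
  "comm x (s *\<^sub>R y) = s *\<^sub>R comm x y" "comm (s *\<^sub>R x) y = s *\<^sub>R comm x y"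
  "comm x 1 = 0" "comm x 0 = 0"
  by (simp_all add: comm_def scaleR_right_diff_distrib)

lemma comm_mult: "comm x (y * z) = comm x y * z + y * comm x z"
  by (simp add: comm_def algebra_simps)

lemma comm_sum_left: "comm (sum f A) y = (\<Sum>i\<in>A. comm (f i) y)"
  by (simp add: comm_def sum_distrib_left sum_distrib_right sum_subtractf)

text \<open>By the Clifford relation, moving \<open>clv w\<close> past
  \<open>clv b * clv (z b)\<close> leaves 2<zw, b> b + 2<w, b> zb. Each of the two terms sums to 2
  zw over the basis, which accounts for the 1/4 in \<open>spn\<close>.\<close>

lemma comm_spn:
  assumes "linear z" and skew: "\<And>u v. z u \<bullet> v = - (u \<bullet> z v)"
  shows "comm (spn z) (clv w) = clv (z w)"
proof -
  have c: "clv a * clv b = - (clv b * clv a) - (2 * (a \<bullet> b)) *\<^sub>R 1" for a b :: 'a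
    using clv_clv[of a b] by (metis add_diff_cancel_right' minus_diff_commute)
  have "comm (clv b * clv (z b)) (clv w) = (2 * (z w \<bullet> b)) *\<^sub>R clv b + (2 * (w \<bullet> b)) *\<^sub>R clv (z b)" for b
  proof -
    have "clv b * clv (z b) * clv w = clv b * (clv (z b) * clv w)"
      by (simp add: mult.assoc)
    also have "\<dots> = - (clv b * clv w * clv (z b)) - (2 * (z b \<bullet> w)) *\<^sub>R clv b"
      by (subst c[of "z b" w]) (simp add: right_diff_distrib mult.assoc)
    also have "clv b * clv w = - (clv w * clv b) - (2 * (b \<bullet> w)) *\<^sub>R 1"
      by (rule c)
    finally show ?thesis
      using skew[of b w] by (simp add: comm_def algebra_simps inner_commute)
  qed
  then have "comm (spn z) (clv w) = (1/4) *\<^sub>R (\<Sum>b\<in>Basis. (2 * (z w \<bullet> b)) *\<^sub>R clv b + (2 * (w \<bullet> b)) *\<^sub>R clv (z b))"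
    by (simp add: spn_def comm_cl_simps(4) comm_sum_left)
  also have "\<dots> = (1/2) *\<^sub>R ((\<Sum>b\<in>Basis. (z w \<bullet> b) *\<^sub>R clv b) + (\<Sum>b\<in>Basis. (w \<bullet> b) *\<^sub>R clv (z b)))"
    by (simp add: sum.distrib scaleR_sum_right scaleR_add_right)
  also have "\<dots> = (1/2) *\<^sub>R (clv (z w) + clv (z w))"
    by (simp only: sum_basis_linear[OF linear_clv] sum_basis_linear[OF linear_compose[OF assms(1) linear_clv, unfolded o_def]])
  finally show ?thesis
    by (simp add: scaleR_2[symmetric])
qed

text \<open>Formulated at one point and in one direction without naming a connection, so that it
  covers \<open>der\<close>, the connection chosen in \<open>nabla\<close> and the conjugate of the
  connection by J.\<close>

definition cl_derivation ::
  "'e::euclidean_space set \<Rightarrow> 'e \<Rightarrow> 'e \<Rightarrow> (('e \<Rightarrow> 'e cl) \<Rightarrow> 'e cl) \<Rightarrow> bool" where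
  "cl_derivation V x u E \<longleftrightarrow>
     (\<forall>\<Phi> \<Psi>. smooth_on V \<Phi> \<longrightarrow> smooth_on V \<Psi> \<longrightarrow> E (\<lambda>y. \<Phi> y + \<Psi> y) = E \<Phi> + E \<Psi>) \<and>
     (\<forall>\<Phi> \<Psi>. smooth_on V \<Phi> \<longrightarrow> smooth_on V \<Psi> \<longrightarrow> E (\<lambda>y. \<Phi> y * \<Psi> y) = E \<Phi> * \<Psi> x + \<Phi> x * E \<Psi>) \<and>
     (\<forall>f \<Phi>. smooth_on V f \<longrightarrow> smooth_on V \<Phi> \<longrightarrow> E (\<lambda>y. f y *C \<Phi> y) = pd f x u *C \<Phi> x + f x *C E \<Phi>)"

text \<open>Agreement on constant vectors spreads to constant Clifford elements by the product rule,
  and then to all smooth fields, which are combinations of constant monomials with smooth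
  coefficients.\<close>

lemma cl_derivation_eqI:
  fixes V :: "'e::euclidean_space set"
  assumes V: "open V" "x \<in> V" and E: "cl_derivation V x u E" and E': "cl_derivation V x u E'"
    and eq: "\<And>w. E (\<lambda>y. clv w) = E' (\<lambda>y. clv w)" and \<Phi>: "smooth_on V \<Phi>"
  shows "E \<Phi> = E' \<Phi>"
proof -
  have E_add: "D (\<lambda>y. \<Phi> y + \<Psi> y) = D \<Phi> + D \<Psi>" and E_mult: "D (\<lambda>y. \<Phi> y * \<Psi> y) = D \<Phi> * \<Psi> x + \<Phi> x * D \<Psi>"
    and E_csc: "D (\<lambda>y. f y *C \<Phi> y) = pd f x u *C \<Phi> x + f x *C D \<Phi>"
    if "D \<in> {E, E'}" "smooth_on V f" "smooth_on V \<Phi>" "smooth_on V \<Psi>" for f D and \<Phi> \<Psi> :: "'e \<Rightarrow> 'e cl"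
    using that E E' by (auto simp: cl_derivation_def)
  have E_zero: "D (\<lambda>y. 0) = 0" and E_one: "D (\<lambda>y. 1) = 0" if "D \<in> {E, E'}" for D
    using E_add[OF that, of undefined "\<lambda>y. 0" "\<lambda>y. 0"] E_add[OF that, of "\<lambda>y. 0" "\<lambda>y. 0" "\<lambda>y. 0"]
      E_mult[OF that, of "\<lambda>y. 0" "\<lambda>y. 1" "\<lambda>y. 1"] by simp_all
  have const: "E (\<lambda>y. c) = E' (\<lambda>y. c)" for c
  proof (induction c rule: cl_induct)
    case (add a b)
    then show ?case
      using E_add[of E "\<lambda>y. 0" "\<lambda>y. a" "\<lambda>y. b"] E_add[of E' "\<lambda>y. 0" "\<lambda>y. a" "\<lambda>y. b"] by simp
  next
    case (csc s a)
    then show ?case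
      using E_csc[of E "\<lambda>y. s" "\<lambda>y. a" "\<lambda>y. a"] E_csc[of E' "\<lambda>y. s" "\<lambda>y. a" "\<lambda>y. a"] by simp
  next
    case (clv v a)
    then show ?case
      using E_mult[of E "\<lambda>y. 0" "\<lambda>y. clv v" "\<lambda>y. a"] E_mult[of E' "\<lambda>y. 0" "\<lambda>y. clv v" "\<lambda>y. a"] eq by simp
  qed (simp add: E_one)
  have fin: "E (\<lambda>y. \<Sum>i\<in>I. f i y *C c i) = E' (\<lambda>y. \<Sum>i\<in>I. f i y *C c i)"
    if "finite I" "\<And>i. i \<in> I \<Longrightarrow> smooth_on V (f i)" for I :: "'e list set" and f c
    using that
  proof (induction I rule: finite_induct)
    case (insert i I)
    have s1: "smooth_on V (\<lambda>y. \<Sum>i\<in>I. f i y *C c i)"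
      using insert.prems by (intro smooth_on_sum smooth_on_csc V smooth_on_const) auto
    have fi: "smooth_on V (f i)"
      using insert.prems by simp
    note s2 = smooth_on_csc[OF V(1) fi smooth_on_const, of "c i"]
    show ?case
      using insert E_add[OF _ fi s2 s1, of E] E_add[OF _ fi s2 s1, of E'] const[of "c i"]
        E_csc[OF _ fi smooth_on_const smooth_on_const, of E "c i"] E_csc[OF _ fi smooth_on_const smooth_on_const, of E' "c i"]
      by simp
  qed (simp add: E_zero)
  let ?f = "\<lambda>ws y. coef ws (\<Phi> y)"
  have "smooth_on V (?f ws)" for ws
    unfolding coef_def divide_inverse
    by (intro smooth_on_mult V smooth_on_const smooth_on_bounded_linear[OF V(1) bounded_linear_frm] \<Phi>)
  from fin[OF finite_cl_index this, of "\<lambda>ws. ws" wedges] show ?thesis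
    by (simp flip: cl_expansion)
qed

section \<open>Smooth orthonormal frames, Christoffel symbols and the covariant derivative\<close>

locale metric_frame =
  fixes V :: "'e::euclidean_space set" and g :: "'e metric" and P Q :: "'e \<Rightarrow> 'e \<Rightarrow> 'e"
  assumes V: "open V" and smg: "\<And>u v. smooth_on V (\<lambda>x. g x u v)"
    and iso: "\<And>x. x \<in> V \<Longrightarrow> orthonormal_iso (g x) (P x) (Q x)"
    and smP: "\<And>v. smooth_on V (\<lambda>x. P x v)" and smQ: "\<And>v. smooth_on V (\<lambda>x. Q x v)"

lemma ex_metric_frame:
  assumes V: "open V" and ip: "\<And>x. x \<in> V \<Longrightarrow> inner_prod (g x)"
    and smg: "\<And>u v. smooth_on V (\<lambda>x. g x u v)"
  shows "\<exists>P Q. metric_frame V g P Q"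
proof -
  obtain f :: "'a \<Rightarrow> 'a \<Rightarrow> 'a" where smf: "\<And>b. b \<in> Basis \<Longrightarrow> smooth_on V (f b)"
    and on: "\<And>x b c. x \<in> V \<Longrightarrow> b \<in> Basis \<Longrightarrow> c \<in> Basis \<Longrightarrow> g x (f b x) (f c x) = (if b = c then 1 else 0)"
    using ex_orthonormal_frame[OF assms] by blast
  define P where "P = (\<lambda>x u. \<Sum>b\<in>Basis. (u \<bullet> b) *\<^sub>R f b x)"
  define Q where "Q = (\<lambda>x v. \<Sum>b\<in>Basis. g x v (f b x) *\<^sub>R b)"
  have bl: "bilinear (g x)" if "x \<in> V" for x
    using ip[OF that] by (rule inner_prodD)
  have "metric_frame V g P Q"
  proof (rule metric_frame.intro)
    show "smooth_on V (\<lambda>x. P x v)" for v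
      unfolding P_def by (intro smooth_on_sum smooth_on_scaleR smooth_on_const V smf)
    show "smooth_on V (\<lambda>x. Q x v)" for v
      unfolding Q_def
      by (intro smooth_on_sum smooth_on_scaleR smooth_on_bilinear_family[OF V bl smg] smooth_on_const V smf)
    show "orthonormal_iso (g x) (P x) (Q x)" if x: "x \<in> V" for x
    proof (rule orthonormal_iso.intro)
      show "inner_prod (g x)"
        by (rule ip[OF x])
      show linP: "linear (P x)"
        unfolding P_def by (intro linearI) (simp_all add: inner_add_left scaleR_add_left sum.distrib scaleR_sum_right)
      show "linear (Q x)"
        unfolding Q_def using bl[OF x]
        by (intro linearI) (simp_all add: bilinear_ladd bilinear_lmul scaleR_add_left sum.distrib scaleR_sum_right)
      have gP: "g x (P x u) (f c x) = u \<bullet> c" if c: "c \<in> Basis" for u c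
      proof -
        have l: "linear (\<lambda>w. g x w (f c x))"
          using bl[OF x] by (simp add: bilinear_def)
        have "g x (P x u) (f c x) = (\<Sum>b\<in>Basis. (u \<bullet> b) * g x (f b x) (f c x))"
          by (simp add: P_def linear_sum[OF l] linear_scale[OF l])
        also have "\<dots> = (\<Sum>b\<in>Basis. if b = c then u \<bullet> b else 0)"
          using on[OF x _ c] by (intro sum.cong refl) simp
        finally show ?thesis
          using c by simp
      qed
      then show "Q x (P x u) = u" for u
        by (simp add: Q_def euclidean_representation)
      show "g x (P x u) (P x v) = u \<bullet> v" for u v
      proof -
        have l: "linear (g x (P x u))"
          using bl[OF x] by (simp add: bilinear_def)
        have "P x v = (\<Sum>b\<in>Basis. (v \<bullet> b) *\<^sub>R f b x)"
          by (simp add: P_def)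
        then have "g x (P x u) (P x v) = (\<Sum>b\<in>Basis. (v \<bullet> b) * g x (P x u) (f b x))"
          by (simp only: linear_sum[OF l] linear_scale[OF l] real_scaleR_def)
        also have "\<dots> = u \<bullet> v"
          by (simp add: gP euclidean_inner[of u v] mult.commute)
        finally show ?thesis .
      qed
      have inj: "inj_on (\<lambda>b. f b x) Basis"
        by (rule inj_onI) (metis on[OF x] zero_neq_one)
      then have "onb (g x) ((\<lambda>b. f b x) ` Basis)"
        unfolding onb_def using on[OF x] by (auto simp: card_image dest: inj_onD)
      from onb_expansion[OF ip[OF x] this] show "P x (Q x v) = v" for v
        by (simp add: P_def Q_def sum.reindex[OF inj] inner_sum_left inner_Basis if_distrib cong: if_cong)
    qed
  qed (use V smg in auto)
  then show ?thesis by blast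
qed

context metric_frame
begin

lemma ip: "x \<in> V \<Longrightarrow> inner_prod (g x)"
  using iso orthonormal_iso.ip by blast

lemma bl: "x \<in> V \<Longrightarrow> bilinear (g x)"
  using ip inner_prodD by blast

lemma linP: "x \<in> V \<Longrightarrow> linear (P x)" and linQ: "x \<in> V \<Longrightarrow> linear (Q x)"
  using iso orthonormal_iso.linP orthonormal_iso.linQ by blast+

lemma PQ: "x \<in> V \<Longrightarrow> P x (Q x v) = v" and QP: "x \<in> V \<Longrightarrow> Q x (P x v) = v"
  using iso orthonormal_iso.PQ orthonormal_iso.QP by blast+

lemma gPP: "x \<in> V \<Longrightarrow> g x (P x u) (P x v) = u \<bullet> v"
  using iso orthonormal_iso.iso by blast

lemma dg: "x \<in> V \<Longrightarrow> (\<lambda>x. g x u v) differentiable (at x)"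
  using smg smooth_on_differentiable by blast

text \<open>The Koszul formula for constant fields, whose brackets vanish; it is the value that
  \<open>g x (christoffel g x u v) w\<close> must have.\<close>

definition koszul :: "'e \<Rightarrow> 'e \<Rightarrow> 'e \<Rightarrow> 'e \<Rightarrow> real" where
  "koszul x u v w =
    (pd (\<lambda>y. g y v w) x u + pd (\<lambda>y. g y u w) x v - pd (\<lambda>y. g y u v) x w) / 2"

lemma linear_pd_g:
  assumes x: "x \<in> V"
  shows "linear (\<lambda>v. pd (\<lambda>y. g y v w) x u)" "linear (\<lambda>w. pd (\<lambda>y. g y v w) x u)"
    "linear (\<lambda>u. pd (\<lambda>y. g y v w) x u)"
proof -
  show "linear (\<lambda>v. pd (\<lambda>y. g y v w) x u)" "linear (\<lambda>w. pd (\<lambda>y. g y v w) x u)"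
    by (rule linear_pd_family[OF V x _ smg], use bl in \<open>simp add: bilinear_def\<close>)+
  show "linear (\<lambda>u. pd (\<lambda>y. g y v w) x u)"
    using linear_frechet_derivative[OF dg[OF x]] .
qed

lemma linear_koszul:
  assumes x: "x \<in> V"
  shows "linear (\<lambda>u. koszul x u v w)" "linear (\<lambda>v. koszul x u v w)" "linear (koszul x u v)"
proof -
  note l = linear_pd_g[OF x, THEN linear_add] linear_pd_g[OF x, THEN linear_scale]
  show "linear (\<lambda>u. koszul x u v w)" "linear (\<lambda>v. koszul x u v w)" "linear (koszul x u v)"
    by (auto intro!: linearI simp: koszul_def l field_simps)
qed

lemma g_sym: "x \<in> V \<Longrightarrow> g x u v = g x v u"
  using ip inner_prodD(2) by blast

lemma pd_g_sym:
  assumes x: "x \<in> V"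
  shows "pd (\<lambda>y. g y v w) x u = pd (\<lambda>y. g y w v) x u"
  by (rule pd_cong[OF V x g_sym dg[OF x]])

text \<open>Two of the permuted compatibility equations minus the third leave twice the wanted term,
  by the symmetry of \<open>\<Gamma>\<close>.\<close>

lemma koszul_unique:
  assumes x: "x \<in> V" and sym: "\<And>u v. \<Gamma> u v = \<Gamma> v u"
    and compat: "\<And>u v w. pd (\<lambda>y. g y v w) x u = g x (\<Gamma> u v) w + g x v (\<Gamma> u w)"
  shows "g x (\<Gamma> u v) w = koszul x u v w"
  using compat[of v w u] compat[of u w v] compat[of u v w] sym[of u v] sym[of u w] sym[of v w]
    g_sym[OF x, of "\<Gamma> u v" w] g_sym[OF x, of "\<Gamma> u w" v] g_sym[OF x, of "\<Gamma> v w" u]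
  by (simp add: koszul_def)

text \<open>A definite description needs a solution and its uniqueness. The solution takes the
  Koszul values as components in the orthonormal basis \<open>P x b\<close>;
  \<open>koszul_unique\<close> excludes any other.\<close>

lemma christoffel:
  assumes x: "x \<in> V"
  shows "bilinear (christoffel g x)" "christoffel g x u v = christoffel g x v u"
    "pd (\<lambda>y. g y v w) x u = g x (christoffel g x u v) w + g x v (christoffel g x u w)"
    "christoffel g x u v = (\<Sum>b\<in>Basis. koszul x u v (P x b) *\<^sub>R P x b)"
proof -
  define \<Gamma> where "\<Gamma> = (\<lambda>u v. \<Sum>b\<in>Basis. koszul x u v (P x b) *\<^sub>R P x b)"
  note lk = linear_koszul[OF x]
  have 1: "bilinear \<Gamma>"
    unfolding bilinear_def \<Gamma>_def
    by (auto intro!: linearI simp: lk[THEN linear_add] lk[THEN linear_scale] scaleR_add_left sum.distrib scaleR_sum_right)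
  have ks: "koszul x u v w = koszul x v u w" for u v w
    using pd_g_sym[OF x, of u v w] by (simp add: koszul_def)
  have 2: "\<Gamma> u v = \<Gamma> v u" for u v
    unfolding \<Gamma>_def by (subst ks) (rule refl)
  have g\<Gamma>: "g x (\<Gamma> u v) w = koszul x u v w" for u v w
  proof -
    have l: "linear (\<lambda>a. g x a w)"
      using bl[OF x] by (simp add: bilinear_def)
    have "g x (\<Gamma> u v) w = (\<Sum>b\<in>Basis. koszul x u v (P x b) * g x (P x b) w)"
      by (simp add: \<Gamma>_def linear_sum[OF l] linear_scale[OF l])
    also have "\<dots> = (\<Sum>b\<in>Basis. (Q x w \<bullet> b) *\<^sub>R koszul x u v (P x b))"
      using gPP[OF x, of _ "Q x w"] PQ[OF x] by (simp add: mult.commute inner_commute)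
    also have "\<dots> = koszul x u v (P x (Q x w))"
      using sum_basis_linear[OF linear_compose[OF linP[OF x] lk(3)]] by (simp add: o_def)
    finally show ?thesis
      by (simp add: PQ[OF x])
  qed
  have 3: "pd (\<lambda>y. g y v w) x u = g x (\<Gamma> u v) w + g x v (\<Gamma> u w)" for u v w
    using g_sym[OF x, of v "\<Gamma> u w"] pd_g_sym[OF x, of v w u] g\<Gamma>[of u v w] g\<Gamma>[of u w v]
    unfolding koszul_def by (simp add: field_simps)
  have "christoffel g x = \<Gamma>"
    unfolding christoffel_def
  proof (rule the_equality)
    show "bilinear \<Gamma> \<and> (\<forall>u v. \<Gamma> u v = \<Gamma> v u) \<and> (\<forall>u v w. pd (\<lambda>y. g y v w) x u = g x (\<Gamma> u v) w + g x v (\<Gamma> u w))"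
      using 1 2 3 by blast
    show "\<Gamma>' = \<Gamma>" if "bilinear \<Gamma>' \<and> (\<forall>u v. \<Gamma>' u v = \<Gamma>' v u) \<and>
      (\<forall>u v w. pd (\<lambda>y. g y v w) x u = g x (\<Gamma>' u v) w + g x v (\<Gamma>' u w))" for \<Gamma>'
    proof (intro ext inner_prod_eqI[OF ip[OF x]])
      show "g x (\<Gamma>' u v) w = g x (\<Gamma> u v) w" for u v w
        using koszul_unique[OF x, of \<Gamma>' u v w] that g\<Gamma> by simp
    qed
  qed
  then show "bilinear (christoffel g x)" "christoffel g x u v = christoffel g x v u"
    "pd (\<lambda>y. g y v w) x u = g x (christoffel g x u v) w + g x v (christoffel g x u w)"
    "christoffel g x u v = (\<Sum>b\<in>Basis. koszul x u v (P x b) *\<^sub>R P x b)"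
    using 1 2 3 \<Gamma>_def by simp_all
qed

lemma smooth_koszul: "smooth_on V (\<lambda>x. koszul x u v w)"
proof -
  have "smooth_on V (\<lambda>x. pd (\<lambda>y. g y v w) x u)" for u v w
    by (rule smooth_on_pd[OF smg])
  moreover have "smooth_on V (\<lambda>x. pd (\<lambda>y. g y v u) x w)"
    by (rule smooth_on_pd[OF smg])
  ultimately show ?thesis
    unfolding koszul_def divide_inverse
    by (intro smooth_on_mult smooth_on_add smooth_on_diff V smooth_on_const)
qed

lemma smooth_christoffel: "smooth_on V (\<lambda>x. christoffel g x u v)"
  by (rule smooth_on_cong[OF V _ christoffel(4)])
    (intro smooth_on_sum smooth_on_scaleR smooth_on_linear_family[OF V linear_koszul(3) smooth_koszul] smP V, assumption)

lemma dP: "x \<in> V \<Longrightarrow> (\<lambda>x. P x v) differentiable (at x)"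
  using smP smooth_on_differentiable by blast

lemma levi_civita_metric:
  assumes x: "x \<in> V" and "smooth_on V Y" "smooth_on V Z"
  shows "pd (\<lambda>y. g y (Y y) (Z y)) x u = g x (levi_civita g u Y x) (Z x) + g x (Y x) (levi_civita g u Z x)"
  using pd_bilinear_family[OF V x bl smg assms(2,3)] christoffel(3)[OF x] bl[OF x]
  by (simp add: levi_civita_def bilinear_ladd bilinear_radd)

lemma linear_pd_P: "x \<in> V \<Longrightarrow> linear (\<lambda>v. pd (\<lambda>y. P y v) x u)"
  by (rule linear_pd_family[OF V _ linP smP])

text \<open>The connection form of the frame: the covariant derivative of the field with constant
  components \<open>w\<close>, expressed in the frame again.\<close>

definition conn :: "'e \<Rightarrow> 'e \<Rightarrow> 'e \<Rightarrow> 'e" where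
  "conn x u w = Q x (levi_civita g u (\<lambda>y. P y w) x)"

lemma linear_conn: 
  assumes x: "x \<in> V"
  shows "linear (conn x u)" "linear (\<lambda>u. conn x u w)"
proof -
  note l = linear_add[OF linQ[OF x]] linear_scale[OF linQ[OF x]] linear_add[OF linP[OF x]] linear_scale[OF linP[OF x]]
    linear_add[OF linear_pd_P[OF x]] linear_scale[OF linear_pd_P[OF x]]
    linear_add[OF linear_frechet_derivative[OF dP[OF x]]] linear_scale[OF linear_frechet_derivative[OF dP[OF x]]]
    bilinear_ladd[OF christoffel(1)[OF x]] bilinear_radd[OF christoffel(1)[OF x]]
    bilinear_lmul[OF christoffel(1)[OF x]] bilinear_rmul[OF christoffel(1)[OF x]]
  show "linear (conn x u)"  "linear (\<lambda>u. conn x u w)"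
    by (auto intro!: linearI simp: conn_def levi_civita_def l scaleR_add_right)
qed

text \<open>Fields with constant components in an orthonormal frame have constant inner products;
  metric compatibility differentiates these. The skewness is what \<open>comm_spn\<close> requires
  of the lift.\<close>

lemma conn_skew:
  assumes x: "x \<in> V"
  shows "conn x u w \<bullet> w' = - (w \<bullet> conn x u w')"
proof -
  have "pd (\<lambda>y. g y (P y w) (P y w')) x u = pd (\<lambda>y. w \<bullet> w') x u"
    by (rule pd_cong[OF V x]) (auto simp: gPP)
  then have "g x (P x (conn x u w)) (P x w') + g x (P x w) (P x (conn x u w')) = 0"
    using levi_civita_metric[OF x smP smP, of w w' u] by (simp add: conn_def PQ[OF x])
  then show ?thesis
    by (simp add: gPP[OF x])
qed

lemma smooth_conn: "smooth_on V (\<lambda>x. conn x u w)"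
  unfolding conn_def levi_civita_def
proof (intro smooth_on_linear_family[OF V linQ smQ] smooth_on_add V smooth_on_pd smP)
  show "smooth_on V (\<lambda>x. christoffel g x u (P x w))"
  proof (rule smooth_on_linear_family[OF V _ smooth_christoffel smP])
    show "linear (christoffel g x u)" if "x \<in> V" for x
      using christoffel(1)[OF that] by (simp add: bilinear_def)
  qed
qed

lemma levi_civita_frame:
  assumes x: "x \<in> V" and Z: "smooth_on V Z"
  shows "levi_civita g u (\<lambda>y. P y (Z y)) x = P x (pd Z x u + conn x u (Z x))"
  using pd_linear_family[OF V x linP smP Z]
  by (simp add: levi_civita_def conn_def PQ[OF x] linear_add[OF linP[OF x]])

definition der :: "'e \<Rightarrow> 'e \<Rightarrow> ('e \<Rightarrow> 'e cl) \<Rightarrow> 'e cl" where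
  "der x u \<Phi> = pd \<Phi> x u + comm (spn (conn x u)) (\<Phi> x)"

lemma smooth_spn: "(\<And>w. smooth_on V (\<lambda>x. z x w)) \<Longrightarrow> smooth_on V (\<lambda>x. spn (z x))"
  unfolding spn_def
  by (intro smooth_on_scaleR smooth_on_sum smooth_on_cl_mult smooth_on_clv smooth_on_const V)

lemma smooth_comm: "smooth_on V \<Phi> \<Longrightarrow> smooth_on V \<Psi> \<Longrightarrow> smooth_on V (\<lambda>x. comm (\<Phi> x) (\<Psi> x :: 'e cl))"
  unfolding comm_def by (intro smooth_on_diff smooth_on_cl_mult V)

lemma smooth_der: "smooth_on V \<Phi> \<Longrightarrow> smooth_on V (\<lambda>x. der x u \<Phi>)"
  unfolding der_def by (intro smooth_on_add V smooth_on_pd smooth_comm smooth_spn smooth_conn)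

context
  fixes x assumes x: "x \<in> V"
begin

lemma der_cong: "smooth_on V \<Psi> \<Longrightarrow> (\<And>y. y \<in> V \<Longrightarrow> \<Phi> y = \<Psi> y) \<Longrightarrow> der x u \<Phi> = der x u \<Psi>"
  using pd_cong[OF V x, of \<Phi> \<Psi> u] x by (simp add: der_def smooth_on_differentiable[OF _ x])

lemma der_add: "smooth_on V \<Phi> \<Longrightarrow> smooth_on V \<Psi> \<Longrightarrow> der x u (\<lambda>y. \<Phi> y + \<Psi> y) = der x u \<Phi> + der x u \<Psi>"
  by (simp add: der_def pd_add comm_simps smooth_on_differentiable[OF _ x])

lemma der_csc: "smooth_on V f \<Longrightarrow> smooth_on V \<Phi> \<Longrightarrow> der x u (\<lambda>y. f y *C \<Phi> y) = pd f x u *C \<Phi> x + f x *C der x u \<Phi>"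
  using pd_bilinear[OF bounded_bilinear_csc, of f x \<Phi> u]
  by (simp add: der_def comm_cl_simps smooth_on_differentiable[OF _ x])

lemma der_mult: "smooth_on V \<Phi> \<Longrightarrow> smooth_on V \<Psi> \<Longrightarrow> der x u (\<lambda>y. \<Phi> y * \<Psi> y) = der x u \<Phi> * \<Psi> x + \<Phi> x * der x u \<Psi>"
  using pd_bilinear[OF bounded_bilinear_cl_mult, of \<Phi> x \<Psi> u]
  by (simp add: der_def comm_mult algebra_simps smooth_on_differentiable[OF _ x])

lemma der_clv: "smooth_on V Z \<Longrightarrow> der x u (\<lambda>y. clv (Z y)) = clv (pd Z x u + conn x u (Z x))"
  using pd_bounded_linear[OF linear_conv_bounded_linear[THEN iffD1, OF linear_clv] smooth_on_differentiable[OF _ x]]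
    comm_spn[OF linear_conn(1)[OF x] conn_skew[OF x]]
  by (simp add: der_def)

lemma linear_der: "smooth_on V \<Phi> \<Longrightarrow> linear (\<lambda>u. der x u \<Phi>)"
proof -
  assume \<Phi>: "smooth_on V \<Phi>"
  have spn: "spn (conn x (u + v)) = spn (conn x u) + spn (conn x v)"
    "spn (conn x (r *\<^sub>R u)) = r *\<^sub>R spn (conn x u)" for u v r
    using linear_conn(2)[OF x, THEN linear_add] linear_conn(2)[OF x, THEN linear_scale]
    by (simp_all add: spn_def distrib_left sum.distrib scaleR_add_right scaleR_sum_right mult.commute)
  show ?thesis
    using linear_frechet_derivative[OF smooth_on_differentiable[OF \<Phi> x]]
    by (auto intro!: linearI simp: der_def spn comm_simps comm_cl_simps linear_add linear_scale scaleR_add_right)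
qed

end

lemma cl_derivation_der: "x \<in> V \<Longrightarrow> cl_derivation V x u (der x u)"
  by (simp add: cl_derivation_def der_add der_mult der_csc)

lemma smooth_toC:
  assumes "smooth_form_on V \<phi>"
  shows "smooth_on V (\<lambda>x. toC (P x) (\<phi> x))"
proof (rule smooth_on_clI[OF V])
  show "smooth_on V (\<lambda>x. frm (toC (P x) (\<phi> x)) ws)" for ws
    using smooth_on_form_map[OF V assms smP] assms orthonormal_iso.frm_toC[OF iso]
    by (rule_tac smooth_on_cong[OF V, of "\<lambda>x. \<phi> x (map (P x) ws)"]) (auto simp: smooth_form_on_def)
qed

lemma smooth_fromC:
  assumes "smooth_on V \<Phi>"
  shows "smooth_form_on V (\<lambda>x. fromC (Q x) (\<Phi> x))"
proof -
  have "smooth_form_on V (\<lambda>x. frm (\<Phi> x))"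
    using smooth_on_bounded_linear[OF V bounded_linear_frm assms] by (simp add: smooth_form_on_def)
  then have "smooth_on V (\<lambda>x. frm (\<Phi> x) (map (Q x) ws))" for ws
    by (rule smooth_on_form_map[OF V _ smQ])
  then show ?thesis
    using orthonormal_iso.alt_fromC[OF iso] by (simp add: smooth_form_on_def) (simp add: fromC_def)
qed

lemma fromC_toC: "x \<in> V \<Longrightarrow> smooth_form_on V \<phi> \<Longrightarrow> fromC (Q x) (toC (P x) (\<phi> x)) = \<phi> x"
  using orthonormal_iso.fromC_toC[OF iso] by (auto simp: smooth_form_on_def)

lemma smooth_form_onE:
  assumes "smooth_form_on V \<phi>"
  obtains \<Phi> where "smooth_on V \<Phi>" "\<And>x. x \<in> V \<Longrightarrow> \<phi> x = fromC (Q x) (\<Phi> x)" "\<And>x. toC (P x) (\<phi> x) = \<Phi> x"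
  using that[OF smooth_toC[OF assms]] fromC_toC[OF _ assms] by metis

lemma smooth_form_on_cong:
  "smooth_form_on V \<psi> \<Longrightarrow> (\<And>x. x \<in> V \<Longrightarrow> \<phi> x = \<psi> x) \<Longrightarrow> smooth_form_on V \<phi>"
  using smooth_on_cong[OF V] unfolding smooth_form_on_def by metis

text \<open>Existence of an extension, on which the choice in \<open>nabla\<close> depends. Each
  clause is transported to the frame, where it is one of the rules for \<open>der\<close>.\<close>

lemma derivation_extension_der:
  "derivation_extension V g (\<lambda>u \<phi> x. fromC (Q x) (der x u (\<lambda>y. toC (P y) (\<phi> y))))"
  unfolding derivation_extension_def
proof (intro conjI allI impI ballI)
  fix u \<phi> assume "smooth_form_on V \<phi>"
  then obtain \<Phi> where s\<Phi>: "smooth_on V \<Phi>" and \<phi>: "\<And>x. x \<in> V \<Longrightarrow> \<phi> x = fromC (Q x) (\<Phi> x)"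
    and t\<Phi>: "\<And>x. toC (P x) (\<phi> x) = \<Phi> x"
    by (rule smooth_form_onE) blast
  show "smooth_form_on V (\<lambda>x. fromC (Q x) (der x u (\<lambda>y. toC (P y) (\<phi> y))))"
    unfolding t\<Phi> by (intro smooth_fromC smooth_der s\<Phi>)
  {
    fix \<psi> x assume "smooth_form_on V \<psi>" and x: "x \<in> V"
    then obtain \<Psi> where s\<Psi>: "smooth_on V \<Psi>" and \<psi>: "\<And>x. x \<in> V \<Longrightarrow> \<psi> x = fromC (Q x) (\<Psi> x)"
      and t\<Psi>: "\<And>x. toC (P x) (\<psi> x) = \<Psi> x"
      using smooth_form_onE by blast
    interpret F: orthonormal_iso "g x" "P x" "Q x" by (rule iso[OF x])
    have "toC (P y) (\<phi> y + \<psi> y) = \<Phi> y + \<Psi> y" if "y \<in> V" for y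
      unfolding \<phi>[OF that] \<psi>[OF that] orthonormal_iso.fromC_simps(1)[OF iso[OF that], symmetric]
      by (rule orthonormal_iso.toC_fromC[OF iso[OF that]])
    from der_cong[OF x smooth_on_add[OF V s\<Phi> s\<Psi>] this] der_add[OF x s\<Phi> s\<Psi>]
    show "fromC (Q x) (der x u (\<lambda>y. toC (P y) (\<phi> y + \<psi> y))) =
       fromC (Q x) (der x u (\<lambda>y. toC (P y) (\<phi> y))) + fromC (Q x) (der x u (\<lambda>y. toC (P y) (\<psi> y)))"
      by (simp only: F.fromC_simps t\<Phi> t\<Psi>)
    have "toC (P y) (cmul (g y) (\<phi> y) (\<psi> y)) = \<Phi> y * \<Psi> y" if "y \<in> V" for y
      unfolding \<phi>[OF that] \<psi>[OF that] orthonormal_iso.cmul_fromC[OF iso[OF that]]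
      by (rule orthonormal_iso.toC_fromC[OF iso[OF that]])
    from der_cong[OF x smooth_on_cl_mult[OF V s\<Phi> s\<Psi>] this] der_mult[OF x s\<Phi> s\<Psi>]
    show "fromC (Q x) (der x u (\<lambda>y. toC (P y) (cmul (g y) (\<phi> y) (\<psi> y)))) =
       cmul (g x) (fromC (Q x) (der x u (\<lambda>y. toC (P y) (\<phi> y)))) (\<psi> x) +
       cmul (g x) (\<phi> x) (fromC (Q x) (der x u (\<lambda>y. toC (P y) (\<psi> y))))"
      by (simp only: t\<Phi> t\<Psi> \<phi>[OF x] \<psi>[OF x] F.cmul_fromC F.fromC_simps)
  next
    fix f :: "'e \<Rightarrow> complex" and x assume f: "smooth_on V f" and x: "x \<in> V"
    interpret F: orthonormal_iso "g x" "P x" "Q x" by (rule iso[OF x])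
    have "toC (P y) (f y \<odot> \<phi> y) = f y *C \<Phi> y" if "y \<in> V" for y
      unfolding \<phi>[OF that] orthonormal_iso.fromC_simps(5)[OF iso[OF that], symmetric]
      by (rule orthonormal_iso.toC_fromC[OF iso[OF that]])
    from der_cong[OF x smooth_on_csc[OF V f s\<Phi>] this] der_csc[OF x f s\<Phi>]
    show "fromC (Q x) (der x u (\<lambda>y. toC (P y) (f y \<odot> \<phi> y))) =
       pd f x u \<odot> \<phi> x + f x \<odot> fromC (Q x) (der x u (\<lambda>y. toC (P y) (\<phi> y)))"
      by (simp only: t\<Phi> \<phi>[OF x] F.fromC_simps)
  }
next
  fix u x and Y :: "'e \<Rightarrow> 'e" assume Y: "smooth_on V Y" and x: "x \<in> V"
  interpret F: orthonormal_iso "g x" "P x" "Q x" by (rule iso[OF x])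
  have Z: "smooth_on V (\<lambda>y. Q y (Y y))"
    by (rule smooth_on_linear_family[OF V linQ smQ Y])
  have "toC (P y) (vec_form (g y) (Y y)) = clv (Q y (Y y))" if "y \<in> V" for y
    using orthonormal_iso.vec_form_eq[OF iso[OF that]] orthonormal_iso.toC_fromC[OF iso[OF that]] by metis
  from der_cong[OF x smooth_on_clv[OF V Z] this] der_clv[OF x Z]
  have "fromC (Q x) (der x u (\<lambda>y. toC (P y) (vec_form (g y) (Y y)))) =
      vec_form (g x) (P x (pd (\<lambda>y. Q y (Y y)) x u + conn x u (Q x (Y x))))"
    by (simp only: F.fromC_clv)
  also have "P x (pd (\<lambda>y. Q y (Y y)) x u + conn x u (Q x (Y x))) = levi_civita g u (\<lambda>y. P y (Q y (Y y))) x"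
    by (rule levi_civita_frame[OF x Z, symmetric])
  also have "\<dots> = levi_civita g u Y x"
    using pd_cong[OF V x, of "\<lambda>y. P y (Q y (Y y))" Y u] smooth_on_differentiable[OF Y x]
    by (simp add: levi_civita_def PQ)
  finally show "fromC (Q x) (der x u (\<lambda>y. toC (P y) (vec_form (g y) (Y y)))) = vec_form (g x) (levi_civita g u Y x)" .
qed

context
  fixes N :: "'e \<Rightarrow> ('e \<Rightarrow> 'e form) \<Rightarrow> 'e \<Rightarrow> 'e form"
  assumes N: "derivation_extension V g N"
begin

lemma derivation_add:
  "smooth_form_on V \<phi> \<Longrightarrow> smooth_form_on V \<psi> \<Longrightarrow> x \<in> V \<Longrightarrow> N u (\<lambda>y. \<phi> y + \<psi> y) x = N u \<phi> x + N u \<psi> x"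
  and derivation_scale:
  "smooth_on V f \<Longrightarrow> smooth_form_on V \<phi> \<Longrightarrow> x \<in> V \<Longrightarrow> N u (\<lambda>y. f y \<odot> \<phi> y) x = pd f x u \<odot> \<phi> x + f x \<odot> N u \<phi> x"
  and derivation_cmul:
  "smooth_form_on V \<phi> \<Longrightarrow> smooth_form_on V \<psi> \<Longrightarrow> x \<in> V \<Longrightarrow>
    N u (\<lambda>y. cmul (g y) (\<phi> y) (\<psi> y)) x = cmul (g x) (N u \<phi> x) (\<psi> x) + cmul (g x) (\<phi> x) (N u \<psi> x)"
  and derivation_vec:
  "smooth_on V Y \<Longrightarrow> x \<in> V \<Longrightarrow> N u (\<lambda>y. vec_form (g y) (Y y)) x = vec_form (g x) (levi_civita g u Y x)"
  and derivation_alt: "smooth_form_on V \<phi> \<Longrightarrow> x \<in> V \<Longrightarrow> alt_form (N u \<phi> x)"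
  using N unfolding derivation_extension_def smooth_form_on_def[of V "N _ _"] by blast+

text \<open>
  Multiplying with the indicator function of the complement of \<open>V\<close>, which is smooth on \<open>V\<close>,
  shows that the values outside \<open>V\<close> do not matter.
\<close>

lemma derivation_local:
  assumes \<phi>: "smooth_form_on V \<phi>" and \<psi>: "smooth_form_on V \<psi>" and eq: "\<And>y. y \<in> V \<Longrightarrow> \<phi> y = \<psi> y" and x: "x \<in> V"
  shows "N u \<phi> x = N u \<psi> x"
proof -
  define f :: "'e \<Rightarrow> complex" where "f = (\<lambda>y. if y \<in> V then 0 else 1)"
  have f: "smooth_on V f"
    by (rule smooth_on_cong[OF V smooth_on_const[of V 0]]) (simp add: f_def)
  have d: "smooth_form_on V (\<lambda>y. \<phi> y - \<psi> y)"
    by (rule smooth_form_on_cong[of "\<lambda>y. 0"]) (auto simp: eq smooth_form_on_def)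
  have fd: "smooth_form_on V (\<lambda>y. f y \<odot> (\<phi> y - \<psi> y))"
    by (rule smooth_form_on_cong[of "\<lambda>y. 0"]) (auto simp: eq smooth_form_on_def cscale_def)
  have "\<phi> = (\<lambda>y. \<psi> y + f y \<odot> (\<phi> y - \<psi> y))"
    by (auto simp: f_def cscale_def fun_eq_iff eq)
  then have "N u \<phi> x = N u (\<lambda>y. \<psi> y + f y \<odot> (\<phi> y - \<psi> y)) x"
    by simp
  also have "\<dots> = N u \<psi> x + (pd f x u \<odot> (\<phi> x - \<psi> x) + f x \<odot> N u (\<lambda>y. \<phi> y - \<psi> y) x)"
    by (simp only: derivation_add[OF \<psi> fd x] derivation_scale[OF f d x])
  also have "\<dots> = N u \<psi> x"
    using x by (simp add: eq f_def cscale_def fun_eq_iff)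
  finally show ?thesis .
qed

text \<open>In the frame and at a fixed point, \<open>N\<close> becomes a
  \<open>cl_derivation\<close> whose values on constant vectors are dictated by the clause on vector
  fields, so it must be \<open>der\<close>. Fields that coincide only on \<open>V\<close> are
  exchanged by \<open>derivation_local\<close>.\<close>

lemma derivation_eq:
  assumes \<phi>: "smooth_form_on V \<phi>" and x: "x \<in> V"
  shows "N u \<phi> x = fromC (Q x) (der x u (\<lambda>y. toC (P y) (\<phi> y)))"
proof -
  interpret F: orthonormal_iso "g x" "P x" "Q x" by (rule iso[OF x])
  define E where "E = (\<lambda>\<Phi>. toC (P x) (N u (\<lambda>y. fromC (Q y) (\<Phi> y)) x))"
  have NE: "N u (\<lambda>y. fromC (Q y) (\<Phi> y)) x = fromC (Q x) (E \<Phi>)" if "smooth_on V \<Phi>" for \<Phi>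
    unfolding E_def by (rule F.fromC_toC[symmetric, OF derivation_alt[OF smooth_fromC[OF that] x]])
  have loc: "N u (\<lambda>y. fromC (Q y) (\<Phi> y)) x = N u \<psi> x"
    if "smooth_on V \<Phi>" "\<And>y. y \<in> V \<Longrightarrow> \<psi> y = fromC (Q y) (\<Phi> y)" for \<Phi> \<psi>
    by (rule derivation_local[OF smooth_fromC[OF that(1)] smooth_form_on_cong[OF smooth_fromC[OF that(1)] that(2)] _ x])
      (simp_all only: that(2))
  have "cl_derivation V x u E"
    unfolding cl_derivation_def
  proof (intro conjI allI impI)
    fix \<Phi> \<Psi> :: "'e \<Rightarrow> 'e cl" assume s: "smooth_on V \<Phi>" "smooth_on V \<Psi>"
    note ss = smooth_fromC[OF s(1)] smooth_fromC[OF s(2)]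
    have "fromC (Q x) (E (\<lambda>y. \<Phi> y + \<Psi> y)) = N u (\<lambda>y. fromC (Q y) (\<Phi> y + \<Psi> y)) x"
      by (rule NE[OF smooth_on_add[OF V s], symmetric])
    also have "\<dots> = N u (\<lambda>y. fromC (Q y) (\<Phi> y) + fromC (Q y) (\<Psi> y)) x"
      by (rule loc[OF smooth_on_add[OF V s] orthonormal_iso.fromC_simps(1)[OF iso, symmetric]])
    also have "\<dots> = fromC (Q x) (E \<Phi> + E \<Psi>)"
      by (simp only: derivation_add[OF ss x] NE s F.fromC_simps)
    finally show "E (\<lambda>y. \<Phi> y + \<Psi> y) = E \<Phi> + E \<Psi>"
      by (simp only: F.fromC_inj)
    have "fromC (Q x) (E (\<lambda>y. \<Phi> y * \<Psi> y)) = N u (\<lambda>y. fromC (Q y) (\<Phi> y * \<Psi> y)) x"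
      by (rule NE[OF smooth_on_cl_mult[OF V s], symmetric])
    also have "\<dots> = N u (\<lambda>y. cmul (g y) (fromC (Q y) (\<Phi> y)) (fromC (Q y) (\<Psi> y))) x"
      by (rule loc[OF smooth_on_cl_mult[OF V s] orthonormal_iso.cmul_fromC[OF iso]])
    also have "\<dots> = fromC (Q x) (E \<Phi> * \<Psi> x + \<Phi> x * E \<Psi>)"
      by (simp only: derivation_cmul[OF ss x] NE s F.cmul_fromC F.fromC_simps)
    finally show "E (\<lambda>y. \<Phi> y * \<Psi> y) = E \<Phi> * \<Psi> x + \<Phi> x * E \<Psi>"
      by (simp only: F.fromC_inj)
  next
    fix f :: "'e \<Rightarrow> complex" and \<Phi> :: "'e \<Rightarrow> 'e cl" assume s: "smooth_on V f" "smooth_on V \<Phi>"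
    have "fromC (Q x) (E (\<lambda>y. f y *C \<Phi> y)) = N u (\<lambda>y. fromC (Q y) (f y *C \<Phi> y)) x"
      by (rule NE[OF smooth_on_csc[OF V s], symmetric])
    also have "\<dots> = N u (\<lambda>y. f y \<odot> fromC (Q y) (\<Phi> y)) x"
      by (rule loc[OF smooth_on_csc[OF V s] orthonormal_iso.fromC_simps(5)[OF iso, symmetric]])
    also have "\<dots> = fromC (Q x) (pd f x u *C \<Phi> x + f x *C E \<Phi>)"
      by (simp only: derivation_scale[OF s(1) smooth_fromC[OF s(2)] x] NE s F.fromC_simps)
    finally show "E (\<lambda>y. f y *C \<Phi> y) = pd f x u *C \<Phi> x + f x *C E \<Phi>"
      by (simp only: F.fromC_inj)
  qed
  moreover have "E (\<lambda>y. clv w) = der x u (\<lambda>y. clv w)" for w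
  proof -
    have "fromC (Q x) (E (\<lambda>y. clv w)) = N u (\<lambda>y. vec_form (g y) (P y w)) x"
      unfolding NE[OF smooth_on_const, symmetric]
      by (rule loc[OF smooth_on_const orthonormal_iso.fromC_clv[OF iso, symmetric]])
    also have "\<dots> = fromC (Q x) (clv (conn x u w))"
      by (simp only: derivation_vec[OF smP x] F.vec_form_eq conn_def)
    finally show ?thesis
      using der_clv[OF x smooth_on_const, of u w] by simp
  qed
  ultimately have "E (\<lambda>y. toC (P y) (\<phi> y)) = der x u (\<lambda>y. toC (P y) (\<phi> y))"
    by (intro cl_derivation_eqI[OF V x _ cl_derivation_der[OF x] _ smooth_toC[OF \<phi>]])
  then show ?thesis
    using NE[OF smooth_toC[OF \<phi>]] loc[OF smooth_toC[OF \<phi>] fromC_toC[OF _ \<phi>, symmetric]] by simp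
qed

end

lemma nabla_eq:
  assumes "smooth_form_on V \<phi>" "x \<in> V"
  shows "nabla V g u \<phi> x = fromC (Q x) (der x u (\<lambda>y. toC (P y) (\<phi> y)))"
proof (rule derivation_eq[OF _ assms])
  show "derivation_extension V g (nabla V g)"
    unfolding nabla_def using derivation_extension_der by (rule someI[of "derivation_extension V g"])
qed

definition dirC :: "('e \<Rightarrow> 'e cl) \<Rightarrow> 'e \<Rightarrow> 'e cl" where
  "dirC \<Phi> x = (\<Sum>b\<in>Basis. clv b * der x (P x b) \<Phi>)"

lemma dirac_on_eq:
  assumes \<phi>: "smooth_form_on V \<phi>" and x: "x \<in> V"
  shows "dirac_on V g \<phi> x = fromC (Q x) (dirC (\<lambda>y. toC (P y) (\<phi> y)) x)"
proof -
  interpret F: orthonormal_iso "g x" "P x" "Q x" by (rule iso[OF x])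
  let ?\<Phi> = "\<lambda>y. toC (P y) (\<phi> y)" and ?E = "SOME E. onb (g x) E"
  have E: "onb (g x) ?E"
    using F.ex_onb by (rule someI)
  have "dirac_on V g \<phi> x = (\<Sum>v\<in>?E. fromC (Q x) (clv (Q x v) * der x v ?\<Phi>))"
    by (simp only: dirac_on_def nabla_eq[OF \<phi> x] F.vec_form_eq F.cmul_fromC)
  also have "\<dots> = fromC (Q x) (\<Sum>v\<in>?E. clv (Q x v) * der x v ?\<Phi>)"
    by (rule F.fromC_sum[symmetric])
  also have "(\<Sum>v\<in>?E. clv (Q x v) * der x v ?\<Phi>) = (\<Sum>b\<in>Basis. clv (Q x (P x b)) * der x (P x b) ?\<Phi>)"
  proof (rule F.onb_sum[OF E, of "\<lambda>u v. clv (Q x u) * der x v ?\<Phi>"])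
    show "bilinear (\<lambda>u v. clv (Q x u) * der x v ?\<Phi>)"
      using linear_der[OF x smooth_toC[OF \<phi>]] orthonormal_iso.linQ[OF iso[OF x]]
      by (auto simp: bilinear_def linear_iff algebra_simps)
  qed
  finally show ?thesis
    by (simp add: dirC_def)
qed

end

section \<open>The algebra of the torsion term\<close>

text \<open>After expansion in the basis both sides are double sums with the coefficients
  \<open>z b \<bullet> c\<close>, which are antisymmetric in \<open>b\<close> and
  \<open>c\<close>.\<close>

lemma sum_skew:
  fixes H :: "'e::euclidean_space \<Rightarrow> 'e \<Rightarrow> 'b::real_vector"
  assumes H: "bilinear H" and skew: "\<And>u v. z u \<bullet> v = - (u \<bullet> z v)"
  shows "(\<Sum>b\<in>Basis. H (z b) b) = - (\<Sum>b\<in>Basis. H b (z b))"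
proof -
  have l: "linear (\<lambda>u. H u v)" "linear (H u)" for u v
    using H by (simp_all add: bilinear_def)
  have "(\<Sum>b\<in>Basis. H (z b) b) = (\<Sum>b\<in>Basis. \<Sum>c\<in>Basis. (z b \<bullet> c) *\<^sub>R H c b)"
    by (simp only: sum_basis_linear[OF l(1)])
  also have "\<dots> = (\<Sum>c\<in>Basis. \<Sum>b\<in>Basis. (z b \<bullet> c) *\<^sub>R H c b)"
    by (rule sum.swap)
  also have "\<dots> = (\<Sum>c\<in>Basis. \<Sum>b\<in>Basis. - ((z c \<bullet> b) *\<^sub>R H c b))"
  proof (intro sum.cong refl)
    show "(z b \<bullet> c) *\<^sub>R H c b = - ((z c \<bullet> b) *\<^sub>R H c b)" for b c
      using skew[of b c] by (simp add: inner_commute)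
  qed
  also have "\<dots> = - (\<Sum>b\<in>Basis. H b (z b))"
    by (simp only: sum_negf sum_basis_linear[OF l(2)])
  finally show ?thesis .
qed

locale complex_structure =
  fixes j :: "'e::euclidean_space \<Rightarrow> 'e"
  assumes linj: "linear j" and jj: "\<And>u. j (j u) = - u" and orth: "\<And>u v. j u \<bullet> j v = u \<bullet> v"
begin

lemma skew: "j u \<bullet> v = - (u \<bullet> j v)"
  using orth[of u "j v"] by (simp add: jj)

abbreviation e :: "'e \<Rightarrow> 'e cl" where "e \<equiv> epsC j"
abbreviation f :: "'e \<Rightarrow> 'e cl" where "f \<equiv> epsC_bar j"

definition herm :: "'e \<Rightarrow> 'e \<Rightarrow> complex" where
  "herm u v = of_real (u \<bullet> v) + \<i> * of_real (u \<bullet> j v)"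

lemma e_j: "e (j v) = \<i> *C e v" and f_j: "f (j v) = (- \<i>) *C f v"
  by (rule epsC_r[of j, OF jj])+

lemma linear_e: "linear e" and linear_f: "linear f"
  by (rule linear_epsC[OF linj])+

text \<open>Everything reduces to the anticommutators \<open>s\<close> of vectors. For two factors
  of the same type the four terms cancel because \<open>j\<close> is orthogonal and skew; for
  opposite types they add up to the hermitian form \<open>herm\<close>.\<close>

lemma anticommute:
  "e u * e v = - (e v * e u)" "f u * f v = - (f v * f u)" 
  "e u * f v = - (f v * e u) - herm u v *C 1"
proof -
  have ee: "clv a * clv b + clv b * clv a = of_real (- (2 * (a \<bullet> b))) *C (1 :: 'e cl)" for a b
    using clv_clv[of a b] by (simp only: csc_of_real scaleR_minus_left)
  define s where "s a b = clv a * clv b + clv b * clv a" for a b :: 'e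
  have s: "s a b = of_real (- (2 * (a \<bullet> b))) *C 1" for a b
    by (simp only: s_def ee)
  have "e u * e v + e v * e u = (1/4) *C (s u v - \<i> *C s u (j v) - \<i> *C s (j u) v - s (j u) (j v))"
    by (simp add: s_def epsC_def algebra_simps)
  also have "\<dots> = 0"
    unfolding s skew[of u v] orth by (rule cl_eqI) (simp add: algebra_simps)
  finally show "e u * e v = - (e v * e u)"
    by (simp add: eq_neg_iff_add_eq_0)
  have "f u * f v + f v * f u = (1/4) *C (s u v + \<i> *C s u (j v) + \<i> *C s (j u) v - s (j u) (j v))"
    by (simp add: s_def epsC_bar_def algebra_simps)
  also have "\<dots> = 0"
    unfolding s skew[of u v] orth by (rule cl_eqI) (simp add: algebra_simps)
  finally show "f u * f v = - (f v * f u)"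
    by (simp add: eq_neg_iff_add_eq_0)
  have "e u * f v + f v * e u = (1/4) *C (s u v + \<i> *C s u (j v) - \<i> *C s (j u) v + s (j u) (j v))"
    by (simp add: s_def epsC_def epsC_bar_def algebra_simps)
  also have "\<dots> = - (herm u v *C 1)"
    unfolding s skew[of u v] orth herm_def by (rule cl_eqI) (simp add: algebra_simps)
  finally show "e u * f v = - (f v * e u) - herm u v *C 1"
    by (metis add_diff_cancel_right' minus_diff_commute)
qed

text \<open>The real and the imaginary part of \<open>herm\<close> each reproduce one copy, since
  \<open>e (j u)\<close> is i times \<open>e u\<close> and \<open>f (j u)\<close> is -i times
  \<open>f u\<close>. This 2 will cancel the 1/2 in \<open>LC\<close> and
  \<open>LC_bar\<close>.\<close>

lemma sum_herm:
  "(\<Sum>v\<in>Basis. herm u v *C e v) = 2 *C e u" "(\<Sum>v\<in>Basis. herm v u *C f v) = 2 *C f u"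
proof -
  have "herm u v *C e v = (u \<bullet> v) *\<^sub>R e v + (- \<i>) *C (j u \<bullet> v) *\<^sub>R e v" for v
    by (rule cl_eqI) (simp add: herm_def skew algebra_simps)
  then have "(\<Sum>v\<in>Basis. herm u v *C e v) =
      (\<Sum>v\<in>Basis. (u \<bullet> v) *\<^sub>R e v) + (- \<i>) *C (\<Sum>v\<in>Basis. (j u \<bullet> v) *\<^sub>R e v)"
    by (simp only: sum.distrib csc_sum)
  also have "\<dots> = e u + (- \<i>) *C e (j u)"
    by (simp only: sum_basis_linear[OF linear_e])
  also have "\<dots> = 2 *C e u"
    by (rule cl_eqI) (simp add: e_j)
  finally show "(\<Sum>v\<in>Basis. herm u v *C e v) = 2 *C e u" .
  have "herm v u *C f v = (u \<bullet> v) *\<^sub>R f v + \<i> *C (j u \<bullet> v) *\<^sub>R f v" for v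
    by (rule cl_eqI) (simp add: herm_def inner_commute algebra_simps)
  then have "(\<Sum>v\<in>Basis. herm v u *C f v) =
      (\<Sum>v\<in>Basis. (u \<bullet> v) *\<^sub>R f v) + \<i> *C (\<Sum>v\<in>Basis. (j u \<bullet> v) *\<^sub>R f v)"
    by (simp only: sum.distrib csc_sum)
  also have "\<dots> = f u + \<i> *C f (j u)"
    by (simp only: sum_basis_linear[OF linear_f])
  also have "\<dots> = 2 *C f u"
    by (rule cl_eqI) (simp add: f_j)
  finally show "(\<Sum>v\<in>Basis. herm v u *C f v) = 2 *C f u" .
qed

lemma sum_herm_mult:
  "(\<Sum>v\<in>Basis. herm u v *C (x * e v * y)) = 2 *C (x * e u * y)"
  "(\<Sum>v\<in>Basis. herm v u *C (x * f v * y)) = 2 *C (x * f u * y)"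
proof -
  have "(\<Sum>v\<in>Basis. herm u v *C (x * e v * y)) = x * (\<Sum>v\<in>Basis. herm u v *C e v) * y"
    by (simp add: sum_distrib_left sum_distrib_right)
  then show "(\<Sum>v\<in>Basis. herm u v *C (x * e v * y)) = 2 *C (x * e u * y)"
    by (simp add: sum_herm)
  have "(\<Sum>v\<in>Basis. herm v u *C (x * f v * y)) = x * (\<Sum>v\<in>Basis. herm v u *C f v) * y"
    by (simp add: sum_distrib_left sum_distrib_right)
  then show "(\<Sum>v\<in>Basis. herm v u *C (x * f v * y)) = 2 *C (x * f u * y)"
    by (simp add: sum_herm)
qed

lemma LC_add: "LC j (x + y) = LC j x + LC j y" "LC_bar j (x + y) = LC_bar j x + LC_bar j y"
  by (simp_all add: LC_def LC_bar_def algebra_simps sum.distrib)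

lemma LC_csc: "LC j (a *C x) = a *C LC j x" "LC_bar j (a *C x) = a *C LC_bar j x"
  by (simp_all add: LC_def LC_bar_def csc_sum)

lemma LC_e_mult: "LC j (e u * y) = - (e u * LC j y)"
proof -
  have "e v * (e u * y) * f v = - (e u * (e v * y * f v))" for v
    by (simp add: mult.assoc[symmetric] anticommute(1)[of v u])
  then show ?thesis
    by (simp add: LC_def sum_negf sum_distrib_left)
qed

text \<open>Moving \<open>e u\<close> past \<open>f v\<close> leaves a scalar, and the sum over
  \<open>v\<close> turns these scalars into multiplication by \<open>e u\<close> from the right. The
  transposed operator in the third identity originates here.\<close>

lemma LC_bar_e_mult: "LC_bar j (e u * y) = y * e u - e u * LC_bar j y"
proof -
  have "f v * e u = - (e u * f v) - herm u v *C 1" for v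
    by (simp add: anticommute(3)[of u v])
  then have "f v * (e u * y) * e v = - (e u * (f v * y * e v)) - herm u v *C (y * e v * 1)" for v
    by (simp add: mult.assoc[symmetric] left_diff_distrib)
  then have "LC_bar j (e u * y) =
     - (1/2) *\<^sub>R (- (e u * (\<Sum>v\<in>Basis. f v * y * e v)) - (\<Sum>v\<in>Basis. herm u v *C (y * e v * 1)))"
    by (simp only: LC_bar_def sum_subtractf sum_negf sum_distrib_left)
  also have "\<dots> = y * e u - e u * LC_bar j y"
    unfolding sum_herm_mult LC_bar_def by (rule cl_eqI) (simp add: frm_sum algebra_simps)
  finally show ?thesis .
qed

lemma tr_LC: "tr (LC j x) = LC_bar j (tr x)" "tr (LC_bar j x) = LC j (tr x)"
proof -
  have "tr (e v) = e v" "tr (f v) = f v" for v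
    by (simp_all add: epsC_def epsC_bar_def)
  then show "tr (LC j x) = LC_bar j (tr x)" "tr (LC_bar j x) = LC j (tr x)"
    by (simp_all add: LC_def LC_bar_def tr_sum tr_mult mult.assoc)
qed

end

text \<open>The value of \<nabla>J at one point of the frame: \<open>A u\<close> is the derivative
  in direction \<open>u\<close>, and \<open>cyclic\<close> expresses d\<omega> = 0.\<close>

locale skew_torsion = complex_structure j for j :: "'e::euclidean_space \<Rightarrow> 'e" +
  fixes A :: "'e::euclidean_space \<Rightarrow> 'e \<Rightarrow> 'e"
  assumes linA: "linear (\<lambda>u. A u v)" "linear (A u)"
    and A_j: "A u (j v) = - j (A u v)" and skewA: "A u v \<bullet> w = - (v \<bullet> A u w)"
    and cyclic: "A u v \<bullet> w + A v w \<bullet> u + A w u \<bullet> v = 0"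
begin

definition T :: "'e \<Rightarrow> 'e \<Rightarrow> 'e \<Rightarrow> real" where
  "T b c d = A b c \<bullet> j d"

text \<open>Write S(u, v, w) for \<open>A u v \<bullet> w\<close>. The cyclic identities for (jb, c,
  d), (b, jc, d) and (b, c, jd) add up to twice the sum in question plus S(jb, c, d) + S(jc, d, b) +
  S(jd, b, c), and these extra terms vanish by the identity for (jb, jc, jd).\<close>

lemma T_cyclic: "T b c d + T c d b + T d b c = 0"
proof -
  have s: "A u (j v) \<bullet> w = A u v \<bullet> j w" for u v w
    by (simp add: A_j skew)
  have ss: "A u (j v) \<bullet> j w = - (A u v \<bullet> w)" for u v w
    by (simp add: s jj)
  show ?thesis
    using cyclic[of "j b" c d] cyclic[of b "j c" d] cyclic[of b c "j d"] cyclic[of "j b" "j c" "j d"]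
      ss[of "j b" c d] ss[of "j c" d b] ss[of "j d" b c]
    unfolding s T_def by (simp add: s ss)
qed

lemma T_skew: "T b d c = - T b c d"
  using skewA[of b d "j c"] skew[of d "A b c"] by (simp add: T_def A_j inner_commute)

lemma T_j2: "T b (j c) d = T b c (j d)"
  using skew[of "A b c" "j d"] by (simp add: T_def A_j jj)

text \<open>The cyclic identity with \<open>j b\<close> in the first slot is compared with
  \<open>T_cyclic\<close>. Together with \<open>T_j2\<close> this moves \<open>j\<close> freely
  among the slots, so the complex extension of \<open>T\<close> vanishes unless all three arguments
  have the same type.\<close>

lemma T_j1: "T (j b) c d = T b c (j d)"
proof -
  have s: "A u (j v) \<bullet> w = A u v \<bullet> j w" for u v w
    by (simp add: A_j skew)
  have "A (j b) c \<bullet> d = T b c d" for d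
    using cyclic[of "j b" c d] T_cyclic[of b c d] by (simp add: T_def s)
  then show ?thesis
    by (simp add: T_def[of "j b"])
qed

lemma bilinear_T: "linear (\<lambda>u. T u v w)" "linear (\<lambda>v. T u v w)" "linear (T u v)"
proof -
  show "linear (\<lambda>u. T u v w)" "linear (\<lambda>v. T u v w)"
    unfolding T_def
    using linear_compose[OF linA(1) bounded_linear.linear[OF bounded_linear_inner_left]]
      linear_compose[OF linA(2) bounded_linear.linear[OF bounded_linear_inner_left]]
    by (simp_all add: o_def)
  show "linear (T u v)"
    unfolding T_def
    using linear_compose[OF linj bounded_linear.linear[OF bounded_linear_inner_right]]
    by (simp add: o_def)
qed

section \<open>Contraction of the torsion with Clifford products\<close>

definition tsum :: "('e \<Rightarrow> 'e \<Rightarrow> 'e \<Rightarrow> 'e cl) \<Rightarrow> 'e cl" where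
  "tsum F = (\<Sum>b\<in>Basis. \<Sum>c\<in>Basis. \<Sum>d\<in>Basis. T b c d *\<^sub>R F b c d)"

lemma tsum_simps:
  "tsum (\<lambda>b c d. F b c d + F' b c d) = tsum F + tsum F'"
  "tsum (\<lambda>b c d. F b c d - F' b c d) = tsum F - tsum F'"
  "tsum (\<lambda>b c d. - F b c d) = - tsum F"
  "tsum (\<lambda>b c d. a *C F b c d) = a *C tsum F"
  "tsum (\<lambda>b c d. r *\<^sub>R F b c d) = r *\<^sub>R tsum F"
  by (simp_all add: scaleR_sum_right mult.commute tsum_def scaleR_add_right scaleR_diff_right sum.distrib sum_subtractf sum_negf csc_sum)

lemma tsum_mult: "tsum (\<lambda>b c d. x * F b c d) = x * tsum F" "tsum (\<lambda>b c d. F b c d * x) = tsum F * x"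
  by (simp_all add: tsum_def sum_distrib_left sum_distrib_right)

lemma tsum_sum: "tsum (\<lambda>b c d. \<Sum>v\<in>S. F v b c d) = (\<Sum>v\<in>S. tsum (F v))"
proof -
  have "tsum (\<lambda>b c d. 0) = 0"
    by (simp add: tsum_def)
  then show ?thesis
    by (induction S rule: infinite_finite_induct) (simp_all add: tsum_simps)
qed

lemma tsum_swap: "tsum (\<lambda>b c d. F b d c) = - tsum F"
proof -
  have "tsum (\<lambda>b c d. F b d c) = (\<Sum>b\<in>Basis. \<Sum>d\<in>Basis. \<Sum>c\<in>Basis. T b c d *\<^sub>R F b d c)"
    unfolding tsum_def by (rule sum.cong[OF refl], rule sum.swap)
  also have "\<dots> = - tsum F"
  proof -
    have "T b c d *\<^sub>R F b d c = - (T b d c *\<^sub>R F b d c)" for b c d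
      using T_skew[of b c d] by simp
    then show ?thesis
      by (simp only: tsum_def sum_negf)
  qed
  finally show ?thesis .
qed

lemma sum3_rotate:
  fixes F :: "'e \<Rightarrow> 'e \<Rightarrow> 'e \<Rightarrow> 'e cl"
  shows "(\<Sum>b\<in>Basis. \<Sum>c\<in>Basis. \<Sum>d\<in>Basis. F b c d) = (\<Sum>b\<in>Basis. \<Sum>c\<in>Basis. \<Sum>d\<in>Basis. F c d b)"
proof -
  have "(\<Sum>b\<in>Basis. \<Sum>c\<in>Basis. \<Sum>d\<in>Basis. F c d b) = (\<Sum>c\<in>Basis. \<Sum>b\<in>Basis. \<Sum>d\<in>Basis. F c d b)"
    by (rule sum.swap)
  also have "\<dots> = (\<Sum>c\<in>Basis. \<Sum>d\<in>Basis. \<Sum>b\<in>Basis. F c d b)"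
    by (rule sum.cong[OF refl], rule sum.swap)
  finally show ?thesis by simp
qed

lemma tsum_cyclic: "tsum F + tsum (\<lambda>b c d. F d b c) + tsum (\<lambda>b c d. F c d b) = 0"
proof -
  have 1: "tsum (\<lambda>b c d. F d b c) = (\<Sum>b\<in>Basis. \<Sum>c\<in>Basis. \<Sum>d\<in>Basis. T c d b *\<^sub>R F b c d)"
    unfolding tsum_def by (rule sum3_rotate)
  have 2: "(\<Sum>b\<in>Basis. \<Sum>c\<in>Basis. \<Sum>d\<in>Basis. T d b c *\<^sub>R F b c d) = tsum (\<lambda>b c d. F c d b)"
    unfolding tsum_def by (rule sum3_rotate)
  have "tsum F + tsum (\<lambda>b c d. F d b c) + tsum (\<lambda>b c d. F c d b) =
      (\<Sum>b\<in>Basis. \<Sum>c\<in>Basis. \<Sum>d\<in>Basis. (T b c d + T c d b + T d b c) *\<^sub>R F b c d)"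
    unfolding 1 2[symmetric] unfolding tsum_def by (simp only: scaleR_add_left sum.distrib)
  then show ?thesis
    by (simp add: T_cyclic)
qed

context
  fixes F :: "'e \<Rightarrow> 'e \<Rightarrow> 'e \<Rightarrow> 'e cl"
  assumes linF: "\<And>v w. linear (\<lambda>u. F u v w)" "\<And>u w. linear (\<lambda>v. F u v w)" "\<And>u v. linear (F u v)"
    and F_j: "\<And>u v w. F (j u) v w = (- \<i>) *C F u v w"
begin

lemma bilinear_TF:
  "bilinear (\<lambda>u v. T b v d *\<^sub>R F b u d)" "bilinear (\<lambda>u v. T b c v *\<^sub>R F b c u)" "bilinear (\<lambda>u v. T u c d *\<^sub>R F v c d)"
  using linF[THEN linear_add] linF[THEN linear_scale] bilinear_T[THEN linear_add] bilinear_T[THEN linear_scale]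
  by (simp_all add: bilinear_def linear_iff scaleR_add_left scaleR_add_right mult.commute)

lemma tsum_F_j1: "(\<Sum>b\<in>Basis. \<Sum>c\<in>Basis. \<Sum>d\<in>Basis. T (j b) c d *\<^sub>R F b c d) = \<i> *C tsum F"
proof -
  have "(\<Sum>b\<in>Basis. T (j b) c d *\<^sub>R F b c d) = \<i> *C (\<Sum>b\<in>Basis. T b c d *\<^sub>R F b c d)" for c d
    using sum_skew[OF bilinear_TF(3) skew, of c d] by (simp add: F_j csc_sum sum_negf)
  note eq = this
  have r: "(\<Sum>b\<in>Basis. \<Sum>c\<in>Basis. \<Sum>d\<in>Basis. G b c d) = (\<Sum>c\<in>Basis. \<Sum>d\<in>Basis. \<Sum>b\<in>Basis. G b c d)"
    for G :: "'e \<Rightarrow> 'e \<Rightarrow> 'e \<Rightarrow> 'e cl"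
    by (rule sum3_rotate[of "\<lambda>c d b. G b c d", symmetric])
  show ?thesis
    unfolding tsum_def by (subst (1 2) r) (simp only: eq csc_sum)
qed

text \<open>\<open>sum_skew\<close> moves \<open>j\<close> from \<open>F\<close> to the same slot of
  \<open>T\<close>, the symmetry of \<open>T\<close> moves it to the first slot, and
  \<open>sum_skew\<close> returns it to \<open>F\<close>, where it acts as the scalar -i. The two
  signs cancel.\<close>

lemma tsum_j2: "tsum (\<lambda>b c d. F b (j c) d) = (- \<i>) *C tsum F"
proof -
  have "tsum (\<lambda>b c d. F b (j c) d) = (\<Sum>b\<in>Basis. \<Sum>d\<in>Basis. \<Sum>c\<in>Basis. T b c d *\<^sub>R F b (j c) d)"
    unfolding tsum_def by (rule sum.cong[OF refl], rule sum.swap)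
  also have "\<dots> = (\<Sum>b\<in>Basis. \<Sum>d\<in>Basis. - (\<Sum>c\<in>Basis. T (j b) c d *\<^sub>R F b c d))"
    unfolding T_j1 T_j2[symmetric] using sum_skew[OF bilinear_TF(1) skew] by simp
  also have "\<dots> = - (\<Sum>b\<in>Basis. \<Sum>c\<in>Basis. \<Sum>d\<in>Basis. T (j b) c d *\<^sub>R F b c d)"
    unfolding sum_negf by (rule arg_cong[of _ _ uminus], rule sum.cong[OF refl], rule sum.swap)
  finally show ?thesis
    by (simp add: tsum_F_j1)
qed

lemma tsum_j3: "tsum (\<lambda>b c d. F b c (j d)) = (- \<i>) *C tsum F"
proof -
  have "tsum (\<lambda>b c d. F b c (j d)) = (\<Sum>b\<in>Basis. \<Sum>c\<in>Basis. - (\<Sum>d\<in>Basis. T (j b) c d *\<^sub>R F b c d))"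
    unfolding tsum_def T_j1 using sum_skew[OF bilinear_TF(2) skew] by simp
  then show ?thesis
    by (simp add: sum_negf tsum_F_j1)
qed

end

text \<open>
  The torsion lies in the \<open>(0,2)\<close>-part: against an antiholomorphic first factor only the
  antiholomorphic parts of the other two factors contribute.
\<close>

lemma tsum_antiholomorphic:
  fixes F :: "'e \<Rightarrow> 'e cl \<Rightarrow> 'e cl \<Rightarrow> 'e cl"
  assumes lin: "\<And>y z. linear (\<lambda>u. F u y z)"
    and add: "\<And>u y y' z. F u (y + y') z = F u y z + F u y' z" "\<And>u y z z'. F u y (z + z') = F u y z + F u y z'"
    and csc: "\<And>u a y z. F u (a *C y) z = a *C F u y z" "\<And>u a y z. F u y (a *C z) = a *C F u y z"
    and F_j: "\<And>u y z. F (j u) y z = (- \<i>) *C F u y z"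
  shows "tsum (\<lambda>b c d. F b (clv c) (clv d)) = tsum (\<lambda>b c d. F b (f c) (f d))"
proof -
  have sR: "F u (r *\<^sub>R y) z = r *\<^sub>R F u y z" "F u y (r *\<^sub>R z) = r *\<^sub>R F u y z" for u r y z
    by (simp_all only: scaleR_cl_def csc)
  have half: "F u (f v) z = (1/2) *C (F u (clv v) z + \<i> *C F u (clv (j v)) z)"
    "F u y (f v) = (1/2) *C (F u y (clv v) + \<i> *C F u y (clv (j v)))" for u v y z
    by (simp_all only: epsC_bar_def add csc)
  have l1: "linear (\<lambda>v. F u (p v) z)" "linear (\<lambda>v. F u y (p v))" if "linear p" for u y z and p :: "'e \<Rightarrow> 'e cl"
    using that by (auto intro!: linearI simp: linear_add linear_scale add sR)
  have fin: "(1/2) *C (x + \<i> *C (- \<i>) *C x) = x" for x :: "'e cl"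
    by (rule cl_eqI) simp
  \<comment> \<open>Of the two halves of \<open>f d\<close>, the one with \<open>j d\<close>
    contributes i times -i, that is 1, times the other one; so \<open>f d\<close> may be replaced by
    \<open>clv d\<close>, and then \<open>f c\<close> by \<open>clv c\<close> in the same
    way.\<close>
  have "tsum (\<lambda>b c d. F b (f c) (f d)) = (1/2) *C (tsum (\<lambda>b c d. F b (f c) (clv d)) + \<i> *C tsum (\<lambda>b c d. F b (f c) (clv (j d))))"
    by (subst half(2)) (simp only: tsum_simps)
  also have "tsum (\<lambda>b c d. F b (f c) (clv (j d))) = (- \<i>) *C tsum (\<lambda>b c d. F b (f c) (clv d))"
    by (rule tsum_j3[of "\<lambda>b c d. F b (f c) (clv d)"]) (intro lin l1 linear_clv linear_f F_j)+
  also have "tsum (\<lambda>b c d. F b (f c) (clv d)) = (1/2) *C (tsum (\<lambda>b c d. F b (clv c) (clv d)) + \<i> *C tsum (\<lambda>b c d. F b (clv (j c)) (clv d)))"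
    by (subst half(1)) (simp only: tsum_simps)
  also have "tsum (\<lambda>b c d. F b (clv (j c)) (clv d)) = (- \<i>) *C tsum (\<lambda>b c d. F b (clv c) (clv d))"
    by (rule tsum_j2[of "\<lambda>b c d. F b (clv c) (clv d)"]) (intro lin l1 linear_clv linear_f F_j)+
  finally show ?thesis
    by (simp only: fin)
qed

definition a :: "'e \<Rightarrow> 'e \<Rightarrow> 'e" where "a u v = - j (A u v)"

lemma a_T: "a b c \<bullet> d = T b c d"
  by (simp add: a_def T_def skew)

definition B :: "'e cl \<Rightarrow> 'e cl" where
  "B x = (\<Sum>b\<in>Basis. f b * comm (spn (a b)) x)"

lemma fff_rotate: "f b * (f c * f d) = f c * (f d * f b)"
proof -
  have "f b * (f c * f d) = - (f c * (f b * f d))"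
    by (simp add: mult.assoc[symmetric] anticommute(2)[of b c])
  also have "\<dots> = f c * (f d * f b)"
    by (simp add: anticommute(2)[of b d])
  finally show ?thesis .
qed

text \<open>A cyclic permutation of three anticommuting factors is even, so all three sums in
  \<open>tsum_cyclic\<close> are equal and three times the sum is zero.\<close>

lemma tsum_fff: "tsum (\<lambda>b c d. f b * (f c * f d)) = 0"
proof -
  let ?S = "tsum (\<lambda>b c d. f b * (f c * f d))"
  have "tsum (\<lambda>b c d. f d * (f b * f c)) = ?S"
    by (rule arg_cong[of _ _ tsum]) (intro ext fff_rotate)
  moreover have "tsum (\<lambda>b c d. f c * (f d * f b)) = ?S"
    by (rule arg_cong[of _ _ tsum]) (intro ext fff_rotate[symmetric])
  moreover have "?S + tsum (\<lambda>b c d. f d * (f b * f c)) + tsum (\<lambda>b c d. f c * (f d * f b)) = 0"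
    by (rule tsum_cyclic)
  ultimately have "?S + ?S + ?S = 0"
    by simp
  moreover have "x = 0" if "x + x + x = 0" for x :: "'e cl"
  proof -
    have "3 *\<^sub>R x = 0"
      using that scaleR_add_left[of 2 1 x] by (simp add: scaleR_2)
    then show ?thesis by simp
  qed
  ultimately show ?thesis by blast
qed

text \<open>The commutator splits into a left and a right multiplication. In both, the two vectors
  of \<open>spn\<close> may be replaced by their antiholomorphic parts, whereupon the left
  multiplication vanishes by \<open>tsum_fff\<close>.\<close>

lemma B_eq: "B x = - (1/4) *\<^sub>R tsum (\<lambda>b c d. f b * x * (f c * f d))"
proof -
  have "(\<Sum>c\<in>Basis. clv c * clv (a b c)) = (\<Sum>c\<in>Basis. \<Sum>d\<in>Basis. T b c d *\<^sub>R (clv c * clv d))" for b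
  proof -
    have "clv (a b c) = (\<Sum>d\<in>Basis. T b c d *\<^sub>R clv d)" for c
      using sum_basis_linear[OF linear_clv, of "a b c"] by (simp add: a_T)
    then show ?thesis
      by (simp add: sum_distrib_left)
  qed
  then have "B x = (1/4) *\<^sub>R (\<Sum>b\<in>Basis. \<Sum>c\<in>Basis. \<Sum>d\<in>Basis. T b c d *\<^sub>R (f b * comm (clv c * clv d) x))"
    by (simp add: B_def spn_def comm_cl_simps comm_sum_left sum_distrib_left scaleR_sum_right)
  also have "\<dots> = (1/4) *\<^sub>R (tsum (\<lambda>b c d. f b * (clv c * clv d) * x) - tsum (\<lambda>b c d. f b * x * (clv c * clv d)))"
    by (simp only: tsum_simps(2)[symmetric]) (simp add: tsum_def comm_def right_diff_distrib mult.assoc)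
  also have "tsum (\<lambda>b c d. f b * (clv c * clv d) * x) = tsum (\<lambda>b c d. f b * (f c * f d) * x)"
    by (rule tsum_antiholomorphic[of "\<lambda>b y z. f b * (y * z) * x"])
      (auto simp: linear_iff linear_add[OF linear_f] linear_scale[OF linear_f] f_j algebra_simps)
  also have "\<dots> = 0"
    by (simp only: tsum_mult tsum_fff mult_zero_left)
  also have "tsum (\<lambda>b c d. f b * x * (clv c * clv d)) = tsum (\<lambda>b c d. f b * x * (f c * f d))"
    by (rule tsum_antiholomorphic[of "\<lambda>b y z. f b * x * (y * z)"])
      (auto simp: linear_iff linear_add[OF linear_f] linear_scale[OF linear_f] f_j algebra_simps)
  finally show ?thesis by simp
qed

text \<open>The factor \<open>f v\<close> commutes with \<open>f c * f d\<close>, so only moving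
  \<open>e v\<close> past \<open>f b\<close> leaves something: a scalar which, summed over
  \<open>v\<close>, puts \<open>f b\<close> beside the other two factors, where
  \<open>tsum_fff\<close> applies.\<close>

lemma B_LC: "B (LC j x) + LC j (B x) = 0"
proof -
  have ff: "f c * f d * f v = f v * (f c * f d)" for c d v
    by (simp only: mult.assoc fff_rotate[of v c d])
  have *: "f b * (e v * x * f v) * (f c * f d) + e v * (f b * x * (f c * f d)) * f v =
      - (herm v b *C (x * f v * (f c * f d)))" for b c d v
  proof -
    have "e v * (f b * x * (f c * f d)) * f v = e v * f b * x * (f c * f d * f v)"
      by (simp add: mult.assoc)
    also have "\<dots> = - (f b * e v * x * (f v * (f c * f d))) - herm v b *C (x * (f v * (f c * f d)))"
      unfolding ff anticommute(3)[of v b] by (simp add: left_diff_distrib)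
    finally show ?thesis
      by (simp add: mult.assoc)
  qed
  have "B (LC j x) + LC j (B x) = (1/8) *\<^sub>R (tsum (\<lambda>b c d. \<Sum>v\<in>Basis.
      f b * (e v * x * f v) * (f c * f d) + e v * (f b * x * (f c * f d)) * f v))"
    unfolding B_eq LC_def
    by (simp add: tsum_simps tsum_sum tsum_mult sum.distrib sum_distrib_left sum_distrib_right scaleR_add_right
        sum_negf scaleR_sum_right[symmetric])
  also have "\<dots> = (1/8) *\<^sub>R tsum (\<lambda>b c d. - (2 *C (x * f b * (f c * f d))))"
    unfolding * sum_negf sum_herm_mult ..
  also have "\<dots> = 0"
    using tsum_fff by (simp add: tsum_simps mult.assoc tsum_mult)
  finally show ?thesis .
qed

text \<open>Now \<open>f v\<close> and \<open>f b\<close> anticommute and the remainder comes from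
  the commutator of \<open>e v\<close> with \<open>f c * f d\<close>. It leaves two antiholomorphic
  factors on the left and one on the right of \<open>x\<close>, which is also the shape of the
  transposed \<open>B\<close>; the two sums differ in how the indices of \<open>T\<close> are
  distributed.\<close>

lemma B_LC_bar: "B (LC_bar j x) + LC_bar j (B x) = tr (B (tr x))"
proof -
  have ef: "e v * f c = - (f c * e v) - herm v c *C 1" for v c
    by (rule anticommute)
  have comm: "e v * (f c * f d) - f c * f d * e v = herm v d *C f c - herm v c *C f d" for v c d
  proof -
    have "e v * (f c * f d) = - (f c * (e v * f d)) - herm v c *C f d"
      by (simp add: mult.assoc[symmetric] ef[of v c] left_diff_distrib)
    then show ?thesis
      by (simp add: ef[of v d] right_diff_distrib mult.assoc)
  qed
  have *: "f b * (f v * x * e v) * (f c * f d) + f v * (f b * x * (f c * f d)) * e v =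
      herm v d *C (f b * f v * (x * f c)) - herm v c *C (f b * f v * (x * f d))" for b c d v
  proof -
    have "f b * (f v * x * e v) * (f c * f d) + f v * (f b * x * (f c * f d)) * e v =
        f b * f v * x * (e v * (f c * f d) - f c * f d * e v)"
      using anticommute(2)[of v b] by (simp add: right_diff_distrib mult.assoc[symmetric])
    also have "\<dots> = herm v d *C (f b * f v * (x * f c)) - herm v c *C (f b * f v * (x * f d))"
      unfolding comm by (simp add: right_diff_distrib mult.assoc)
    finally show ?thesis .
  qed
  let ?U = "tsum (\<lambda>b c d. f b * f c * (x * f d))" and ?W = "tsum (\<lambda>b c d. f c * f d * (x * f b))"
  have "B (LC_bar j x) + LC_bar j (B x) = (1/8) *\<^sub>R (tsum (\<lambda>b c d. \<Sum>v\<in>Basis.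
      f b * (f v * x * e v) * (f c * f d) + f v * (f b * x * (f c * f d)) * e v))"
    unfolding B_eq LC_bar_def
    by (simp add: tsum_simps tsum_sum tsum_mult sum.distrib sum_distrib_left sum_distrib_right scaleR_add_right
        sum_negf scaleR_sum_right[symmetric])
  also have "\<dots> = (1/8) *\<^sub>R tsum (\<lambda>b c d. 2 *C (f b * f d * (x * f c)) - 2 *C (f b * f c * (x * f d)))"
    unfolding * sum_subtractf sum_herm_mult ..
  also have "\<dots> = (1/4) *\<^sub>R (tsum (\<lambda>b c d. f b * f d * (x * f c)) - ?U)"
    unfolding tsum_simps by (rule cl_eqI) simp
  also have "tsum (\<lambda>b c d. f b * f d * (x * f c)) = - ?U"
    by (rule tsum_swap[of "\<lambda>b c d. f b * f c * (x * f d)"])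
  finally have 1: "B (LC_bar j x) + LC_bar j (B x) = - (1/2) *\<^sub>R ?U"
    by (intro cl_eqI) simp
  have "tsum (\<lambda>b c d. f d * f b * (x * f c)) = - tsum (\<lambda>b c d. f c * f b * (x * f d))"
    by (rule tsum_swap[of "\<lambda>b c d. f c * f b * (x * f d)"])
  also have "\<dots> = ?U"
  proof -
    have "f c * f b * (x * f d) = - (f b * f c * (x * f d))" for b c d
      using anticommute(2)[of c b] by simp
    then have "tsum (\<lambda>b c d. f c * f b * (x * f d)) = tsum (\<lambda>b c d. - (f b * f c * (x * f d)))"
      by (intro arg_cong[of _ _ tsum] ext)
    then show ?thesis
      by (simp only: tsum_simps(3) minus_minus)
  qed
  \<comment> \<open>Of the three terms in the cyclic identity two agree: exchanging the last two
    indices of \<open>T\<close> and exchanging the two left factors each give a sign. This fixes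
    \<open>?W\<close> as -2 times \<open>?U\<close>, which matches the coefficients -1/2 and 1/4 of
    the two sides.\<close>
  finally have "?U + ?U + ?W = 0"
    using tsum_cyclic[of "\<lambda>b c d. f b * f c * (x * f d)"] by simp
  then have "?W = - (?U + ?U)"
    by (metis add.commute eq_neg_iff_add_eq_0)
  then have 2: "?W = - 2 *\<^sub>R ?U"
    by (simp only: scaleR_minus_left scaleR_2)
  have trs: "tr (tsum F) = tsum (\<lambda>b c d. tr (F b c d))" for F
    by (simp add: tsum_def tr_sum)
  have "tr (f v) = f v" for v
    by (simp add: epsC_bar_def)
  then have "tr (f b * tr x * (f c * f d)) = - (f c * f d * (x * f b))" for b c d
    using anticommute(2)[of d c] by (simp add: tr_mult mult.assoc[symmetric])
  then have "tr (B (tr x)) = (1/4) *\<^sub>R ?W"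
    by (simp add: B_eq trs tsum_simps)
  then show ?thesis
    unfolding 1 2 by simp
qed

end

section \<open>The operators in an orthonormal frame\<close>

lemma epsC_minus: "epsC (\<lambda>v. - r v) = epsC_bar r" "epsC_bar (\<lambda>v. - r v) = epsC r"
  by (simp_all add: fun_eq_iff epsC_def epsC_bar_def)

lemma LC_minus: "LC (\<lambda>v. - r v) = LC_bar r" "LC_bar (\<lambda>v. - r v) = LC r"
  by (simp_all add: fun_eq_iff LC_def LC_bar_def epsC_minus)

text \<open>\<open>sum_skew\<close> merges the four products so that \<open>j\<close> remains only
  in the right factor, which makes the operator easier to differentiate when \<open>j\<close>
  varies.\<close>

lemma (in complex_structure) LC_expand:
  "LC j x = (- 1/4) *C (\<Sum>b\<in>Basis. clv b * x * (clv b + \<i> *C clv (j b)))"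
proof -
  have l: "linear (\<lambda>v. clv (j v))"
    using linear_compose[OF linj linear_clv] by (simp add: o_def)
  have 1: "(\<Sum>b\<in>Basis. clv (j b) * x * clv b) = - (\<Sum>b\<in>Basis. clv b * x * clv (j b))"
    by (rule sum_skew[OF bilinear_mult_linear[OF linear_clv linear_clv] skew])
  have 2: "(\<Sum>b\<in>Basis. clv (j b) * x * clv (j b)) = (\<Sum>b\<in>Basis. clv b * x * clv b)"
    using sum_skew[OF bilinear_mult_linear[OF linear_clv l] skew, of x] by (simp add: jj sum_negf)
  have "(\<Sum>b\<in>Basis. e b * x * f b) = (1/4) *C ((\<Sum>b\<in>Basis. clv b * x * clv b) + (\<Sum>b\<in>Basis. clv (j b) * x * clv (j b))
      + \<i> *C (\<Sum>b\<in>Basis. clv b * x * clv (j b)) - \<i> *C (\<Sum>b\<in>Basis. clv (j b) * x * clv b))"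
    unfolding csc_sum sum.distrib[symmetric] sum_subtractf[symmetric]
    by (intro sum.cong refl) (simp add: epsC_def epsC_bar_def algebra_simps)
  also have "\<dots> = (1/2) *C (\<Sum>b\<in>Basis. clv b * x * (clv b + \<i> *C clv (j b)))"
    unfolding 1 2 distrib_left sum.distrib by (rule cl_eqI) (simp add: frm_sum sum_distrib_left algebra_simps)
  finally show ?thesis
    unfolding LC_def by (intro cl_eqI) simp
qed

text \<open>Reversal puts \<open>z b\<close> in front of \<open>b\<close>, and moving the skew map
  back costs a sign. This sign and the one from reversing a commutator cancel, so the connection
  commutes with transposition.\<close>

lemma tr_spn:
  assumes "linear z" "\<And>u v. z u \<bullet> v = - (u \<bullet> z v)"
  shows "tr (spn z) = - spn z"
proof -
  have "tr (spn z) = (1/4) *\<^sub>R (\<Sum>b\<in>Basis. clv (z b) * clv b)"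
    by (simp add: spn_def tr_sum tr_mult)
  also have "bilinear (\<lambda>u v. clv u * clv v :: 'a cl)"
    using bilinear_mult_linear[OF linear_clv linear_clv, of 1] by simp
  from sum_skew[OF this assms(2)] have "(\<Sum>b\<in>Basis. clv (z b) * clv b) = - (\<Sum>b\<in>Basis. clv b * clv (z b))" .
  finally show ?thesis
    by (simp add: spn_def)
qed

locale almost_complex_frame = metric_frame V g P Q
  for V :: "'e::euclidean_space set" and g P Q +
  fixes j :: "'e \<Rightarrow> 'e \<Rightarrow> 'e"
  assumes cs: "\<And>x. x \<in> V \<Longrightarrow> complex_structure (j x)" and smj: "\<And>v. smooth_on V (\<lambda>x. j x v)"
begin

text \<open>\<nabla>J in the frame: the derivative of \<open>j\<close> plus its commutator with the
  connection form.\<close>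

definition A :: "'e \<Rightarrow> 'e \<Rightarrow> 'e \<Rightarrow> 'e" where
  "A x u v = pd (\<lambda>y. j y v) x (P x u) + conn x (P x u) (j x v) - j x (conn x (P x u) v)"

definition tors :: "'e \<Rightarrow> 'e \<Rightarrow> 'e \<Rightarrow> 'e" where
  "tors x u v = - j x (A x u v)"

text \<open>The frame version of \<open>D_op\<close>, as \<open>DD_eq_dirC\<close> shows. The extra
  commutator is the effect of conjugating \<nabla> by the automorphism, and the minus sign appears
  because the inverse automorphism takes \<open>clv b\<close> to
  \<open>- clv (j x b)\<close>.\<close>

definition DD :: "('e \<Rightarrow> 'e cl) \<Rightarrow> 'e \<Rightarrow> 'e cl" where
  "DD \<Phi> x = (1/2) *C (\<Sum>b\<in>Basis. clv b * der x (P x b) \<Phi> -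
     \<i> *C (clv (j x b) * (der x (P x b) \<Phi> + comm (spn (tors x b)) (\<Phi> x))))"

lemma almost_complex_frame_minus: "almost_complex_frame V g P Q (\<lambda>x v. - j x v)"
proof (intro almost_complex_frame.intro almost_complex_frame_axioms.intro metric_frame_axioms)
  show "complex_structure (\<lambda>v. - j x v)" if "x \<in> V" for x
  proof -
    interpret complex_structure "j x" by (rule cs[OF that])
    show ?thesis
      by (rule complex_structure.intro) (simp_all add: linear_compose_neg linj linear_neg[OF linj] jj orth)
  qed
qed (intro smooth_on_minus V smj)

lemma dj: "x \<in> V \<Longrightarrow> (\<lambda>y. j y v) differentiable (at x)"
  using smj smooth_on_differentiable by blast

lemma linj: "x \<in> V \<Longrightarrow> linear (j x)"
  using cs complex_structure.linj by blast

lemma smooth_LC: "smooth_on V \<Phi> \<Longrightarrow> smooth_on V (\<lambda>x. LC (j x) (\<Phi> x))"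
  unfolding LC_def epsC_def epsC_bar_def
  by (intro smooth_on_scaleR smooth_on_sum smooth_on_cl_mult smooth_on_csc smooth_on_add smooth_on_diff
      smooth_on_clv smj smooth_on_const V)

lemma smooth_pull:
  assumes "smooth_on V \<Phi>"
  shows "smooth_on V (\<lambda>x. pull (j x) (\<Phi> x))"
proof (rule smooth_on_clI[OF V])
  have "smooth_form_on V (\<lambda>x. frm (\<Phi> x))"
    using smooth_on_bounded_linear[OF V bounded_linear_frm assms] by (simp add: smooth_form_on_def)
  then have "smooth_on V (\<lambda>x. frm (\<Phi> x) (map (j x) ws))" for ws
    by (rule smooth_on_form_map[OF V _ smj])
  then show "smooth_on V (\<lambda>x. frm (pull (j x) (\<Phi> x)) ws)" for ws
    by (rule smooth_on_cong[OF V]) (simp add: frm_pull[OF linj])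
qed

context
  fixes x assumes x: "x \<in> V"
begin

interpretation complex_structure "j x" by (rule cs[OF x])

lemma linear_pd_j: "linear (\<lambda>v. pd (\<lambda>y. j y v) x u)"
  by (rule linear_pd_family[OF V x almost_complex_frame.linj[OF almost_complex_frame_axioms] smj])

lemma linear_A: "linear (\<lambda>u. A x u v)" "linear (A x u)"
proof -
  note l = linear_add[OF linj] linear_scale[OF linj]
    linear_add[OF linear_pd_j] linear_scale[OF linear_pd_j] linear_add[OF linP[OF x]] linear_scale[OF linP[OF x]]
    linear_add[OF linear_frechet_derivative[OF dj[OF x]]] linear_scale[OF linear_frechet_derivative[OF dj[OF x]]]
    linear_conn[OF x, THEN linear_add] linear_conn[OF x, THEN linear_scale]
  show "linear (\<lambda>u. A x u v)" "linear (A x u)"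
    by (auto intro!: linearI simp: A_def l scaleR_add_right scaleR_diff_right)
qed

text \<open>The derivative of the relation \<open>j y (j y v) = - v\<close>, corrected by the
  connection form.\<close>

lemma A_j: "A x u (j x v) = - j x (A x u v)"
proof -
  have "pd (\<lambda>y. j y (j y v)) x (P x u) = pd (\<lambda>y. - v) x (P x u)"
    by (rule pd_cong[OF V x complex_structure.jj[OF cs]]) auto
  moreover have "pd (\<lambda>y. j y (j y v)) x (P x u) = pd (\<lambda>y. j y (j x v)) x (P x u) + j x (pd (\<lambda>y. j y v) x (P x u))"
    by (rule pd_linear_family[OF V x almost_complex_frame.linj[OF almost_complex_frame_axioms] smj smj])
  ultimately have "pd (\<lambda>y. j y (j x v)) x (P x u) = - j x (pd (\<lambda>y. j y v) x (P x u))"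
    by (simp add: eq_neg_iff_add_eq_0)
  then show ?thesis
    by (simp add: A_def jj linear_add[OF linj] linear_diff[OF linj] linear_neg[OF linear_conn(1)[OF x]])
qed

text \<open>The derivative of the skewness of \<open>j\<close>. The connection terms match in pairs
  because \<open>conn\<close> and \<open>j\<close> are both skew for the constant inner
  product.\<close>

lemma skew_A: "A x u v \<bullet> w = - (v \<bullet> A x u w)"
proof -
  have d: "(\<lambda>y. j y a \<bullet> b) differentiable (at x)" for a b
    by (rule differentiable_bounded_linear[OF bounded_linear_inner_left dj[OF x]])
  have "pd (\<lambda>y. j y v \<bullet> w) x (P x u) = pd (\<lambda>y. - (j y w \<bullet> v)) x (P x u)"
  proof (rule pd_cong[OF V x])
    show "j y v \<bullet> w = - (j y w \<bullet> v)" if "y \<in> V" for y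
      using complex_structure.skew[OF cs[OF that], of v w] by (simp only: inner_commute[of v])
    show "(\<lambda>y. - (j y w \<bullet> v)) differentiable (at x)"
      by (intro differentiable_minus d)
  qed
  also have "\<dots> = - pd (\<lambda>y. j y w \<bullet> v) x (P x u)"
    by (rule pd_bounded_linear[OF bounded_linear_minus[OF bounded_linear_ident] d])
  finally have "pd (\<lambda>y. j y v) x (P x u) \<bullet> w = - (pd (\<lambda>y. j y w) x (P x u) \<bullet> v)"
    by (simp add: pd_bounded_linear[OF bounded_linear_inner_left dj[OF x]])
  moreover have "conn x (P x u) (j x v) \<bullet> w = v \<bullet> j x (conn x (P x u) w)"
    using conn_skew[OF x, of "P x u" "j x v" w] skew[of v "conn x (P x u) w"] by simp
  moreover have "j x (conn x (P x u) v) \<bullet> w = v \<bullet> conn x (P x u) (j x w)"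
    using conn_skew[OF x, of "P x u" v "j x w"] skew[of "conn x (P x u) v" w] by simp
  moreover have "A x u v \<bullet> w =
      pd (\<lambda>y. j y v) x (P x u) \<bullet> w + conn x (P x u) (j x v) \<bullet> w - j x (conn x (P x u) v) \<bullet> w"
    by (simp only: A_def inner_diff_left inner_add_left)
  moreover have "v \<bullet> A x u w =
      pd (\<lambda>y. j y w) x (P x u) \<bullet> v + v \<bullet> conn x (P x u) (j x w) - v \<bullet> j x (conn x (P x u) w)"
    by (simp only: A_def inner_diff_right inner_add_right inner_commute[of v "pd _ _ _"])
  ultimately show ?thesis
    by linarith
qed

lemma linear_tors: "linear (tors x u)"
  using linear_compose_neg[OF linear_compose[OF linear_A(2) linj]] by (simp add: tors_def[abs_def] o_def)

lemma skew_tors: "tors x u v \<bullet> w = - (v \<bullet> tors x u w)"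
  using skew_A[of u v "j x w"] by (simp add: tors_def skew A_j)

text \<open>The connection \<open>\<nabla> - J(\<nabla>J)/2\<close>, which preserves both \<open>g\<close> and \<open>J\<close>.\<close>

definition hder :: "'e \<Rightarrow> ('e \<Rightarrow> 'e cl) \<Rightarrow> 'e cl" where
  "hder u \<Phi> = der x (P x u) \<Phi> + (1/2) *\<^sub>R comm (spn (tors x u)) (\<Phi> x)"

definition hconn :: "'e \<Rightarrow> 'e \<Rightarrow> 'e" where
  "hconn u v = conn x (P x u) v + (1/2) *\<^sub>R tors x u v"

lemma skew_hconn: "hconn u v \<bullet> w = - (v \<bullet> hconn u w)"
  using skew_tors[of u v w] conn_skew[OF x, of "P x u" v w]
  by (simp add: hconn_def inner_add_left inner_add_right)

text \<open>\<open>tors\<close> composed with \<open>j\<close> is -A in one order and A in the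
  other, so the commutator of half of \<open>tors\<close> with \<open>j\<close> is -A and cancels
  \<nabla>J exactly.\<close>

lemma hconn_j: "pd (\<lambda>y. j y v) x (P x u) + hconn u (j x v) = j x (hconn u v)"
proof -
  have "tors x u (j x v) = - A x u v" "j x (tors x u v) = A x u v"
    by (simp_all add: tors_def A_j jj linear_neg[OF linj])
  then show ?thesis
    by (simp add: hconn_def linear_add[OF linj] linear_scale[OF linj]) (simp add: A_def algebra_simps flip: scaleR_2)
qed

lemma hder_cong: "smooth_on V \<Psi> \<Longrightarrow> (\<And>y. y \<in> V \<Longrightarrow> \<Phi> y = \<Psi> y) \<Longrightarrow> hder u \<Phi> = hder u \<Psi>"
  using der_cong[OF x, of \<Psi> \<Phi>] x by (simp add: hder_def)

lemma hder_simps: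
  assumes "smooth_on V \<Phi>" "smooth_on V \<Psi>"
  shows "hder u (\<lambda>y. \<Phi> y + \<Psi> y) = hder u \<Phi> + hder u \<Psi>"
    "hder u (\<lambda>y. s *C \<Phi> y) = s *C hder u \<Phi>"
    "hder u (\<lambda>y. \<Phi> y * \<Psi> y) = hder u \<Phi> * \<Psi> x + \<Phi> x * hder u \<Psi>"
  using assms der_csc[OF x smooth_on_const assms(1), of "P x u" s]
  by (simp_all add: hder_def der_add[OF x] der_mult[OF x] comm_simps comm_cl_simps comm_mult algebra_simps)

lemma hder_sum:
  assumes "\<And>i. i \<in> S \<Longrightarrow> smooth_on V (F i)"
  shows "hder u (\<lambda>y. \<Sum>i\<in>S. F i y) = (\<Sum>i\<in>S. hder u (F i))"
  using assms
proof (induction S rule: infinite_finite_induct)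
  case (insert i S)
  then show ?case
    using hder_simps(1)[of "F i" "\<lambda>y. \<Sum>i\<in>S. F i y" u] by (simp add: smooth_on_sum[OF V])
qed (simp_all add: hder_def der_def comm_cl_simps)

lemma hder_clv: "smooth_on V Z \<Longrightarrow> hder u (\<lambda>y. clv (Z y)) = clv (pd Z x (P x u) + hconn u (Z x))"
  by (simp add: hder_def der_clv[OF x] hconn_def comm_spn[OF linear_tors skew_tors])

text \<open>As \<open>j\<close> is parallel, the derivatives of \<open>clv b\<close> and of the
  right factor are both given by \<open>hconn u b\<close>, and they cancel in the sum over the basis
  because \<open>hconn u\<close> is skew.\<close>

lemma hder_LC:
  assumes \<Phi>: "smooth_on V \<Phi>"
  shows "hder u (\<lambda>y. LC (j y) (\<Phi> y)) = LC (j x) (hder u \<Phi>)"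
proof -
  define W where "W = (\<lambda>b y. clv b + \<i> *C clv (j y b))"
  have sj: "smooth_on V (\<lambda>y. \<i> *C clv (j y b))" for b
    by (intro smooth_on_csc smooth_on_clv smj smooth_on_const V)
  have sW: "smooth_on V (W b)" for b
    unfolding W_def by (intro smooth_on_add smooth_on_const V sj)
  have s1: "smooth_on V (\<lambda>y. clv b * \<Phi> y)" for b
    by (intro smooth_on_cl_mult smooth_on_const V \<Phi>)
  have s2: "smooth_on V (\<lambda>y. clv b * \<Phi> y * W b y)" for b
    by (rule smooth_on_cl_mult[OF V s1 sW])
  have hW: "hder u (W b) = clv (hconn u b) + \<i> *C clv (j x (hconn u b))" for b
    unfolding W_def
    by (simp add: hder_simps(1)[OF smooth_on_const sj] hder_simps(2)[OF smooth_on_clv[OF V smj] smooth_on_const]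
        hder_clv[OF smj] hder_clv[OF smooth_on_const] hconn_j del: clv_simps)
  have bil: "bilinear (\<lambda>u v. clv u * \<Phi> x * (clv v + \<i> *C clv (j x v)))"
    by (rule bilinear_mult_linear[OF linear_clv])
      (auto intro!: linearI simp: linear_add[OF linj] linear_scale[OF linj] algebra_simps)
  have "hder u (\<lambda>y. LC (j y) (\<Phi> y)) = hder u (\<lambda>y. (- 1/4) *C (\<Sum>b\<in>Basis. clv b * \<Phi> y * W b y))"
  proof (rule hder_cong)
    show "smooth_on V (\<lambda>y. (- 1/4) *C (\<Sum>b\<in>Basis. clv b * \<Phi> y * W b y))"
      by (intro smooth_on_csc smooth_on_sum smooth_on_const V s2)
  qed (simp only: W_def complex_structure.LC_expand[OF cs])
  also have "\<dots> = (- 1/4) *C (\<Sum>b\<in>Basis. hder u (\<lambda>y. clv b * \<Phi> y * W b y))"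
    by (simp only: hder_simps(2)[OF smooth_on_sum[OF V s2] smooth_on_const] hder_sum[OF s2])
  also have "(\<Sum>b\<in>Basis. hder u (\<lambda>y. clv b * \<Phi> y * W b y)) =
      (\<Sum>b\<in>Basis. clv b * hder u \<Phi> * W b x + (clv (hconn u b) * \<Phi> x * (clv b + \<i> *C clv (j x b)) +
      clv b * \<Phi> x * (clv (hconn u b) + \<i> *C clv (j x (hconn u b)))))"
  proof (rule sum.cong[OF refl])
    fix b
    have "hder u (\<lambda>y. clv b) = clv (hconn u b)"
      using hder_clv[OF smooth_on_const, of u b] by simp
    then show "hder u (\<lambda>y. clv b * \<Phi> y * W b y) =
      clv b * hder u \<Phi> * W b x + (clv (hconn u b) * \<Phi> x * (clv b + \<i> *C clv (j x b)) +
      clv b * \<Phi> x * (clv (hconn u b) + \<i> *C clv (j x (hconn u b))))"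
      unfolding hder_simps(3)[OF s1 sW] hder_simps(3)[OF smooth_on_const \<Phi>] hW
      by (simp only: W_def distrib_right add.assoc add.left_commute add.commute)
  qed
  also have "\<dots> = (\<Sum>b\<in>Basis. clv b * hder u \<Phi> * W b x)"
    unfolding sum.distrib sum_skew[OF bil skew_hconn] by simp
  finally show ?thesis
    by (simp add: LC_expand W_def)
qed

lemma hder_tr:
  assumes \<Phi>: "smooth_on V \<Phi>"
  shows "tr (hder u (\<lambda>y. tr (\<Phi> y))) = hder u \<Phi>"
proof -
  have "tr (comm (spn z) (tr (\<Phi> x))) = comm (spn z) (\<Phi> x)" if "linear z" "\<And>u v. z u \<bullet> v = - (u \<bullet> z v)" for z
    using tr_spn[OF that] by (simp add: comm_def tr_mult)
  then show ?thesis
    using pd_bounded_linear[OF bounded_linear_tr smooth_on_differentiable[OF \<Phi> x], of "P x u"]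
      linear_conn(1)[OF x] conn_skew[OF x] linear_tors skew_tors
    by (simp add: hder_def der_def)
qed

text \<open>Both sides are derivations over the same point and direction, so by
  \<open>cl_derivation_eqI\<close> they need only be compared on constant vectors. There the left
  side is the conjugate by \<open>j\<close> of the connection on vectors, which is
  \<open>conn\<close> plus \<open>tors\<close>.\<close>

lemma pull_der:
  assumes \<Phi>: "smooth_on V \<Phi>"
  shows "pull (j x) (der x (P x u) (\<lambda>y. pull (\<lambda>v. - j y v) (\<Phi> y))) = der x (P x u) \<Phi> + comm (spn (tors x u)) (\<Phi> x)"
proof -
  interpret neg: almost_complex_frame V g P Q "\<lambda>x v. - j x v" by (rule almost_complex_frame_minus)
  let ?p = "\<lambda>\<Phi> y. pull (\<lambda>v. - j y v) (\<Phi> y)"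
  have on: "\<And>u v. j x u \<bullet> j x v = u \<bullet> v"
    by (rule orth)
  have inv: "pull (j x) (?p \<Psi> x) = \<Psi> x" for \<Psi>
    by (rule cl_eqI) (simp add: frm_pull[OF linj] frm_pull[OF neg.linj[OF x]] o_def jj)
  note ps = pull_simps[OF neg.linj]
  have E: "cl_derivation V x (P x u) (\<lambda>\<Phi>. pull (j x) (der x (P x u) (?p \<Phi>)))"
    unfolding cl_derivation_def
  proof (intro conjI allI impI)
    fix \<Phi> \<Psi> :: "'e \<Rightarrow> 'e cl" assume s: "smooth_on V \<Phi>" "smooth_on V \<Psi>"
    note sp = neg.smooth_pull[OF s(1)] neg.smooth_pull[OF s(2)]
    have "der x (P x u) (?p (\<lambda>y. \<Phi> y + \<Psi> y)) = der x (P x u) (\<lambda>y. ?p \<Phi> y + ?p \<Psi> y)"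
      by (rule der_cong[OF x smooth_on_add[OF V sp] ps(1)])
    then show "pull (j x) (der x (P x u) (?p (\<lambda>y. \<Phi> y + \<Psi> y))) =
        pull (j x) (der x (P x u) (?p \<Phi>)) + pull (j x) (der x (P x u) (?p \<Psi>))"
      by (simp only: der_add[OF x sp] pull_simps[OF linj])
    have "?p (\<lambda>y. \<Phi> y * \<Psi> y) y = ?p \<Phi> y * ?p \<Psi> y" if "y \<in> V" for y
      by (rule pull_mult[OF neg.linj[OF that] complex_structure.orth[OF neg.cs[OF that]]])
    then have "der x (P x u) (?p (\<lambda>y. \<Phi> y * \<Psi> y)) = der x (P x u) (\<lambda>y. ?p \<Phi> y * ?p \<Psi> y)"
      by (rule der_cong[OF x smooth_on_cl_mult[OF V sp]])
    then show "pull (j x) (der x (P x u) (?p (\<lambda>y. \<Phi> y * \<Psi> y))) =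
        pull (j x) (der x (P x u) (?p \<Phi>)) * \<Psi> x + \<Phi> x * pull (j x) (der x (P x u) (?p \<Psi>))"
      by (simp only: der_mult[OF x sp] pull_simps[OF linj] pull_mult[OF linj on] inv)
  next
    fix h :: "'e \<Rightarrow> complex" and \<Phi> :: "'e \<Rightarrow> 'e cl" assume s: "smooth_on V h" "smooth_on V \<Phi>"
    note sp = neg.smooth_pull[OF s(2)]
    have "der x (P x u) (?p (\<lambda>y. h y *C \<Phi> y)) = der x (P x u) (\<lambda>y. h y *C ?p \<Phi> y)"
      by (rule der_cong[OF x smooth_on_csc[OF V s(1) sp] ps(2)])
    then show "pull (j x) (der x (P x u) (?p (\<lambda>y. h y *C \<Phi> y))) =
        pd h x (P x u) *C \<Phi> x + h x *C pull (j x) (der x (P x u) (?p \<Phi>))"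
      by (simp only: der_csc[OF x s(1) sp] pull_simps[OF linj] inv)
  qed
  have E': "cl_derivation V x (P x u) (\<lambda>\<Phi>. der x (P x u) \<Phi> + comm (spn (tors x u)) (\<Phi> x))"
    by (simp add: cl_derivation_def der_add[OF x] der_mult[OF x] der_csc[OF x] comm_simps comm_cl_simps comm_mult
        algebra_simps)
  show ?thesis
  proof (rule cl_derivation_eqI[OF V x E E' _ \<Phi>])
    fix w
    have "?p (\<lambda>y. clv w) y = clv (j y w)" if "y \<in> V" for y
      using pull_clv[OF neg.linj[OF that] complex_structure.orth[OF neg.cs[OF that]], of "j y w"]
        complex_structure.jj[OF cs[OF that]] by simp
    then have "der x (P x u) (?p (\<lambda>y. clv w)) = der x (P x u) (\<lambda>y. clv (j y w))"
      by (rule der_cong[OF x smooth_on_clv[OF V smj]])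
    also have "\<dots> = clv (pd (\<lambda>y. j y w) x (P x u) + conn x (P x u) (j x w))"
      by (rule der_clv[OF x smj])
    also have "\<dots> = clv (j x (tors x u w + conn x (P x u) w))"
      by (simp add: tors_def linear_diff[OF linj] jj) (simp add: A_def algebra_simps)
    finally have "pull (j x) (der x (P x u) (?p (\<lambda>y. clv w))) = clv (tors x u w + conn x (P x u) w)"
      by (simp only: pull_clv[OF linj on])
    then show "pull (j x) (der x (P x u) (?p (\<lambda>y. clv w))) =
        der x (P x u) (\<lambda>y. clv w) + comm (spn (tors x u)) (clv w)"
      using der_clv[OF x smooth_on_const, of "P x u" w] by (simp add: comm_spn[OF linear_tors skew_tors])
  qed
qed

lemma pull_dirC:
  assumes \<Phi>: "smooth_on V \<Phi>"
  shows "pull (j x) (dirC (\<lambda>y. pull (\<lambda>v. - j y v) (\<Phi> y)) x) =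
    - (\<Sum>b\<in>Basis. clv (j x b) * (der x (P x b) \<Phi> + comm (spn (tors x b)) (\<Phi> x)))"
proof -
  have ps: "pull (j x) (sum F S) = (\<Sum>i\<in>S. pull (j x) (F i))" for F :: "'e \<Rightarrow> 'e cl" and S
    by (induction S rule: infinite_finite_induct) (simp_all add: pull_simps[OF linj])
  have "pull (j x) (clv b) = - clv (j x b)" for b
    using pull_clv[OF linj orth, of "- j x b"] by (simp add: linear_neg[OF linj] jj)
  then show ?thesis
    by (simp add: dirC_def ps pull_mult[OF linj orth] pull_der[OF \<Phi>] sum_negf)
qed

lemma DD_eq_dirC:
  assumes \<Phi>: "smooth_on V \<Phi>"
  shows "DD \<Phi> x = (1/2) *C (dirC \<Phi> x + \<i> *C pull (j x) (dirC (\<lambda>y. pull (\<lambda>v. - j y v) (\<Phi> y)) x))"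
  unfolding DD_def pull_dirC[OF \<Phi>] by (simp add: dirC_def sum_subtractf csc_sum sum_negf)

end

end

locale almost_kaehler_frame = almost_complex_frame V g P Q j
  for V :: "'e::euclidean_space set" and g P Q j +
  assumes cyclic_A: "\<And>x u v w. x \<in> V \<Longrightarrow> A x u v \<bullet> w + A x v w \<bullet> u + A x w u \<bullet> v = 0"
begin

lemma skew_torsion_A: "x \<in> V \<Longrightarrow> skew_torsion (j x) (A x)"
  by (intro skew_torsion.intro skew_torsion_axioms.intro cs linear_A A_j skew_A cyclic_A)

text \<open>\<open>A\<close> is odd in \<open>j\<close>, so the cyclic condition persists when the
  sign of \<open>j\<close> changes; \<open>tors\<close> is even, so the conjugated connection is the
  same for both signs.\<close>

lemma minus: "almost_kaehler_frame V g P Q (\<lambda>x v. - j x v)"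
  and tors_minus: "x \<in> V \<Longrightarrow> almost_complex_frame.tors g P Q (\<lambda>x v. - j x v) x = tors x"
proof -
  interpret neg: almost_complex_frame V g P Q "\<lambda>x v. - j x v" by (rule almost_complex_frame_minus)
  have A: "neg.A x u v = - A x u v" if x: "x \<in> V" for x u v
    using pd_bounded_linear[OF bounded_linear_minus[OF bounded_linear_ident] dj[OF x], of v "P x u"]
    by (simp add: neg.A_def A_def linear_neg[OF linear_conn(1)[OF x]])
  show "almost_kaehler_frame V g P Q (\<lambda>x v. - j x v)"
  proof
    show "neg.A x u v \<bullet> w + neg.A x v w \<bullet> u + neg.A x w u \<bullet> v = 0" if "x \<in> V" for x u v w
      using cyclic_A[OF that, of u v w] by (simp add: A[OF that])
  qed
  show "neg.tors x = tors x" if "x \<in> V"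
    by (simp add: fun_eq_iff neg.tors_def tors_def A[OF that] linear_neg[OF linj[OF that]])
qed

context
  fixes x assumes x: "x \<in> V"
begin

interpretation skew_torsion "j x" "A x" by (rule skew_torsion_A[OF x])

lemma tors_eq: "tors x = a"
  by (simp add: fun_eq_iff tors_def a_def)

lemma DD_eq: "DD \<Phi> x = (\<Sum>b\<in>Basis. e b * hder x b \<Phi>) - (1/2) *\<^sub>R B (\<Phi> x)"
proof -
  \<comment> \<open>The split of \<open>- \<i> *C clv (j x b)\<close> into \<open>e b - f b\<close>,
    which distributes the conjugation term over \<open>hder\<close> and \<open>B\<close>.\<close>
  have *: "(1/2) *C (clv b * d - \<i> *C (clv (j x b) * (d + k))) = e b * (d + (1/2) *\<^sub>R k) - (1/2) *\<^sub>R (f b * k)" for b d k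
    unfolding epsC_def epsC_bar_def by (simp add: algebra_simps) (intro cl_eqI, simp)
  show ?thesis
    unfolding DD_def csc_sum B_def hder_def[OF x] tors_eq scaleR_sum_right sum_subtractf[symmetric]
    by (intro sum.cong refl *)
qed

lemma LC_sum: "LC (j x) (sum F S) = (\<Sum>i\<in>S. LC (j x) (F i))" "LC_bar (j x) (sum F S) = (\<Sum>i\<in>S. LC_bar (j x) (F i))"
  using LC_csc[of 0] by (induction S rule: infinite_finite_induct) (simp_all add: LC_add)

lemma LC_diff_scale: "LC (j x) (y - r *\<^sub>R z) = LC (j x) y - r *\<^sub>R LC (j x) z"
  "LC_bar (j x) (y - r *\<^sub>R z) = LC_bar (j x) y - r *\<^sub>R LC_bar (j x) z"
  using LC_add[of y "of_real (- r) *C z"] LC_csc[of "of_real (- r)" z] by simp_all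

lemma hder_LC_bar:
  assumes "smooth_on V \<Phi>"
  shows "hder x u (\<lambda>y. LC_bar (j y) (\<Phi> y)) = LC_bar (j x) (hder x u \<Phi>)"
proof -
  interpret neg: almost_complex_frame V g P Q "\<lambda>x v. - j x v" by (rule almost_complex_frame_minus)
  show ?thesis
    using neg.hder_LC[OF x assms, of u] by (simp add: hder_def[OF x] neg.hder_def[OF x] tors_minus[OF x] LC_minus)
qed

text \<open>\<open>LC\<close> commutes with \<open>hder\<close> and changes sign across
  \<open>e b\<close>, so the derivative terms cancel in pairs and only the statement about
  \<open>B\<close> is left.\<close>

lemma anticommute_DD_LC:
  assumes \<Phi>: "smooth_on V \<Phi>"
  shows "DD (\<lambda>y. LC (j y) (\<Phi> y)) x + LC (j x) (DD \<Phi> x) = 0"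
proof -
  have "DD (\<lambda>y. LC (j y) (\<Phi> y)) x + LC (j x) (DD \<Phi> x) = - (1/2) *\<^sub>R (B (LC (j x) (\<Phi> x)) + LC (j x) (B (\<Phi> x)))"
    by (simp add: DD_eq LC_diff_scale LC_sum LC_e_mult hder_LC[OF x \<Phi>] sum_negf scaleR_add_right)
  then show ?thesis
    by (simp add: B_LC)
qed

text \<open>The derivative terms leave \<open>hder x b \<Phi> * e b\<close>, which is
  \<open>e b\<close> times the derivative with the factors reversed; \<open>hder_tr\<close> and
  \<open>B_LC_bar\<close> identify the whole with the transposed operator.\<close>

lemma anticommute_DD_LC_bar:
  assumes \<Phi>: "smooth_on V \<Phi>"
  shows "DD (\<lambda>y. LC_bar (j y) (\<Phi> y)) x + LC_bar (j x) (DD \<Phi> x) = tr (DD (\<lambda>y. tr (\<Phi> y)) x)"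
proof -
  have tre: "tr (e v) = e v" for v
    by (simp add: epsC_def)
  have "DD (\<lambda>y. LC_bar (j y) (\<Phi> y)) x + LC_bar (j x) (DD \<Phi> x) =
      (\<Sum>b\<in>Basis. hder x b \<Phi> * e b) - (1/2) *\<^sub>R (B (LC_bar (j x) (\<Phi> x)) + LC_bar (j x) (B (\<Phi> x)))"
    by (simp add: DD_eq LC_diff_scale LC_sum LC_bar_e_mult hder_LC_bar[OF \<Phi>] sum_subtractf scaleR_add_right)
  also have "\<dots> = tr (DD (\<lambda>y. tr (\<Phi> y)) x)"
    by (simp add: DD_eq B_LC_bar tr_sum tr_mult tre hder_tr[OF x \<Phi>])
  finally show ?thesis .
qed

lemma DD_cong: "smooth_on V \<Psi> \<Longrightarrow> (\<And>y. y \<in> V \<Longrightarrow> \<Phi> y = \<Psi> y) \<Longrightarrow> DD \<Phi> x = DD \<Psi> x"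
  using der_cong[OF x, of \<Psi> \<Phi>] x by (simp add: DD_def)

lemma DD_diff:
  assumes \<Phi>: "smooth_on V \<Phi>" and \<Psi>: "smooth_on V \<Psi>"
  shows "DD (\<lambda>y. \<Phi> y - \<Psi> y) x = DD \<Phi> x - DD \<Psi> x"
proof -
  have d: "der x u (\<lambda>y. \<Phi> y - \<Psi> y) = der x u \<Phi> - der x u \<Psi>" for u
    using der_add[OF x smooth_on_diff[OF V \<Phi> \<Psi>] \<Psi>, of u] by (simp add: eq_diff_eq)
  show ?thesis
    unfolding DD_def csc_simps(2)[symmetric] sum_subtractf[symmetric]
    by (intro arg_cong[of _ _ "(*C) _"] sum.cong refl) (simp add: d comm_simps algebra_simps)
qed

end

lemma smooth_LC_bar: "smooth_on V \<Phi> \<Longrightarrow> smooth_on V (\<lambda>x. LC_bar (j x) (\<Phi> x))"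
  using almost_complex_frame.smooth_LC[OF almost_complex_frame_minus] by (simp add: LC_minus)

text \<open>Write D, L, M for the operators \<open>DD\<close>, \<open>LC\<close>,
  \<open>LC_bar\<close> and D' for the transposed D. The anticommutators give LMD = LD' + DLM and
  MLD = DML - D'L, so the commutator equals LD' + D'L. Transposition turns this into MD + DM = D',
  whose transpose is D.\<close>

lemma commutator_DD:
  assumes x: "x \<in> V" and \<Phi>: "smooth_on V \<Phi>"
  shows "LC (j x) (LC_bar (j x) (DD \<Phi> x)) - LC_bar (j x) (LC (j x) (DD \<Phi> x)) -
    DD (\<lambda>y. LC (j y) (LC_bar (j y) (\<Phi> y)) - LC_bar (j y) (LC (j y) (\<Phi> y))) x = DD \<Phi> x"
proof -
  interpret C: complex_structure "j x" by (rule cs[OF x])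
  let ?L = "\<lambda>\<Phi> y. LC (j y) (\<Phi> y)" and ?M = "\<lambda>\<Phi> y. LC_bar (j y) (\<Phi> y)"
  note sL = smooth_LC[OF \<Phi>] and sM = smooth_LC_bar[OF \<Phi>] and sT = smooth_on_tr[OF V \<Phi>]
  note lin = LC_diff_scale[OF x, of _ 1, simplified]
  have 1: "?M (DD \<Phi>) x = tr (DD (\<lambda>y. tr (\<Phi> y)) x) - DD (?M \<Phi>) x"
    using anticommute_DD_LC_bar[OF x \<Phi>] by (simp add: eq_diff_eq add.commute)
  have 2: "?L (DD \<Psi>) x = - DD (?L \<Psi>) x" if "smooth_on V \<Psi>" for \<Psi>
    using anticommute_DD_LC[OF x that] by (simp add: eq_neg_iff_add_eq_0 add.commute)
  have 3: "?M (DD (?L \<Phi>)) x = tr (DD (\<lambda>y. tr (?L \<Phi> y)) x) - DD (?M (?L \<Phi>)) x"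
    using anticommute_DD_LC_bar[OF x sL] by (simp add: eq_diff_eq add.commute)
  have "DD (\<lambda>y. tr (?L \<Phi> y)) x = DD (?M (\<lambda>y. tr (\<Phi> y))) x"
    by (rule DD_cong[OF x smooth_LC_bar[OF sT]]) (rule complex_structure.tr_LC[OF cs])
  moreover have "DD (?M (\<lambda>y. tr (\<Phi> y))) x + ?M (DD (\<lambda>y. tr (\<Phi> y))) x = tr (DD \<Phi> x)"
    using anticommute_DD_LC_bar[OF x sT] by simp
  then have "tr (DD (?M (\<lambda>y. tr (\<Phi> y))) x) + tr (?M (DD (\<lambda>y. tr (\<Phi> y))) x) = DD \<Phi> x"
    by (metis tr_simps(1) tr_simps(7))
  ultimately have 4: "LC (j x) (tr (DD (\<lambda>y. tr (\<Phi> y)) x)) + tr (DD (\<lambda>y. tr (?L \<Phi> y)) x) = DD \<Phi> x"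
    by (simp add: C.tr_LC add.commute)
  have m: "LC_bar (j x) (- y) = - LC_bar (j x) y" for y
    using C.LC_csc(2)[of "- 1" y] by simp
  have 5: "LC (j x) (LC_bar (j x) (DD \<Phi> x)) = LC (j x) (tr (DD (\<lambda>y. tr (\<Phi> y)) x)) + DD (?L (?M \<Phi>)) x"
    using 1 2[OF sM] by (simp add: lin)
  have 6: "LC_bar (j x) (LC (j x) (DD \<Phi> x)) = DD (?M (?L \<Phi>)) x - tr (DD (\<lambda>y. tr (?L \<Phi> y)) x)"
    using 2[OF \<Phi>] 3 by (simp add: m)
  have 7: "DD (\<lambda>y. ?L (?M \<Phi>) y - ?M (?L \<Phi>) y) x = DD (?L (?M \<Phi>)) x - DD (?M (?L \<Phi>)) x"
    by (rule DD_diff[OF x smooth_LC[OF sM] smooth_LC_bar[OF sL]])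
  show ?thesis
    by (simp only: 5 6 7) (simp add: 4[symmetric])
qed

end

section \<open>Passage to a chart\<close>

text \<open>d\<omega> on constant fields is an alternating sum of derivatives of
  \<open>g (J v) w\<close>. Metric compatibility splits each into a \<nabla>J term and Christoffel
  terms; the latter cancel since the connection is torsion free, leaving the cyclic sum of
  \<nabla>J.\<close>

lemma ex_almost_kaehler_frame:
  fixes g :: "'e::euclidean_space metric" and J :: "'e endo"
  assumes V: "open V" and ip: "\<And>x. x \<in> V \<Longrightarrow> inner_prod (g x)"
    and smg: "\<And>u v. smooth_on V (\<lambda>x. g x u v)"
    and linJ: "\<And>x. x \<in> V \<Longrightarrow> linear (J x)" and JJ: "\<And>x u. x \<in> V \<Longrightarrow> J x (J x u) = - u"
    and smJ: "\<And>u. smooth_on V (\<lambda>x. J x u)"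
    and gJ: "\<And>x u v. x \<in> V \<Longrightarrow> g x (J x u) (J x v) = g x u v"
    and d\<omega>: "\<And>x ws. x \<in> V \<Longrightarrow> ext_deriv (fundamental_form g J) x ws = 0"
  shows "\<exists>P Q. almost_kaehler_frame V g P Q (\<lambda>x v. Q x (J x (P x v)))"
proof -
  obtain P Q where "metric_frame V g P Q"
    using ex_metric_frame[OF V ip smg] by blast
  then interpret metric_frame V g P Q .
  define j where "j = (\<lambda>x v. Q x (J x (P x v)))"
  have smJP: "smooth_on V (\<lambda>x. J x (P x v))" for v
    by (rule smooth_on_linear_family[OF V linJ smJ smP])
  have smj: "smooth_on V (\<lambda>x. j x v)" for v
    unfolding j_def by (rule smooth_on_linear_family[OF V linQ smQ smJP])
  have cs: "complex_structure (j x)" if x: "x \<in> V" for x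
  proof
    note l = linear_add[OF linP[OF x]] linear_add[OF linQ[OF x]] linear_add[OF linJ[OF x]]
      linear_scale[OF linP[OF x]] linear_scale[OF linQ[OF x]] linear_scale[OF linJ[OF x]]
    show "j x (b1 + b2) = j x b1 + j x b2" "j x (r *\<^sub>R b) = r *\<^sub>R j x b" for b1 b2 r b
      by (simp_all add: j_def l)
    show "j x (j x u) = - u" for u
      by (simp add: j_def PQ[OF x] JJ[OF x] linear_neg[OF linQ[OF x]] QP[OF x])
    show "j x u \<bullet> j x v = u \<bullet> v" for u v
      by (simp add: j_def orthonormal_iso.QQ[OF iso[OF x]] gJ[OF x] gPP[OF x])
  qed
  interpret almost_complex_frame V g P Q j
    by (intro almost_complex_frame.intro almost_complex_frame_axioms.intro metric_frame_axioms cs smj)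
  have "A x u v \<bullet> w + A x v w \<bullet> u + A x w u \<bullet> v = 0" if x: "x \<in> V" for x u v w
  proof -
    define \<Gamma> where "\<Gamma> = christoffel g x"
    \<comment> \<open>The covariant derivative of J in coordinates, in direction \<open>u\<close>
      and applied to \<open>v\<close>; the frame map \<open>P\<close> carries \<open>A\<close> to
      it, as \<open>PA\<close> shows.\<close>
    define D where "D = (\<lambda>u v. pd (\<lambda>y. J y v) x u + \<Gamma> u (J x v) - J x (\<Gamma> u v))"
    have \<Gamma>: "\<Gamma> u v = \<Gamma> v u" for u v
      unfolding \<Gamma>_def by (rule christoffel(2)[OF x])
    note gl = bilinear_ladd[OF bl[OF x]] bilinear_lsub[OF bl[OF x]]
    have skewJ: "g x (J x u) v = - g x u (J x v)" for u v
      using gJ[OF x, of "J x u" v] by (simp add: JJ[OF x] bilinear_lneg[OF bl[OF x]])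
    have PA: "P x (A x u v) = D (P x u) (P x v)" for u v
    proof -
      have "levi_civita g (P x u) (\<lambda>y. P y (j y v)) x = levi_civita g (P x u) (\<lambda>y. J y (P y v)) x"
        using pd_cong[OF V x, of "\<lambda>y. P y (j y v)" "\<lambda>y. J y (P y v)"] smooth_on_differentiable[OF smJP x]
        by (simp add: levi_civita_def j_def PQ x)
      then have 1: "P x (pd (\<lambda>y. j y v) x (P x u) + conn x (P x u) (j x v)) =
          pd (\<lambda>y. J y (P y v)) x (P x u) + \<Gamma> (P x u) (J x (P x v))"
        unfolding levi_civita_frame[OF x smj] by (simp add: levi_civita_def \<Gamma>_def)
      have 2: "pd (\<lambda>y. J y (P y v)) x (P x u) =
          pd (\<lambda>y. J y (P x v)) x (P x u) + J x (pd (\<lambda>y. P y v) x (P x u))"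
        by (rule pd_linear_family[OF V x linJ smJ smP])
      have 3: "P x (j x (conn x (P x u) v)) = J x (pd (\<lambda>y. P y v) x (P x u)) + J x (\<Gamma> (P x u) (P x v))"
        by (simp add: j_def conn_def levi_civita_def PQ[OF x] linear_add[OF linJ[OF x]] \<Gamma>_def)
      show ?thesis
        unfolding A_def linear_diff[OF linP[OF x]] 1 2 3 D_def by simp
    qed
    have A: "A x u v \<bullet> w = g x (D (P x u) (P x v)) (P x w)" for u v w
      by (simp add: PA[symmetric] gPP[OF x])
    have d: "pd (\<lambda>y. g y (J y v) w) x u = g x (D u v) w + g x (J x (\<Gamma> u v)) w + g x (J x v) (\<Gamma> u w)" for u v w
      using levi_civita_metric[OF x smJ smooth_on_const, of v w u]
      by (simp add: levi_civita_def D_def gl \<Gamma>_def)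
    have ff: "(\<lambda>y. fundamental_form g J y [v, w]) = (\<lambda>y. g y (J y v) w)" for v w
      by (simp add: fundamental_form_def)
    have "g x (D u v) w + g x (D v w) u + g x (D w u) v = 0" for u v w
    proof -
      \<comment> \<open>The middle term of the exterior derivative has a minus sign and the order v,
        u, w; skewness makes it the missing cyclic term.\<close>
      have skewD: "g x (D v u) w = - g x (D v w) u"
      proof -
        have "pd (\<lambda>y. g y (J y u) w) x v = pd (\<lambda>y. - g y (J y w) u) x v"
        proof (rule pd_cong[OF V x])
          show "g y (J y u) w = - g y (J y w) u" if "y \<in> V" for y
            using gJ[OF that, of "J y u" w] g_sym[OF that, of u "J y w"]
            by (simp add: JJ[OF that] bilinear_lneg[OF bl[OF that]])
          show "(\<lambda>y. - g y (J y w) u) differentiable (at x)"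
            by (intro differentiable_minus smooth_on_differentiable[OF _ x] smooth_on_bilinear_family[OF V bl smg smJ smooth_on_const])
        qed
        also have "\<dots> = - pd (\<lambda>y. g y (J y w) u) x v"
          by (intro pd_bounded_linear[OF bounded_linear_minus[OF bounded_linear_ident]]
              smooth_on_differentiable[OF _ x] smooth_on_bilinear_family[OF V bl smg smJ smooth_on_const])
        finally show ?thesis
          unfolding d using skewJ[of "\<Gamma> v u" w] skewJ[of "\<Gamma> v w" u] g_sym[OF x, of "\<Gamma> v u" "J x w"] g_sym[OF x, of "\<Gamma> v w" "J x u"]
          by simp
      qed
      have "ext_deriv (fundamental_form g J) x [u, v, w] =
          pd (\<lambda>y. g y (J y v) w) x u - pd (\<lambda>y. g y (J y u) w) x v + pd (\<lambda>y. g y (J y u) v) x w"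
        by (simp add: ext_deriv_def remove_nth_def ff lessThan_Suc numeral_3_eq_3)
      then have "g x (D u v) w - g x (D v u) w + g x (D w u) v = 0"
        using d\<omega>[OF x, of "[u, v, w]"] unfolding d
        using skewJ[of "\<Gamma> u v" w] skewJ[of "\<Gamma> u w" v] skewJ[of "\<Gamma> v w" u]
          g_sym[OF x, of "\<Gamma> u v" "J x w"] g_sym[OF x, of "\<Gamma> u w" "J x v"] g_sym[OF x, of "\<Gamma> v w" "J x u"]
        by (simp add: \<Gamma>[of v u] \<Gamma>[of w u] \<Gamma>[of w v])
      then show ?thesis
        using skewD by simp
    qed
    then show ?thesis
      unfolding A by blast
  qed
  then have "almost_kaehler_frame V g P Q j"
    by unfold_locales
  then show ?thesis
    unfolding j_def by blast
qed

theorem proposition7p7: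
  fixes X :: "'p topology"
    and A :: "('p, 'e::euclidean_space) chart set"
    and g :: "('p, 'e) chart \<Rightarrow> 'e metric"
    and J :: "('p, 'e) chart \<Rightarrow> 'e endo"
  assumes "almost_kaehler X A g J"
  shows "eq_on_sections A (anticommutator (D_op g J) (L_op g J)) (\<lambda>\<phi>. 0) \<and>
         eq_on_sections A (anticommutator (D_bar_op g J) (L_bar_op g J)) (\<lambda>\<phi>. 0) \<and>
         eq_on_sections A (anticommutator (D_op g J) (L_bar_op g J)) (op_star g (D_op g J)) \<and>
         eq_on_sections A (anticommutator (D_bar_op g J) (L_op g J)) (op_star g (D_bar_op g J)) \<and>
         eq_on_sections A (commutator (H_op g J) (D_op g J)) (D_op g J)"
proof -
  have "anticommutator (D_op g J) (L_op g J) \<phi> c x = 0 \<and>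
      anticommutator (D_bar_op g J) (L_bar_op g J) \<phi> c x = 0 \<and>
      anticommutator (D_op g J) (L_bar_op g J) \<phi> c x = op_star g (D_op g J) \<phi> c x \<and>
      anticommutator (D_bar_op g J) (L_op g J) \<phi> c x = op_star g (D_bar_op g J) \<phi> c x \<and>
      commutator (H_op g J) (D_op g J) \<phi> c x = D_op g J \<phi> c x"
    if \<phi>: "\<phi> \<in> sections A" and c: "c \<in> A" and x: "x \<in> target c" for \<phi> c x
  proof -
    let ?V = "target c"
    have "open ?V"
      using assms c by (simp add: almost_kaehler_def smooth_manifold_def)
    moreover have "\<And>x. x \<in> ?V \<Longrightarrow> inner_prod (g c x)" "\<And>u v. smooth_on ?V (\<lambda>x. g c x u v)"
      using assms c by (auto simp: almost_kaehler_def riemannian_metric_def)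
    moreover have linJ: "\<And>x. x \<in> ?V \<Longrightarrow> linear (J c x)" and JJ: "\<And>x u. x \<in> ?V \<Longrightarrow> J c x (J c x u) = - u"
      and "\<And>u. smooth_on ?V (\<lambda>x. J c x u)"
      using assms c by (auto simp: almost_kaehler_def almost_complex_structure_def)
    moreover have gJ: "\<And>x u v. x \<in> ?V \<Longrightarrow> g c x (J c x u) (J c x v) = g c x u v"
      and "\<And>x ws. x \<in> ?V \<Longrightarrow> ext_deriv (fundamental_form (g c) (J c)) x ws = 0"
      using assms c by (auto simp: almost_kaehler_def)
    ultimately have "\<exists>P Q. almost_kaehler_frame ?V (g c) P Q (\<lambda>x v. Q x (J c x (P x v)))"
      by (rule ex_almost_kaehler_frame)
    then obtain P Q where frame: "almost_kaehler_frame ?V (g c) P Q (\<lambda>x v. Q x (J c x (P x v)))"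
      by blast
    define j where "j = (\<lambda>x v. Q x (J c x (P x v)))"
    have j: "j x v = Q x (J c x (P x v))" for x v
      by (simp add: j_def)
    interpret almost_kaehler_frame ?V "g c" P Q j
      using frame by (simp only: j_def)
    interpret neg: almost_kaehler_frame ?V "g c" P Q "\<lambda>x v. - j x v" by (rule minus)
    \<comment> \<open>\<open>\<Psi>\<close> represents the field \<open>\<psi>\<close> over the
      domain of \<open>c\<close> alone. This suffices because the value of each operator in the
      chart \<open>c\<close> depends only on the field in that chart.\<close>
    define rep where "rep = (\<lambda>(\<psi> :: ('p, 'e) cl_field) \<Psi>. \<forall>y\<in>?V. \<psi> c y = fromC (Q y) (\<Psi> y))"
    have fibre: "L_fibre (g c y) (J c y) (fromC (Q y) z) = fromC (Q y) (LC (j y) z)"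
      "L_bar_fibre (g c y) (J c y) (fromC (Q y) z) = fromC (Q y) (LC_bar (j y) z)"
      "J_alg (g c y) (J c y) (fromC (Q y) z) = fromC (Q y) (pull (\<lambda>v. - j y v) z)"
      "J_alg_inv (g c y) (J c y) (fromC (Q y) z) = fromC (Q y) (pull (j y) z)"
      if y: "y \<in> ?V" for y z
    proof -
      interpret F: orthonormal_iso "g c y" "P y" "Q y" by (rule iso[OF y])
      show "L_fibre (g c y) (J c y) (fromC (Q y) z) = fromC (Q y) (LC (j y) z)"
        by (rule F.L_fibre_fromC[of "j y" "J c y", OF j linJ[OF y] JJ[OF y] gJ[OF y]])
      show "L_bar_fibre (g c y) (J c y) (fromC (Q y) z) = fromC (Q y) (LC_bar (j y) z)"
        by (rule F.L_bar_fibre_fromC[of "j y" "J c y", OF j linJ[OF y] JJ[OF y] gJ[OF y]])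
      show "J_alg (g c y) (J c y) (fromC (Q y) z) = fromC (Q y) (pull (\<lambda>v. - j y v) z)"
        by (rule F.J_alg_fromC[of "j y" "J c y", OF j linJ[OF y] JJ[OF y] gJ[OF y]])
      show "J_alg_inv (g c y) (J c y) (fromC (Q y) z) = fromC (Q y) (pull (j y) z)"
        by (rule F.J_alg_inv_fromC[of "j y" "J c y", OF j linJ[OF y] JJ[OF y] gJ[OF y]])
    qed
    have rep_L: "rep (L_op g J \<psi>) (\<lambda>y. LC (j y) (\<Psi> y))" and rep_M: "rep (L_bar_op g J \<psi>) (\<lambda>y. LC_bar (j y) (\<Psi> y))"
      if "rep \<psi> \<Psi>" for \<psi> \<Psi>
      using that by (simp_all add: rep_def L_op_def L_bar_op_def fibre)
    have rep_star: "rep (star g \<psi>) (\<lambda>y. tr (\<Psi> y))" if "rep \<psi> \<Psi>" for \<psi> \<Psi>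
      using that by (simp add: rep_def star_def orthonormal_iso.transposition_fromC[OF iso])
    have rep_arith: "rep (\<psi> + \<psi>') (\<lambda>y. \<Psi> y + \<Psi>' y)" "rep (\<psi> - \<psi>') (\<lambda>y. \<Psi> y - \<Psi>' y)"
      "rep (fscale s \<psi>) (\<lambda>y. s *C \<Psi> y)"
      if "rep \<psi> \<Psi>" "rep \<psi>' \<Psi>'" for \<psi> \<psi>' \<Psi> \<Psi>' s
      using that by (simp_all add: rep_def fscale_def orthonormal_iso.fromC_simps[OF iso])
    have rep_dirac: "rep (dirac g \<psi>) (dirC \<Psi>)" if r: "rep \<psi> \<Psi>" and s: "smooth_on ?V \<Psi>" for \<psi> \<Psi>
      unfolding rep_def
    proof
      fix y assume y: "y \<in> ?V"
      have "smooth_form_on ?V (\<psi> c)"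
        using r by (intro smooth_form_on_cong[OF smooth_fromC[OF s]]) (simp add: rep_def)
      from dirac_on_eq[OF this y]
      have "dirac g \<psi> c y = fromC (Q y) (dirC (\<lambda>y. toC (P y) (\<psi> c y)) y)"
        by (simp add: dirac_def)
      also have "dirC (\<lambda>y. toC (P y) (\<psi> c y)) y = dirC \<Psi> y"
        using r der_cong[OF y s, of "\<lambda>y. toC (P y) (\<psi> c y)"]
        by (simp add: dirC_def rep_def orthonormal_iso.toC_fromC[OF iso])
      finally show "dirac g \<psi> c y = fromC (Q y) (dirC \<Psi> y)" .
    qed
    have rep_c: "rep (op_c g J (dirac g) \<psi>) (\<lambda>y. pull (j y) (dirC (\<lambda>y. pull (\<lambda>v. - j y v) (\<Psi> y)) y))"
      if r: "rep \<psi> \<Psi>" and s: "smooth_on ?V \<Psi>" for \<psi> \<Psi>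
    proof -
      have "rep (\<lambda>c x. J_alg (g c x) (J c x) (\<psi> c x)) (\<lambda>y. pull (\<lambda>v. - j y v) (\<Psi> y))"
        using r by (simp add: rep_def fibre)
      from rep_dirac[OF this neg.smooth_pull[OF s]] show ?thesis
        by (simp add: rep_def op_c_def fibre)
    qed
    have rep_D: "rep (D_op g J \<psi>) (DD \<Psi>)" and rep_D_bar: "rep (D_bar_op g J \<psi>) (neg.DD \<Psi>)"
      if r: "rep \<psi> \<Psi>" and s: "smooth_on ?V \<Psi>" for \<psi> \<Psi>
    proof -
      note d = rep_dirac[OF r s] and dc = rep_arith(3)[OF rep_c[OF r s] rep_c[OF r s], of \<i>]
      show "rep (D_op g J \<psi>) (DD \<Psi>)"
        using rep_arith(3)[OF rep_arith(1)[OF d dc] d, of "1/2"] DD_eq_dirC[OF _ s]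
        by (simp add: rep_def D_op_def)
      have "neg.DD \<Psi> y = (1/2) *C (dirC \<Psi> y - \<i> *C pull (j y) (dirC (\<lambda>y. pull (\<lambda>v. - j y v) (\<Psi> y)) y))"
        if y: "y \<in> ?V" for y
        unfolding neg.DD_def pull_dirC[OF y s] tors_minus[OF y]
        by (simp add: dirC_def sum.distrib csc_sum sum_negf)
      then show "rep (D_bar_op g J \<psi>) (neg.DD \<Psi>)"
        using rep_arith(3)[OF rep_arith(2)[OF d dc] d, of "1/2"]
        by (simp add: rep_def D_bar_op_def)
    qed
    define \<Phi> where "\<Phi> = (\<lambda>y. toC (P y) (\<phi> c y))"
    have sf: "smooth_form_on ?V (\<phi> c)"
      using \<phi> c by (simp add: sections_def)
    have s: "smooth_on ?V \<Phi>" and r: "rep \<phi> \<Phi>"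
      using smooth_toC[OF sf] fromC_toC[OF _ sf] by (simp_all add: \<Phi>_def rep_def)
    note sL = smooth_LC[OF s] and sM = smooth_LC_bar[OF s] and sT = smooth_on_tr[OF V s]
    note rL = rep_L[OF r] and rM = rep_M[OF r] and rT = rep_star[OF r]
    note rD = rep_D[OF r s] and rE = rep_D_bar[OF r s]
    have rep_eq: "\<psi> c x = \<psi>' c x" if "rep \<psi> \<Psi>" "rep \<psi>' \<Psi>'" "\<Psi> x = \<Psi>' x" for \<psi> \<psi>' \<Psi> \<Psi>'
      using that x by (simp add: rep_def)
    have zero: "rep 0 (\<lambda>y. 0)"
      by (simp add: rep_def orthonormal_iso.fromC_simps[OF iso])
    note star_D = rep_star[OF rep_D[OF rT sT]] and star_D_bar = rep_star[OF rep_D_bar[OF rT sT]]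
    have "(D_op g J (L_op g J \<phi>) + L_op g J (D_op g J \<phi>)) c x = (0 :: ('p, 'e) cl_field) c x"
      by (rule rep_eq[OF rep_arith(1)[OF rep_D[OF rL sL] rep_L[OF rD]] zero anticommute_DD_LC[OF x s]])
    moreover have "(D_bar_op g J (L_bar_op g J \<phi>) + L_bar_op g J (D_bar_op g J \<phi>)) c x = (0 :: ('p, 'e) cl_field) c x"
      by (rule rep_eq[OF rep_arith(1)[OF rep_D_bar[OF rM sM] rep_M[OF rE]] zero])
        (use neg.anticommute_DD_LC[OF x s] in \<open>simp add: LC_minus\<close>)
    moreover have "(D_op g J (L_bar_op g J \<phi>) + L_bar_op g J (D_op g J \<phi>)) c x = star g (D_op g J (star g \<phi>)) c x"
      by (rule rep_eq[OF rep_arith(1)[OF rep_D[OF rM sM] rep_M[OF rD]] star_D anticommute_DD_LC_bar[OF x s]])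
    moreover have "(D_bar_op g J (L_op g J \<phi>) + L_op g J (D_bar_op g J \<phi>)) c x = star g (D_bar_op g J (star g \<phi>)) c x"
      by (rule rep_eq[OF rep_arith(1)[OF rep_D_bar[OF rL sL] rep_L[OF rE]] star_D_bar])
        (use neg.anticommute_DD_LC_bar[OF x s] in \<open>simp add: LC_minus\<close>)
    moreover have "(L_op g J (L_bar_op g J (D_op g J \<phi>)) - L_bar_op g J (L_op g J (D_op g J \<phi>)) -
        D_op g J (L_op g J (L_bar_op g J \<phi>) - L_bar_op g J (L_op g J \<phi>))) c x = D_op g J \<phi> c x"
      by (rule rep_eq[OF rep_arith(2)[OF rep_arith(2)[OF rep_L[OF rep_M[OF rD]] rep_M[OF rep_L[OF rD]]]
            rep_D[OF rep_arith(2)[OF rep_L[OF rM] rep_M[OF rL]]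
              smooth_on_diff[OF V smooth_LC[OF sM] smooth_LC_bar[OF sL]]]] rD commutator_DD[OF x s]])
    ultimately show ?thesis
      by (simp add: anticommutator_def commutator_def H_op_def op_star_def)
  qed
  then show ?thesis
    by (simp add: eq_on_sections_def)
qed

end
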